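(* For any finite set $X$ let $\mathbb{D}_X$ be the $\mathbf{k}$-vector space with basis the pairs $(\mathcal{T},Y)$, where $\mathcal{T}$ is a topology on $X$ and $Y\in\mathcal{T}$ (i.e. $Y$ is open for $\mathcal{T}$). Equip the species $\mathbb{D}$ with the product $$m:\mathbb{D}_{X_1}\otimes\mathbb{D}_{X_2}\to\mathbb{D}_{X_1\sqcup X_2},\qquad (\mathcal{T}_1,Y_1)(\mathcal{T}_2,Y_2)=(\mathcal{T}_1\mathcal{T}_2,\,Y_1\sqcup Y_2),$$ with unit $\mathbf{1}=(\{\emptyset\},\emptyset)\in\mathbb{D}_\emptyset$, with the coproduct $$\Delta:\mathbb{D}_X\to(\mathbb{D}\otimes\mathbb{D})_X=\bigoplus_{Z\subset X}\mathbb{D}_Z\otimes\mathbb{D}_{X\setminus Z},\qquad \Delta(\mathcal{T},Y)=\sum_{Z\in\mathcal{T}_{|Y}}(\mathcal{T}_{|Z},Z)\otimes(\mathcal{T}_{|X\setminus Z},\,Y\setminus Z),$$ and with the grading $d(\mathcal{T},Y)=|Y|$. Then $\mathbb{D}$ is a commutative graded connected bimonoid, and $\mathcal{D}=\overline{\mathcal{K}}(\mathbb{D})$, with the induced operations, is a commutative graded bialgebra.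
   Context: $\mathbf{k}$ is a field. A topology on a finite set $X$ is identified with its family $\mathcal{T}$ of open subsets. For $Y\subset X$, $\mathcal{T}_{|Y}=\{Z\cap Y: Z\in\mathcal{T}\}$ is the restriction. For topologies $\mathcal{T}_1$ on $X_1$ and $\mathcal{T}_2$ on $X_2$, $\mathcal{T}_1\mathcal{T}_2$ is the disjoint union topology on $X_1\sqcup X_2$: $Y\in\mathcal{T}_1\mathcal{T}_2$ iff $Y\cap X_1\in\mathcal{T}_1$ and $Y\cap X_2\in\mathcal{T}_2$. A linear species is a contravariant functor from the category of finite sets with bijections to $\mathbf{k}$-vector spaces; here bijections act by relabelling. The tensor product of species is $(\mathbb{E}\otimes\mathbb{F})_X=\bigoplus_{Y\sqcup Z=X}\mathbb{E}_Y\otimes\mathbb{F}_Z$. The bosonic Fock functor is $\overline{\mathcal{K}}(\mathbb{E})=\bigoplus_{n\ge0}\mathbb{E}_{\{1,\dots,n\}}/S_n$ (coinvariants under the symmetric group $S_n$); operations on species induce operations on the corresponding vector spaces. "Bimonoid" and "bialgebra" are here understood without counit: the product is associative and unital, the coproduct is coassociative, and they are compatible, i.e. $\Delta(ab)=\Delta(a)\Delta(b)$, where the product on the right-hand side is $(a_1\otimes a_2)(b_1\otimes b_2)=a_1b_1\otimes a_2b_2$, and $\Delta(\mathbf{1})=\mathbf{1}\otimes\mathbf{1}$. Graded means that product and coproduct preserve the degree $d$ (total degree on tensor products). Connected, for a species, means that $\mathbb{D}_\emptyset$ is one-dimensional, spanned by the unit. *)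

theory Defs
  imports
    "HOL-Analysis.Abstract_Topology"
    "HOL-Algebra.Module"
    "HOL-Algebra.QuotRing"
begin

section \<open>Linear algebra on module records\<close>

text \<open>
  Vector spaces over a field \<open>K\<close> are modules over \<open>K\<close> in the sense of HOL-Algebra.  The record type
  of modules extends that of rings, so the fields for multiplication and unit are left
  \<^const>\<open>undefined\<close> wherever no algebra structure is meant.
\<close>

definition linear_maps ::
    "('k, 'm) ring_scheme \<Rightarrow> ('k, 'v, 'p) module_scheme \<Rightarrow> ('k, 'w, 'q) module_scheme \<Rightarrow> ('v \<Rightarrow> 'w) set"
  where "linear_maps K V W =
    {f \<in> carrier V \<rightarrow> carrier W.
       (\<forall>x\<in>carrier V. \<forall>y\<in>carrier V. f (x \<oplus>\<^bsub>V\<^esub> y) = f x \<oplus>\<^bsub>W\<^esub> f y) \<and>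
       (\<forall>c\<in>carrier K. \<forall>x\<in>carrier V. f (c \<odot>\<^bsub>V\<^esub> x) = c \<odot>\<^bsub>W\<^esub> f x)}"

definition bilinear_maps ::
    "('k, 'm) ring_scheme \<Rightarrow> ('k, 'u, 'p) module_scheme \<Rightarrow> ('k, 'v, 'q) module_scheme \<Rightarrow>
      ('k, 'w, 'r) module_scheme \<Rightarrow> ('u \<Rightarrow> 'v \<Rightarrow> 'w) set"
  where "bilinear_maps K U V W =
    {\<beta>. (\<forall>u\<in>carrier U. \<beta> u \<in> linear_maps K V W) \<and>
        (\<forall>v\<in>carrier V. (\<lambda>u. \<beta> u v) \<in> linear_maps K U W)}"

definition lin_span ::
    "('k, 'm) ring_scheme \<Rightarrow> ('k, 'v, 'p) module_scheme \<Rightarrow> 'v set \<Rightarrow> 'v set"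
  where "lin_span K V S = \<Inter>{N. submodule N K V \<and> S \<subseteq> N}"

text \<open>Elements of the free module on \<open>B\<close> are extended by zero outside \<open>B\<close>.\<close>

definition free_module :: "('k, 'm) ring_scheme \<Rightarrow> 'b set \<Rightarrow> ('k, 'b \<Rightarrow> 'k) module"
  where "free_module K B =
    \<lparr>carrier = {f. range f \<subseteq> carrier K \<and> finite {b. f b \<noteq> \<zero>\<^bsub>K\<^esub>} \<and> {b. f b \<noteq> \<zero>\<^bsub>K\<^esub>} \<subseteq> B},
     mult = undefined, one = undefined,
     zero = (\<lambda>_. \<zero>\<^bsub>K\<^esub>), add = (\<lambda>f g b. f b \<oplus>\<^bsub>K\<^esub> g b),
     smult = (\<lambda>c f b. c \<otimes>\<^bsub>K\<^esub> f b)\<rparr>"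

definition basis_vec :: "('k, 'm) ring_scheme \<Rightarrow> 'b \<Rightarrow> 'b \<Rightarrow> 'k"
  where "basis_vec K b = (\<lambda>c. if c = b then \<one>\<^bsub>K\<^esub> else \<zero>\<^bsub>K\<^esub>)"

definition lin_ext ::
    "('k, 'm) ring_scheme \<Rightarrow> ('k, 'v, 'p) module_scheme \<Rightarrow> ('b \<Rightarrow> 'v) \<Rightarrow> ('b \<Rightarrow> 'k) \<Rightarrow> 'v"
  where "lin_ext K V \<phi> f = (\<Oplus>\<^bsub>V\<^esub>b\<in>{b. f b \<noteq> \<zero>\<^bsub>K\<^esub>}. f b \<odot>\<^bsub>V\<^esub> \<phi> b)"

definition quotient_module :: "('k, 'v, 'p) module_scheme \<Rightarrow> 'v set \<Rightarrow> ('k, 'v set) module"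
  where "quotient_module V N =
    \<lparr>carrier = a_rcosets\<^bsub>V\<^esub> N, mult = undefined, one = undefined,
     zero = N, add = set_add V,
     smult = (\<lambda>c A. \<Union>x\<in>A. N +>\<^bsub>V\<^esub> (c \<odot>\<^bsub>V\<^esub> x))\<rparr>"

definition direct_sum ::
    "'i set \<Rightarrow> ('i \<Rightarrow> ('k, 'v, 'p) module_scheme) \<Rightarrow> ('k, 'i \<Rightarrow> 'v) module"
  where "direct_sum I V =
    \<lparr>carrier = {f \<in> \<Pi>\<^sub>E i\<in>I. carrier (V i). finite {i \<in> I. f i \<noteq> \<zero>\<^bsub>V i\<^esub>}},
     mult = undefined, one = undefined,
     zero = (\<lambda>i\<in>I. \<zero>\<^bsub>V i\<^esub>), add = (\<lambda>f g. \<lambda>i\<in>I. f i \<oplus>\<^bsub>V i\<^esub> g i),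
     smult = (\<lambda>c f. \<lambda>i\<in>I. c \<odot>\<^bsub>V i\<^esub> f i)\<rparr>"

definition ds_inj ::
    "'i set \<Rightarrow> ('i \<Rightarrow> ('k, 'v, 'p) module_scheme) \<Rightarrow> 'i \<Rightarrow> 'v \<Rightarrow> 'i \<Rightarrow> 'v"
  where "ds_inj I V j x = (\<lambda>i\<in>I. if i = j then x else \<zero>\<^bsub>V i\<^esub>)"


subsection \<open>Tensor products\<close>

text \<open>The tensor product is the free module on pairs modulo the bilinearity relations.\<close>

definition tensor_rel ::
    "('k, 'm) ring_scheme \<Rightarrow> ('k, 'v, 'p) module_scheme \<Rightarrow> ('k, 'w, 'q) module_scheme \<Rightarrow>
      ('v \<times> 'w \<Rightarrow> 'k) set"
  where "tensor_rel K V W =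
    (let F = free_module K (carrier V \<times> carrier W); e = (\<lambda>v w. basis_vec K (v, w)) in
     lin_span K F
       ({e (v \<oplus>\<^bsub>V\<^esub> v') w \<ominus>\<^bsub>F\<^esub> (e v w \<oplus>\<^bsub>F\<^esub> e v' w) | v v' w.
            v \<in> carrier V \<and> v' \<in> carrier V \<and> w \<in> carrier W} \<union>
        {e v (w \<oplus>\<^bsub>W\<^esub> w') \<ominus>\<^bsub>F\<^esub> (e v w \<oplus>\<^bsub>F\<^esub> e v w') | v w w'.
            v \<in> carrier V \<and> w \<in> carrier W \<and> w' \<in> carrier W} \<union>
        {e (c \<odot>\<^bsub>V\<^esub> v) w \<ominus>\<^bsub>F\<^esub> (c \<odot>\<^bsub>F\<^esub> e v w) | c v w.
            c \<in> carrier K \<and> v \<in> carrier V \<and> w \<in> carrier W} \<union>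
        {e v (c \<odot>\<^bsub>W\<^esub> w) \<ominus>\<^bsub>F\<^esub> (c \<odot>\<^bsub>F\<^esub> e v w) | c v w.
            c \<in> carrier K \<and> v \<in> carrier V \<and> w \<in> carrier W}))"

definition tensor ::
    "('k, 'm) ring_scheme \<Rightarrow> ('k, 'v, 'p) module_scheme \<Rightarrow> ('k, 'w, 'q) module_scheme \<Rightarrow>
      ('k, ('v \<times> 'w \<Rightarrow> 'k) set) module"
  where "tensor K V W =
    quotient_module (free_module K (carrier V \<times> carrier W)) (tensor_rel K V W)"

definition pure_tensor ::
    "('k, 'm) ring_scheme \<Rightarrow> ('k, 'v, 'p) module_scheme \<Rightarrow> ('k, 'w, 'q) module_scheme \<Rightarrow>
      'v \<Rightarrow> 'w \<Rightarrow> ('v \<times> 'w \<Rightarrow> 'k) set"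
  where "pure_tensor K V W v w =
    tensor_rel K V W +>\<^bsub>free_module K (carrier V \<times> carrier W)\<^esub> basis_vec K (v, w)"

text \<open>
  The linear map on a tensor product induced by a bilinear map \<open>\<beta>\<close> into \<open>U\<close>.  Its argument \<open>t\<close> is a
  coset of formal combinations of pairs, and bilinearity of \<open>\<beta>\<close> makes the image below a singleton.
\<close>

definition tensor_lift ::
    "('k, 'm) ring_scheme \<Rightarrow> ('k, 'u, 'p) module_scheme \<Rightarrow> ('v \<Rightarrow> 'w \<Rightarrow> 'u) \<Rightarrow>
      ('v \<times> 'w \<Rightarrow> 'k) set \<Rightarrow> 'u"
  where "tensor_lift K U \<beta> t = the_elem (lin_ext K U (\<lambda>(v, w). \<beta> v w) ` t)"

definition tensor_map ::
    "('k, 'm) ring_scheme \<Rightarrow> ('k, 'v, 'p) module_scheme \<Rightarrow> ('k, 'w, 'q) module_scheme \<Rightarrow>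
      ('v0 \<Rightarrow> 'v) \<Rightarrow> ('w0 \<Rightarrow> 'w) \<Rightarrow> ('v0 \<times> 'w0 \<Rightarrow> 'k) set \<Rightarrow> ('v \<times> 'w \<Rightarrow> 'k) set"
  where "tensor_map K V W f g =
    tensor_lift K (tensor K V W) (\<lambda>v w. pure_tensor K V W (f v) (g w))"

text \<open>The canonical isomorphism from \<open>(U \<otimes> V) \<otimes> W\<close> to \<open>U \<otimes> (V \<otimes> W)\<close>.\<close>

definition tensor_assoc ::
    "('k, 'm) ring_scheme \<Rightarrow> ('k, 'u, 'p) module_scheme \<Rightarrow> ('k, 'v, 'q) module_scheme \<Rightarrow>
      ('k, 'w, 'r) module_scheme \<Rightarrow>
      (('u \<times> 'v \<Rightarrow> 'k) set \<times> 'w \<Rightarrow> 'k) set \<Rightarrow> ('u \<times> ('v \<times> 'w \<Rightarrow> 'k) set \<Rightarrow> 'k) set"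
  where "tensor_assoc K U V W =
    (let T = tensor K U (tensor K V W) in
     tensor_lift K T (\<lambda>t w. tensor_lift K T
       (\<lambda>u v. pure_tensor K U (tensor K V W) u (pure_tensor K V W v w)) t))"

text \<open>The product \<open>(a \<otimes> b)(a' \<otimes> b') = \<mu> a a' \<otimes> \<nu> b b'\<close> with values in \<open>V \<otimes> W\<close>.\<close>

definition tensor_mult ::
    "('k, 'm) ring_scheme \<Rightarrow> ('k, 'v, 'p) module_scheme \<Rightarrow> ('k, 'w, 'q) module_scheme \<Rightarrow>
      ('v1 \<Rightarrow> 'v2 \<Rightarrow> 'v) \<Rightarrow> ('w1 \<Rightarrow> 'w2 \<Rightarrow> 'w) \<Rightarrow>
      ('v1 \<times> 'w1 \<Rightarrow> 'k) set \<Rightarrow> ('v2 \<times> 'w2 \<Rightarrow> 'k) set \<Rightarrow> ('v \<times> 'w \<Rightarrow> 'k) set"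
  where "tensor_mult K V W \<mu> \<nu> s t =
    tensor_lift K (tensor K V W)
      (\<lambda>a b. tensor_lift K (tensor K V W)
         (\<lambda>a' b'. pure_tensor K V W (\<mu> a a') (\<nu> b b')) t) s"


subsection \<open>Gradings\<close>

definition graded_module ::
    "('k, 'm) ring_scheme \<Rightarrow> ('k, 'v, 'p) module_scheme \<Rightarrow> (nat \<Rightarrow> 'v set) \<Rightarrow> bool"
  where "graded_module K V G \<longleftrightarrow>
    (\<forall>n. submodule (G n) K V) \<and>
    (\<forall>x\<in>carrier V. \<exists>!h. (\<forall>n. h n \<in> G n) \<and> finite {n. h n \<noteq> \<zero>\<^bsub>V\<^esub>} \<and>
        x = (\<Oplus>\<^bsub>V\<^esub>n\<in>{n. h n \<noteq> \<zero>\<^bsub>V\<^esub>}. h n))"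

definition tensor_grading ::
    "('k, 'm) ring_scheme \<Rightarrow> ('k, 'v, 'p) module_scheme \<Rightarrow> ('k, 'w, 'q) module_scheme \<Rightarrow>
      (nat \<Rightarrow> 'v set) \<Rightarrow> (nat \<Rightarrow> 'w set) \<Rightarrow> nat \<Rightarrow> ('v \<times> 'w \<Rightarrow> 'k) set set"
  where "tensor_grading K V W G H n =
    lin_span K (tensor K V W) {pure_tensor K V W v w | v w i j. v \<in> G i \<and> w \<in> H j \<and> i + j = n}"


section \<open>Linear species\<close>

text \<open>
  The category of finite sets and bijections is represented by the finite subsets of a type \<open>'a\<close>.
  For a bijection \<open>\<sigma>\<close> from \<open>X\<close> to \<open>X'\<close>, \<open>sp_map E X X' \<sigma>\<close> is the induced (contravariant) map from
  \<open>sp_obj E X'\<close> to \<open>sp_obj E X\<close>; as \<open>\<sigma>\<close> is a total function, only its values on \<open>X\<close> may matter.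
\<close>

record ('a, 'k, 'v) species =
  sp_obj :: "'a set \<Rightarrow> ('k, 'v) module"
  sp_map :: "'a set \<Rightarrow> 'a set \<Rightarrow> ('a \<Rightarrow> 'a) \<Rightarrow> 'v \<Rightarrow> 'v"

definition linear_species ::
    "('k, 'm) ring_scheme \<Rightarrow> ('a, 'k, 'v, 'z) species_scheme \<Rightarrow> bool"
  where "linear_species K E \<longleftrightarrow>
    (\<forall>X. finite X \<longrightarrow> module K (sp_obj E X)) \<and>
    (\<forall>X X' \<sigma>. finite X \<and> bij_betw \<sigma> X X' \<longrightarrow>
       sp_map E X X' \<sigma> \<in> linear_maps K (sp_obj E X') (sp_obj E X)) \<and>
    (\<forall>X X' \<sigma> \<tau>. finite X \<and> bij_betw \<sigma> X X' \<and> (\<forall>i\<in>X. \<sigma> i = \<tau> i) \<longrightarrow>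
       (\<forall>v\<in>carrier (sp_obj E X'). sp_map E X X' \<sigma> v = sp_map E X X' \<tau> v)) \<and>
    (\<forall>X. finite X \<longrightarrow> (\<forall>v\<in>carrier (sp_obj E X). sp_map E X X id v = v)) \<and>
    (\<forall>X X' X'' \<sigma> \<tau>. finite X \<and> bij_betw \<sigma> X X' \<and> bij_betw \<tau> X' X'' \<longrightarrow>
       (\<forall>v\<in>carrier (sp_obj E X'').
          sp_map E X X'' (\<tau> \<circ> \<sigma>) v = sp_map E X X' \<sigma> (sp_map E X' X'' \<tau> v)))"

definition species_tensor ::
    "('k, 'm) ring_scheme \<Rightarrow> ('a, 'k, 'v, 'y) species_scheme \<Rightarrow> ('a, 'k, 'w, 'z) species_scheme \<Rightarrow>
      ('a, 'k, 'a set \<Rightarrow> ('v \<times> 'w \<Rightarrow> 'k) set) species"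
  where "species_tensor K E F =
    \<lparr>sp_obj = (\<lambda>X. direct_sum (Pow X) (\<lambda>Z. tensor K (sp_obj E Z) (sp_obj F (X - Z)))),
     sp_map = (\<lambda>X X' \<sigma> t. \<lambda>Z\<in>Pow X.
       tensor_map K (sp_obj E Z) (sp_obj F (X - Z))
         (sp_map E Z (\<sigma> ` Z) \<sigma>) (sp_map F (X - Z) (X' - \<sigma> ` Z) \<sigma>) (t (\<sigma> ` Z)))\<rparr>"


subsection \<open>Bimonoids in species\<close>

text \<open>
  The product from \<open>(E \<otimes> E)\<^sub>X\<close> is given by its components on \<open>E\<^sub>Y \<otimes> E\<^sub>Z\<close>, for \<open>X\<close> the disjoint union
  of \<open>Y\<close> and \<open>Z\<close>, written as bilinear maps \<open>sp_mult E Y Z\<close>.  The coproduct \<open>sp_comult E X\<close> takes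
  values in the direct sum \<open>(E \<otimes> E)\<^sub>X\<close>; the component of \<open>sp_comult E X x\<close> in
  \<open>E\<^sub>Z \<otimes> E\<^bsub>X - Z\<^esub>\<close> is \<open>sp_comult E X x Z\<close>.
\<close>

record ('a, 'k, 'v) bimon_species = "('a, 'k, 'v) species" +
  sp_mult :: "'a set \<Rightarrow> 'a set \<Rightarrow> 'v \<Rightarrow> 'v \<Rightarrow> 'v"
  sp_unit :: "'v"
  sp_comult :: "'a set \<Rightarrow> 'v \<Rightarrow> 'a set \<Rightarrow> ('v \<times> 'v \<Rightarrow> 'k) set"

definition species_monoid ::
    "('k, 'm) ring_scheme \<Rightarrow> ('a, 'k, 'v, 'z) bimon_species_scheme \<Rightarrow> bool"
  where "species_monoid K E \<longleftrightarrow>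
    linear_species K E \<and>
    (\<forall>X Y. finite X \<and> finite Y \<and> X \<inter> Y = {} \<longrightarrow>
       sp_mult E X Y \<in> bilinear_maps K (sp_obj E X) (sp_obj E Y) (sp_obj E (X \<union> Y))) \<and>
    (\<forall>X Y X' Y' \<sigma>. finite X \<and> finite Y \<and> X \<inter> Y = {} \<and> X' \<inter> Y' = {} \<and>
         bij_betw \<sigma> X X' \<and> bij_betw \<sigma> Y Y' \<longrightarrow>
       (\<forall>a\<in>carrier (sp_obj E X'). \<forall>b\<in>carrier (sp_obj E Y').
          sp_map E (X \<union> Y) (X' \<union> Y') \<sigma> (sp_mult E X' Y' a b) =
          sp_mult E X Y (sp_map E X X' \<sigma> a) (sp_map E Y Y' \<sigma> b))) \<and>
    (\<forall>X Y Z. finite X \<and> finite Y \<and> finite Z \<and> X \<inter> Y = {} \<and> X \<inter> Z = {} \<and> Y \<inter> Z = {} \<longrightarrow>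
       (\<forall>a\<in>carrier (sp_obj E X). \<forall>b\<in>carrier (sp_obj E Y). \<forall>c\<in>carrier (sp_obj E Z).
          sp_mult E (X \<union> Y) Z (sp_mult E X Y a b) c =
          sp_mult E X (Y \<union> Z) a (sp_mult E Y Z b c))) \<and>
    sp_unit E \<in> carrier (sp_obj E {}) \<and>
    (\<forall>X. finite X \<longrightarrow> (\<forall>a\<in>carrier (sp_obj E X).
       sp_mult E {} X (sp_unit E) a = a \<and> sp_mult E X {} a (sp_unit E) = a))"

definition species_comonoid_no_counit ::
    "('k, 'm) ring_scheme \<Rightarrow> ('a, 'k, 'v, 'z) bimon_species_scheme \<Rightarrow> bool"
  where "species_comonoid_no_counit K E \<longleftrightarrow>
    linear_species K E \<and>
    (\<forall>X. finite X \<longrightarrow>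
       sp_comult E X \<in> linear_maps K (sp_obj E X) (sp_obj (species_tensor K E E) X)) \<and>
    (\<forall>X X' \<sigma>. finite X \<and> bij_betw \<sigma> X X' \<longrightarrow>
       (\<forall>x\<in>carrier (sp_obj E X').
          sp_comult E X (sp_map E X X' \<sigma> x) =
          sp_map (species_tensor K E E) X X' \<sigma> (sp_comult E X' x))) \<and>
    (\<forall>X Y Z. finite X \<and> finite Y \<and> finite Z \<and> X \<inter> Y = {} \<and> X \<inter> Z = {} \<and> Y \<inter> Z = {} \<longrightarrow>
       (\<forall>x\<in>carrier (sp_obj E (X \<union> Y \<union> Z)).
          tensor_assoc K (sp_obj E X) (sp_obj E Y) (sp_obj E Z)
            (tensor_map K (tensor K (sp_obj E X) (sp_obj E Y)) (sp_obj E Z)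
               (\<lambda>y. sp_comult E (X \<union> Y) y X) id
               (sp_comult E (X \<union> Y \<union> Z) x (X \<union> Y))) =
          tensor_map K (sp_obj E X) (tensor K (sp_obj E Y) (sp_obj E Z))
            id (\<lambda>y. sp_comult E (Y \<union> Z) y Y)
            (sp_comult E (X \<union> Y \<union> Z) x X)))"

text \<open>
  In the compatibility \<open>\<Delta>(ab) = \<Delta>(a)\<Delta>(b)\<close>, the component in \<open>E\<^sub>Z \<otimes> E\<^bsub>(X \<union> Y) - Z\<^esub>\<close> of the right-hand
  side only involves the components of \<open>\<Delta>(a)\<close> and \<open>\<Delta>(b)\<close> at \<open>Z \<inter> X\<close> and \<open>Z \<inter> Y\<close>.
\<close>

definition bimonoid_no_counit ::
    "('k, 'm) ring_scheme \<Rightarrow> ('a, 'k, 'v, 'z) bimon_species_scheme \<Rightarrow> bool"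
  where "bimonoid_no_counit K E \<longleftrightarrow>
    species_monoid K E \<and> species_comonoid_no_counit K E \<and>
    (\<forall>X Y. finite X \<and> finite Y \<and> X \<inter> Y = {} \<longrightarrow>
       (\<forall>a\<in>carrier (sp_obj E X). \<forall>b\<in>carrier (sp_obj E Y). \<forall>Z\<in>Pow (X \<union> Y).
          sp_comult E (X \<union> Y) (sp_mult E X Y a b) Z =
          tensor_mult K (sp_obj E Z) (sp_obj E (X \<union> Y - Z))
            (sp_mult E (Z \<inter> X) (Z \<inter> Y)) (sp_mult E (X - Z) (Y - Z))
            (sp_comult E X a (Z \<inter> X)) (sp_comult E Y b (Z \<inter> Y)))) \<and>
    sp_comult E {} (sp_unit E) {} =
      pure_tensor K (sp_obj E {}) (sp_obj E {}) (sp_unit E) (sp_unit E)"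

definition species_commutative :: "('a, 'k, 'v, 'z) bimon_species_scheme \<Rightarrow> bool"
  where "species_commutative E \<longleftrightarrow>
    (\<forall>X Y. finite X \<and> finite Y \<and> X \<inter> Y = {} \<longrightarrow>
       (\<forall>a\<in>carrier (sp_obj E X). \<forall>b\<in>carrier (sp_obj E Y).
          sp_mult E X Y a b = sp_mult E Y X b a))"

definition species_connected ::
    "('k, 'm) ring_scheme \<Rightarrow> ('a, 'k, 'v, 'z) bimon_species_scheme \<Rightarrow> bool"
  where "species_connected K E \<longleftrightarrow>
    sp_unit E \<noteq> \<zero>\<^bsub>sp_obj E {}\<^esub> \<and>
    carrier (sp_obj E {}) = {c \<odot>\<^bsub>sp_obj E {}\<^esub> sp_unit E | c. c \<in> carrier K}"

definition species_graded ::
    "('k, 'm) ring_scheme \<Rightarrow> ('a, 'k, 'v, 'z) bimon_species_scheme \<Rightarrow>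
      ('a set \<Rightarrow> nat \<Rightarrow> 'v set) \<Rightarrow> bool"
  where "species_graded K E G \<longleftrightarrow>
    (\<forall>X. finite X \<longrightarrow> graded_module K (sp_obj E X) (G X)) \<and>
    (\<forall>X X' \<sigma> n. finite X \<and> bij_betw \<sigma> X X' \<longrightarrow> sp_map E X X' \<sigma> ` G X' n \<subseteq> G X n) \<and>
    (\<forall>X Y i j. finite X \<and> finite Y \<and> X \<inter> Y = {} \<longrightarrow>
       (\<forall>a\<in>G X i. \<forall>b\<in>G Y j. sp_mult E X Y a b \<in> G (X \<union> Y) (i + j))) \<and>
    sp_unit E \<in> G {} 0 \<and>
    (\<forall>X n. finite X \<longrightarrow>
       (\<forall>x\<in>G X n. \<forall>Z\<in>Pow X.
          sp_comult E X x Z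
            \<in> tensor_grading K (sp_obj E Z) (sp_obj E (X - Z)) (G Z) (G (X - Z)) n))"


section \<open>Bialgebras\<close>

definition tensor_algebra ::
    "('k, 'm) ring_scheme \<Rightarrow> ('k, 'v, 'p) module_scheme \<Rightarrow> ('k, 'w, 'q) module_scheme \<Rightarrow>
      ('k, ('v \<times> 'w \<Rightarrow> 'k) set) module"
  where "tensor_algebra K A B = (tensor K A B)
    \<lparr>mult := tensor_mult K A B (mult A) (mult B),
     one := pure_tensor K A B \<one>\<^bsub>A\<^esub> \<one>\<^bsub>B\<^esub>\<rparr>"

definition bialgebra_no_counit ::
    "('k, 'm) ring_scheme \<Rightarrow> ('k, 'v, 'p) module_scheme \<Rightarrow>
      ('v \<Rightarrow> ('v \<times> 'v \<Rightarrow> 'k) set) \<Rightarrow> bool"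
  where "bialgebra_no_counit K A \<Delta> \<longleftrightarrow>
    module K A \<and> ring A \<and> mult A \<in> bilinear_maps K A A A \<and>
    \<Delta> \<in> linear_maps K A (tensor K A A) \<and>
    (\<forall>a\<in>carrier A.
       tensor_assoc K A A A (tensor_map K (tensor K A A) A \<Delta> id (\<Delta> a)) =
       tensor_map K A (tensor K A A) id \<Delta> (\<Delta> a)) \<and>
    \<Delta> \<in> ring_hom A (tensor_algebra K A A)"

definition bialgebra_graded ::
    "('k, 'm) ring_scheme \<Rightarrow> ('k, 'v, 'p) module_scheme \<Rightarrow>
      ('v \<Rightarrow> ('v \<times> 'v \<Rightarrow> 'k) set) \<Rightarrow> (nat \<Rightarrow> 'v set) \<Rightarrow> bool"
  where "bialgebra_graded K A \<Delta> G \<longleftrightarrow>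
    graded_module K A G \<and>
    (\<forall>i j. \<forall>a\<in>G i. \<forall>b\<in>G j. a \<otimes>\<^bsub>A\<^esub> b \<in> G (i + j)) \<and> \<one>\<^bsub>A\<^esub> \<in> G 0 \<and>
    (\<forall>n. \<forall>a\<in>G n. \<Delta> a \<in> tensor_grading K A A G G n)"


section \<open>The bosonic Fock functor\<close>

definition coinv_rel ::
    "('k, 'm) ring_scheme \<Rightarrow> (nat, 'k, 'v, 'z) species_scheme \<Rightarrow> nat \<Rightarrow> 'v set"
  where "coinv_rel K E n =
    lin_span K (sp_obj E {1..n})
      {v \<ominus>\<^bsub>sp_obj E {1..n}\<^esub> sp_map E {1..n} {1..n} \<sigma> v | v \<sigma>.
         v \<in> carrier (sp_obj E {1..n}) \<and> bij_betw \<sigma> {1..n} {1..n}}"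

definition coinvariants ::
    "('k, 'm) ring_scheme \<Rightarrow> (nat, 'k, 'v, 'z) species_scheme \<Rightarrow> nat \<Rightarrow> ('k, 'v set) module"
  where "coinvariants K E n = quotient_module (sp_obj E {1..n}) (coinv_rel K E n)"

definition fock ::
    "('k, 'm) ring_scheme \<Rightarrow> (nat, 'k, 'v, 'z) species_scheme \<Rightarrow> ('k, nat \<Rightarrow> 'v set) module"
  where "fock K E = direct_sum UNIV (coinvariants K E)"

text \<open>
  The class in the Fock space of an element of \<open>sp_obj E X\<close>, for an arbitrary finite set \<open>X\<close> of naturals:
  transport it to \<open>{1..card X}\<close> along the increasing bijection (any other gives the same class).
\<close>

definition fock_class ::
    "('k, 'm) ring_scheme \<Rightarrow> (nat, 'k, 'v, 'z) species_scheme \<Rightarrow> nat set \<Rightarrow> 'v \<Rightarrow> nat \<Rightarrow> 'v set"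
  where "fock_class K E X x =
    ds_inj UNIV (coinvariants K E) (card X)
      (coinv_rel K E (card X) +>\<^bsub>sp_obj E {1..card X}\<^esub>
         sp_map E {1..card X} X (\<lambda>i. sorted_list_of_set X ! (i - 1)) x)"

text \<open>
  The operations induced on the Fock space.  The components \<open>f n\<close> are cosets, and naturality of the
  operations on the species makes the images below singletons.  To multiply the classes of
  \<open>a \<in> E\<^bsub>{1..k}\<^esub>\<close> and \<open>b \<in> E\<^bsub>{1..l}\<^esub>\<close>, \<open>b\<close> is first transported to \<open>{k+1..k+l}\<close>.
\<close>

definition fock_mult ::
    "('k, 'm) ring_scheme \<Rightarrow> (nat, 'k, 'v, 'z) bimon_species_scheme \<Rightarrow>
      (nat \<Rightarrow> 'v set) \<Rightarrow> (nat \<Rightarrow> 'v set) \<Rightarrow> nat \<Rightarrow> 'v set"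
  where "fock_mult K E f g =
    (\<Oplus>\<^bsub>fock K E\<^esub>k\<in>{k. f k \<noteq> \<zero>\<^bsub>coinvariants K E k\<^esub>}.
      \<Oplus>\<^bsub>fock K E\<^esub>l\<in>{l. g l \<noteq> \<zero>\<^bsub>coinvariants K E l\<^esub>}.
        the_elem ((\<lambda>(a, b). fock_class K E {1..k + l}
          (sp_mult E {1..k} {k + 1..k + l} a
             (sp_map E {k + 1..k + l} {1..l} (\<lambda>i. i - k) b))) ` (f k \<times> g l)))"

definition fock_algebra ::
    "('k, 'm) ring_scheme \<Rightarrow> (nat, 'k, 'v, 'z) bimon_species_scheme \<Rightarrow> ('k, nat \<Rightarrow> 'v set) module"
  where "fock_algebra K E = (fock K E)
    \<lparr>mult := fock_mult K E, one := fock_class K E {} (sp_unit E)\<rparr>"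

definition fock_comult ::
    "('k, 'm) ring_scheme \<Rightarrow> (nat, 'k, 'v, 'z) bimon_species_scheme \<Rightarrow>
      (nat \<Rightarrow> 'v set) \<Rightarrow> ((nat \<Rightarrow> 'v set) \<times> (nat \<Rightarrow> 'v set) \<Rightarrow> 'k) set"
  where "fock_comult K E f =
    (\<Oplus>\<^bsub>tensor K (fock K E) (fock K E)\<^esub>n\<in>{n. f n \<noteq> \<zero>\<^bsub>coinvariants K E n\<^esub>}.
      the_elem ((\<lambda>x. \<Oplus>\<^bsub>tensor K (fock K E) (fock K E)\<^esub>Z\<in>Pow {1..n}.
        tensor_map K (fock K E) (fock K E) (fock_class K E Z) (fock_class K E ({1..n} - Z))
          (sp_comult E {1..n} x Z)) ` f n))"

definition fock_grading ::
    "('k, 'm) ring_scheme \<Rightarrow> (nat, 'k, 'v, 'z) species_scheme \<Rightarrow> (nat set \<Rightarrow> nat \<Rightarrow> 'v set) \<Rightarrow>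
      nat \<Rightarrow> (nat \<Rightarrow> 'v set) set"
  where "fock_grading K E G j =
    {f \<in> carrier (fock K E). \<forall>n. \<exists>x\<in>G {1..n} j.
       f n = coinv_rel K E n +>\<^bsub>sp_obj E {1..n}\<^esub> x}"


section \<open>The species of finite topologies with a marked open set\<close>

text \<open>
  The species \<open>DD\<close> has as basis of \<open>sp_obj (DD K) X\<close> the pairs \<open>(T, Y)\<close> of a topology on \<open>X\<close> and an open
  set; a bijection relabels such a pair by taking preimages.
\<close>

definition topology_disjoint_union :: "'a topology \<Rightarrow> 'a topology \<Rightarrow> 'a topology"
  where "topology_disjoint_union T1 T2 =
    topology (\<lambda>Y. Y \<subseteq> topspace T1 \<union> topspace T2 \<and>
      openin T1 (Y \<inter> topspace T1) \<and> openin T2 (Y \<inter> topspace T2))"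

definition marked_topologies :: "'a set \<Rightarrow> ('a topology \<times> 'a set) set"
  where "marked_topologies X = {(T, Y). topspace T = X \<and> openin T Y}"

definition DD_base ::
    "('k, 'm) ring_scheme \<Rightarrow> ('a, 'k, 'a topology \<times> 'a set \<Rightarrow> 'k) species"
  where "DD_base K =
    \<lparr>sp_obj = (\<lambda>X. free_module K (marked_topologies X)),
     sp_map = (\<lambda>X X' \<sigma>. lin_ext K (free_module K (marked_topologies X))
       (\<lambda>(T, Y). basis_vec K (pullback_topology X \<sigma> T, \<sigma> -` Y \<inter> X)))\<rparr>"

definition DD_mult ::
    "('k, 'm) ring_scheme \<Rightarrow> 'a set \<Rightarrow> 'a set \<Rightarrow>
      ('a topology \<times> 'a set \<Rightarrow> 'k) \<Rightarrow> ('a topology \<times> 'a set \<Rightarrow> 'k) \<Rightarrow> 'a topology \<times> 'a set \<Rightarrow> 'k"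
  where "DD_mult K X1 X2 a b =
    (let M = sp_obj (DD_base K) (X1 \<union> X2) in
     lin_ext K M (\<lambda>(T1, Y1). lin_ext K M (\<lambda>(T2, Y2).
       basis_vec K (topology_disjoint_union T1 T2, Y1 \<union> Y2)) b) a)"

definition DD_comult ::
    "('k, 'm) ring_scheme \<Rightarrow> 'a set \<Rightarrow> ('a topology \<times> 'a set \<Rightarrow> 'k) \<Rightarrow>
      'a set \<Rightarrow> (('a topology \<times> 'a set \<Rightarrow> 'k) \<times> ('a topology \<times> 'a set \<Rightarrow> 'k) \<Rightarrow> 'k) set"
  where "DD_comult K X =
    (let D = sp_obj (DD_base K); M = sp_obj (species_tensor K (DD_base K) (DD_base K)) X in
     lin_ext K M (\<lambda>(T, Y).
       \<Oplus>\<^bsub>M\<^esub>Z\<in>{Z. openin (subtopology T Y) Z}.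
         ds_inj (Pow X) (\<lambda>Z. tensor K (D Z) (D (X - Z))) Z
           (pure_tensor K (D Z) (D (X - Z))
              (basis_vec K (subtopology T Z, Z))
              (basis_vec K (subtopology T (X - Z), Y - Z)))))"

text \<open>The only topology on the empty set is \<^term>\<open>discrete_topology {}\<close>.\<close>

definition DD :: "('k, 'm) ring_scheme \<Rightarrow> ('a, 'k, 'a topology \<times> 'a set \<Rightarrow> 'k) bimon_species"
  where "DD K =
    \<lparr>sp_obj = sp_obj (DD_base K), sp_map = sp_map (DD_base K),
     sp_mult = DD_mult K,
     sp_unit = basis_vec K (discrete_topology {}, {}),
     sp_comult = DD_comult K\<rparr>"

definition DD_grading ::
    "('k, 'm) ring_scheme \<Rightarrow> 'a set \<Rightarrow> nat \<Rightarrow> ('a topology \<times> 'a set \<Rightarrow> 'k) set"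
  where "DD_grading K X n =
    carrier (free_module K {(T, Y) \<in> marked_topologies X. card Y = n})"

end

theory Submission
  imports Defs
begin

text \<open>
  A linear map is determined by its values on a spanning set.  Hence every identity in the species is
  checked on basis vectors (pure tensors of them, where tensor products occur), where it becomes an
  identity of topologies.  Both sides of coassociativity at a marked topology \<open>(T, M)\<close> and a
  decomposition of the underlying set into \<open>X\<close>, \<open>Y\<close>, \<open>Z\<close> are a single pure tensor or zero:
  \<open>X \<union> Y\<close> is open in \<open>T\<close> and \<open>X\<close> is open in \<open>X \<union> Y\<close> if and only if \<open>X\<close> is open
  in \<open>T\<close> and \<open>Y\<close> is open in \<open>Y \<union> Z\<close>.

  The Fock space is treated for an arbitrary bimonoid in species.  The class of an element of
  \<open>E[X]\<close> makes sense for every finite set \<open>X\<close> of naturals and is natural in \<open>X\<close>, so the classes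
  to be multiplied may be taken on pairwise disjoint sets, and the axioms of a bialgebra are the sums
  over subsets of the axioms of the bimonoid.
\<close>

section \<open>Linear maps and spanning sets\<close>

text \<open>The obstacle is that tensor products, coinvariants and the Fock space are concrete
  quotients, and that operations out of them are given by \<open>the_elem\<close> of an image of
  cosets, a formula from which neither well-definedness nor linearity can be read off. So each such
  formula is first recognized as a map induced by a universal property: \<open>tensor_lift\<close>
  for bilinear maps, \<open>fock_lift\<close> for families of linear maps invariant under the
  symmetric groups. A second difficulty is nesting: the associator, the product on a tensor product
  and the Fock product are lifts of lifts, whose inner lift depends on a parameter.
  \<open>linear_maps_param\<close> settles linearity in the parameter: each of its laws is an
  identity between linear maps in the remaining variable. For the grading of the Fock space the
  difficulty is that a homogeneous element is described by the existence of homogeneous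
  representatives, which is not visibly a linear condition; it is replaced by being fixed by a
  linear projection.\<close>

lemma module_cring: "module K V \<Longrightarrow> cring K"
  by (simp add: module_def)

lemma module_abelian_group: "module K V \<Longrightarrow> abelian_group V"
  by (simp add: module_def)

lemma linear_mapsI:
  assumes "\<And>x. x \<in> carrier V \<Longrightarrow> f x \<in> carrier W"
    and "\<And>x y. x \<in> carrier V \<Longrightarrow> y \<in> carrier V \<Longrightarrow> f (x \<oplus>\<^bsub>V\<^esub> y) = f x \<oplus>\<^bsub>W\<^esub> f y"
    and "\<And>c x. c \<in> carrier K \<Longrightarrow> x \<in> carrier V \<Longrightarrow> f (c \<odot>\<^bsub>V\<^esub> x) = c \<odot>\<^bsub>W\<^esub> f x"
  shows "f \<in> linear_maps K V W"
  using assms by (auto simp: linear_maps_def)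

lemma linear_maps_closed: "f \<in> linear_maps K V W \<Longrightarrow> x \<in> carrier V \<Longrightarrow> f x \<in> carrier W"
  by (auto simp: linear_maps_def)

lemma linear_maps_add:
  "f \<in> linear_maps K V W \<Longrightarrow> x \<in> carrier V \<Longrightarrow> y \<in> carrier V \<Longrightarrow> f (x \<oplus>\<^bsub>V\<^esub> y) = f x \<oplus>\<^bsub>W\<^esub> f y"
  by (auto simp: linear_maps_def)

lemma linear_maps_smult:
  "f \<in> linear_maps K V W \<Longrightarrow> c \<in> carrier K \<Longrightarrow> x \<in> carrier V \<Longrightarrow> f (c \<odot>\<^bsub>V\<^esub> x) = c \<odot>\<^bsub>W\<^esub> f x"
  by (auto simp: linear_maps_def)

lemma linear_maps_zero:
  assumes "module K V" "module K W" "f \<in> linear_maps K V W"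
  shows "f \<zero>\<^bsub>V\<^esub> = \<zero>\<^bsub>W\<^esub>"
proof -
  interpret V: module K V by fact
  interpret W: module K W by fact
  have "f (\<zero>\<^bsub>K\<^esub> \<odot>\<^bsub>V\<^esub> \<zero>\<^bsub>V\<^esub>) = \<zero>\<^bsub>K\<^esub> \<odot>\<^bsub>W\<^esub> f \<zero>\<^bsub>V\<^esub>"
    by (rule linear_maps_smult[OF assms(3)]) auto
  then show ?thesis
    using linear_maps_closed[OF assms(3)] by simp
qed

lemma linear_maps_a_inv:
  assumes "module K V" "module K W" "f \<in> linear_maps K V W" "x \<in> carrier V"
  shows "f (\<ominus>\<^bsub>V\<^esub> x) = \<ominus>\<^bsub>W\<^esub> f x"
proof -
  interpret V: module K V by fact
  interpret W: module K W by fact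
  note cl = linear_maps_closed[OF assms(3)]
  have "f (\<ominus>\<^bsub>V\<^esub> x) \<oplus>\<^bsub>W\<^esub> f x = \<zero>\<^bsub>W\<^esub>"
    using assms by (simp add: linear_maps_add[OF assms(3), symmetric] V.l_neg linear_maps_zero)
  then show ?thesis
    using assms cl by (simp add: W.minus_equality)
qed

lemma linear_maps_minus:
  assumes "module K V" "module K W" "f \<in> linear_maps K V W" "x \<in> carrier V" "y \<in> carrier V"
  shows "f (x \<ominus>\<^bsub>V\<^esub> y) = f x \<ominus>\<^bsub>W\<^esub> f y"
proof -
  interpret V: module K V by fact
  show ?thesis
    using assms by (simp add: a_minus_def linear_maps_add linear_maps_a_inv)
qed

lemma linear_maps_finsum:
  assumes "module K V" "module K W" "f \<in> linear_maps K V W" "\<And>i. i \<in> I \<Longrightarrow> g i \<in> carrier V"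
  shows "f (\<Oplus>\<^bsub>V\<^esub>i\<in>I. g i) = (\<Oplus>\<^bsub>W\<^esub>i\<in>I. f (g i))"
proof -
  interpret V: module K V by fact
  interpret W: module K W by fact
  note cl = linear_maps_closed[OF assms(3)]
  show ?thesis
    using assms(4)
  proof (induction I rule: infinite_finite_induct)
    case (insert i I)
    then have "g \<in> I \<rightarrow> carrier V" "(\<lambda>i. f (g i)) \<in> I \<rightarrow> carrier W"
      using cl by auto
    with insert show ?case
      by (simp add: linear_maps_add[OF assms(3)] cl)
  qed (use assms in \<open>simp_all add: linear_maps_zero\<close>)
qed

text \<open>Being linear concerns values on the carrier only. This matters because lifts and
  \<open>fock_mult\<close> are given by a usable formula on carriers, so they are exchanged for that
  formula there.\<close>

lemma linear_maps_cong:
  assumes "module K V" "f \<in> linear_maps K V W" "\<And>x. x \<in> carrier V \<Longrightarrow> g x = f x"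
  shows "g \<in> linear_maps K V W"
proof -
  interpret V: module K V by fact
  show ?thesis
    using assms(2,3) by (auto simp: linear_maps_def)
qed

lemma linear_maps_id: "(\<lambda>x. x) \<in> linear_maps K V V"
  by (auto simp: linear_maps_def)

lemma linear_maps_id': "id \<in> linear_maps K V V"
  using linear_maps_id by (simp add: id_def)

lemma linear_maps_comp:
  "f \<in> linear_maps K U V \<Longrightarrow> g \<in> linear_maps K V W \<Longrightarrow> (\<lambda>x. g (f x)) \<in> linear_maps K U W"
  by (auto simp: linear_maps_def Pi_iff)

lemma linear_maps_const_zero:
  assumes "module K W"
  shows "(\<lambda>x. \<zero>\<^bsub>W\<^esub>) \<in> linear_maps K V W"
proof -
  interpret W: module K W by fact
  show ?thesis by (auto simp: linear_maps_def)
qed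

lemma linear_maps_add_fun:
  assumes "module K W" "f \<in> linear_maps K V W" "g \<in> linear_maps K V W"
  shows "(\<lambda>x. f x \<oplus>\<^bsub>W\<^esub> g x) \<in> linear_maps K V W"
proof -
  interpret W: module K W by fact
  show ?thesis
    using assms(2,3)
    by (intro linear_mapsI)
      (simp_all add: linear_maps_closed linear_maps_add linear_maps_smult W.smult_r_distr W.a_ac)
qed

lemma linear_maps_smult_fun:
  assumes "module K W" "f \<in> linear_maps K V W" "c \<in> carrier K"
  shows "(\<lambda>x. c \<odot>\<^bsub>W\<^esub> f x) \<in> linear_maps K V W"
proof -
  interpret W: module K W by fact
  show ?thesis
    using assms(3) linear_maps_closed[OF assms(2)]
    by (intro linear_mapsI)
       (simp_all add: linear_maps_add[OF assms(2)] linear_maps_smult[OF assms(2)] W.smult_r_distr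
         W.smult_assoc1[symmetric] W.m_comm)
qed

lemma linear_maps_finsum_fun:
  assumes "module K W" "\<And>i. i \<in> I \<Longrightarrow> f i \<in> linear_maps K V W"
  shows "(\<lambda>x. \<Oplus>\<^bsub>W\<^esub>i\<in>I. f i x) \<in> linear_maps K V W"
proof -
  interpret W: module K W by fact
  have fx: "f i x \<in> carrier W" if "x \<in> carrier V" "i \<in> I" for x i
    using that assms(2) by (auto intro: linear_maps_closed)
  show ?thesis
  proof (cases "finite I")
    \<comment> \<open>A \<open>finsum\<close> over an infinite index set is zero by convention, so
      here the map is constantly zero.\<close>
    case False
    then show ?thesis
      using linear_maps_const_zero[OF assms(1)] by simp
  next
    case True
    show ?thesis
    proof (rule linear_mapsI)
      fix x y assume xy: "x \<in> carrier V" "y \<in> carrier V"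
      have "(\<Oplus>\<^bsub>W\<^esub>i\<in>I. f i (x \<oplus>\<^bsub>V\<^esub> y)) = (\<Oplus>\<^bsub>W\<^esub>i\<in>I. f i x \<oplus>\<^bsub>W\<^esub> f i y)"
        using xy by (intro W.finsum_cong') (auto simp: linear_maps_add[OF assms(2)] fx)
      also have "\<dots> = (\<Oplus>\<^bsub>W\<^esub>i\<in>I. f i x) \<oplus>\<^bsub>W\<^esub> (\<Oplus>\<^bsub>W\<^esub>i\<in>I. f i y)"
        using xy by (intro W.finsum_addf) (auto simp: fx)
      finally show "(\<Oplus>\<^bsub>W\<^esub>i\<in>I. f i (x \<oplus>\<^bsub>V\<^esub> y)) = (\<Oplus>\<^bsub>W\<^esub>i\<in>I. f i x) \<oplus>\<^bsub>W\<^esub> (\<Oplus>\<^bsub>W\<^esub>i\<in>I. f i y)" .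
    next
      fix c x assume cx: "c \<in> carrier K" "x \<in> carrier V"
      have "(\<Oplus>\<^bsub>W\<^esub>i\<in>I. f i (c \<odot>\<^bsub>V\<^esub> x)) = (\<Oplus>\<^bsub>W\<^esub>i\<in>I. c \<odot>\<^bsub>W\<^esub> f i x)"
        using cx by (intro W.finsum_cong') (auto simp: linear_maps_smult[OF assms(2)] fx)
      also have "\<dots> = c \<odot>\<^bsub>W\<^esub> (\<Oplus>\<^bsub>W\<^esub>i\<in>I. f i x)"
        using cx True by (intro W.finsum_smult_ldistr[symmetric]) (auto simp: fx)
      finally show "(\<Oplus>\<^bsub>W\<^esub>i\<in>I. f i (c \<odot>\<^bsub>V\<^esub> x)) = c \<odot>\<^bsub>W\<^esub> (\<Oplus>\<^bsub>W\<^esub>i\<in>I. f i x)" .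
    qed (use fx in \<open>auto intro!: W.finsum_closed\<close>)
  qed
qed

section \<open>Submodules, linear spans and spanning sets\<close>

lemma submodule_closed:
  assumes "module K V" "submodule N K V"
  shows "x \<in> N \<Longrightarrow> x \<in> carrier V" "\<zero>\<^bsub>V\<^esub> \<in> N"
    "x \<in> N \<Longrightarrow> y \<in> N \<Longrightarrow> x \<oplus>\<^bsub>V\<^esub> y \<in> N" "c \<in> carrier K \<Longrightarrow> x \<in> N \<Longrightarrow> c \<odot>\<^bsub>V\<^esub> x \<in> N"
    "x \<in> N \<Longrightarrow> \<ominus>\<^bsub>V\<^esub> x \<in> N" "x \<in> N \<Longrightarrow> y \<in> N \<Longrightarrow> x \<ominus>\<^bsub>V\<^esub> y \<in> N"
proof -
  interpret V: module K V by fact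
  note N = V.submoduleE[OF assms(2)]
  show "x \<in> N \<Longrightarrow> x \<in> carrier V" "x \<in> N \<Longrightarrow> y \<in> N \<Longrightarrow> x \<oplus>\<^bsub>V\<^esub> y \<in> N"
    "c \<in> carrier K \<Longrightarrow> x \<in> N \<Longrightarrow> c \<odot>\<^bsub>V\<^esub> x \<in> N" "x \<in> N \<Longrightarrow> \<ominus>\<^bsub>V\<^esub> x \<in> N"
    "x \<in> N \<Longrightarrow> y \<in> N \<Longrightarrow> x \<ominus>\<^bsub>V\<^esub> y \<in> N"
    using N by (auto simp: a_minus_def)
  show "\<zero>\<^bsub>V\<^esub> \<in> N"
    using subgroup.one_closed[OF submodule.axioms(1)[OF assms(2)]] by simp
qed

lemma submodule_finsum_closed:
  assumes "module K V" "submodule N K V" "\<And>i. i \<in> I \<Longrightarrow> g i \<in> N"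
  shows "(\<Oplus>\<^bsub>V\<^esub>i\<in>I. g i) \<in> N"
proof -
  interpret V: module K V by fact
  note N = submodule_closed[OF assms(1,2)]
  show ?thesis
    using assms(3)
  proof (induction I rule: infinite_finite_induct)
    case (insert i I)
    then have "g \<in> I \<rightarrow> carrier V" "g i \<in> carrier V"
      using N(1) by auto
    with insert show ?case
      by (simp add: N)
  qed (simp_all add: N)
qed

lemma submodule_vimage:
  assumes "module K V" "module K W" "f \<in> linear_maps K V W" "submodule N K W"
  shows "submodule {x \<in> carrier V. f x \<in> N} K V"
proof -
  interpret V: module K V by fact
  interpret W: module K W by fact
  show ?thesis
    using assms
    by (intro V.submoduleI)
      (auto simp: linear_maps_zero linear_maps_a_inv linear_maps_add linear_maps_smult
        submodule_closed[OF assms(2,4)])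
qed

lemma submodule_zero:
  assumes "module K V"
  shows "submodule {\<zero>\<^bsub>V\<^esub>} K V"
proof -
  interpret V: module K V by fact
  show ?thesis by (intro V.submoduleI) auto
qed

lemma lin_span_base: "x \<in> S \<Longrightarrow> x \<in> lin_span K V S"
  by (auto simp: lin_span_def)

lemma lin_span_least: "submodule N K V \<Longrightarrow> S \<subseteq> N \<Longrightarrow> lin_span K V S \<subseteq> N"
  by (auto simp: lin_span_def)

lemma submodule_lin_span:
  assumes "module K V" "S \<subseteq> carrier V"
  shows "submodule (lin_span K V S) K V"
proof -
  interpret V: module K V by fact
  \<comment> \<open>The carrier contains \<open>S\<close> and is therefore one of the submodules
    intersected; this keeps the intersection inside the carrier.\<close>
  have "lin_span K V S \<subseteq> carrier V"
    using V.carrier_is_submodule assms(2) by (rule lin_span_least)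
  then show ?thesis
    by (intro V.submoduleI)
      (auto simp: lin_span_def intro: submodule_closed[OF assms(1)])
qed

text \<open>The preimage of a submodule is a submodule, so it contains the span once it contains the
  generators. With the zero submodule as \<open>N\<close> this shows that a map kills relations;
  with a homogeneous part as \<open>N\<close>, that it respects degrees.\<close>

lemma linear_maps_span:
  assumes "module K V" "module K W" "f \<in> linear_maps K V W" "submodule N K W" "S \<subseteq> carrier V"
    "\<And>s. s \<in> S \<Longrightarrow> f s \<in> N" "x \<in> lin_span K V S"
  shows "f x \<in> N"
proof -
  have "lin_span K V S \<subseteq> {x \<in> carrier V. f x \<in> N}"
    using assms by (intro lin_span_least submodule_vimage) auto
  with assms(7) show ?thesis by auto
qed

text \<open>The inclusion of \<open>S\<close> in the carrier makes \<open>lin_span\<close> a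
  submodule, so that for a module the second inclusion is in fact an equality.\<close>

definition spans :: "('k, 'm) ring_scheme \<Rightarrow> ('k, 'v, 'p) module_scheme \<Rightarrow> 'v set \<Rightarrow> bool"
  where "spans K V S \<longleftrightarrow> S \<subseteq> carrier V \<and> carrier V \<subseteq> lin_span K V S"

lemma spans_carrier: "spans K V (carrier V)"
  by (auto simp: spans_def intro: lin_span_base)

text \<open>The equalizer of two linear maps is a submodule, hence contains the span of every set on
  which they agree.\<close>

lemma linear_maps_eqI:
  assumes "module K V" "module K W" "f \<in> linear_maps K V W" "g \<in> linear_maps K V W"
    "spans K V S" "\<And>s. s \<in> S \<Longrightarrow> f s = g s" "x \<in> carrier V"
  shows "f x = g x"
proof -
  interpret V: module K V by fact
  interpret W: module K W by fact
  have "submodule {x \<in> carrier V. f x = g x} K V"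
    using assms
    by (intro V.submoduleI) (auto simp: linear_maps_zero linear_maps_a_inv linear_maps_add linear_maps_smult)
  then have "lin_span K V S \<subseteq> {x \<in> carrier V. f x = g x}"
    using assms(5,6) by (intro lin_span_least) (auto simp: spans_def)
  with assms(5,7) show ?thesis by (auto simp: spans_def)
qed

text \<open>For fixed parameters \<open>a\<close> and \<open>b\<close>, additivity in the parameter
  is an equality of two linear maps in \<open>v\<close>; the same holds for scalars. So it suffices
  to know linearity in the parameter for \<open>v\<close> in a spanning set.\<close>

lemma linear_maps_param:
  assumes "module K A" "module K V" "module K W" "spans K V S"
    and lin: "\<And>a. a \<in> carrier A \<Longrightarrow> f a \<in> linear_maps K V W"
    and param: "\<And>s. s \<in> S \<Longrightarrow> (\<lambda>a. f a s) \<in> linear_maps K A W"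
    and v: "v \<in> carrier V"
  shows "(\<lambda>a. f a v) \<in> linear_maps K A W"
proof -
  interpret A: module K A by fact
  note eqI = linear_maps_eqI[OF assms(2,3) _ _ assms(4) _ v]
  show ?thesis
  proof (rule linear_mapsI)
    show "f a v \<in> carrier W" if "a \<in> carrier A" for a
      using lin[OF that] v by (rule linear_maps_closed)
    show "f (a \<oplus>\<^bsub>A\<^esub> b) v = f a v \<oplus>\<^bsub>W\<^esub> f b v" if "a \<in> carrier A" "b \<in> carrier A" for a b
      using that by (intro eqI[OF lin linear_maps_add_fun[OF assms(3) lin lin]])
        (simp_all add: linear_maps_add[OF param])
    show "f (c \<odot>\<^bsub>A\<^esub> a) v = c \<odot>\<^bsub>W\<^esub> f a v" if "c \<in> carrier K" "a \<in> carrier A" for a c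
      using that by (intro eqI[OF lin linear_maps_smult_fun[OF assms(3) lin]])
        (simp_all add: linear_maps_smult[OF param])
  qed
qed

lemma spans_image:
  assumes "module K V" "module K W" "f \<in> linear_maps K V W" "spans K V S" "carrier W \<subseteq> f ` carrier V"
  shows "spans K W (f ` S)"
proof -
  have S: "S \<subseteq> carrier V" using assms(4) by (simp add: spans_def)
  then have fS: "f ` S \<subseteq> carrier W"
    using linear_maps_closed[OF assms(3)] by auto
  have "f x \<in> lin_span K W (f ` S)" if "x \<in> carrier V" for x
  proof (rule linear_maps_span[OF assms(1,2,3) submodule_lin_span[OF assms(2) fS] S])
    show "f s \<in> lin_span K W (f ` S)" if "s \<in> S" for s
      using that by (intro lin_span_base imageI)
    show "x \<in> lin_span K V S"
      using that assms(4) by (auto simp: spans_def)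
  qed
  then have "f ` carrier V \<subseteq> lin_span K W (f ` S)"
    by (rule image_subsetI)
  with assms(5) have "carrier W \<subseteq> lin_span K W (f ` S)"
    by (rule subset_trans)
  with fS show ?thesis
    by (simp add: spans_def)
qed

lemma spans_trans:
  assumes "module K V" "spans K V S" "T \<subseteq> carrier V" "S \<subseteq> lin_span K V T"
  shows "spans K V T"
  using assms lin_span_least[OF submodule_lin_span[OF assms(1,3)] assms(4)]
  by (auto simp: spans_def)

section \<open>Bilinear maps\<close>

lemma bilinear_mapsI:
  assumes "\<And>u v. u \<in> carrier U \<Longrightarrow> v \<in> carrier V \<Longrightarrow> \<beta> u v \<in> carrier W"
    and "\<And>u u' v. u \<in> carrier U \<Longrightarrow> u' \<in> carrier U \<Longrightarrow> v \<in> carrier V \<Longrightarrow>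
      \<beta> (u \<oplus>\<^bsub>U\<^esub> u') v = \<beta> u v \<oplus>\<^bsub>W\<^esub> \<beta> u' v"
    and "\<And>u v v'. u \<in> carrier U \<Longrightarrow> v \<in> carrier V \<Longrightarrow> v' \<in> carrier V \<Longrightarrow>
      \<beta> u (v \<oplus>\<^bsub>V\<^esub> v') = \<beta> u v \<oplus>\<^bsub>W\<^esub> \<beta> u v'"
    and "\<And>c u v. c \<in> carrier K \<Longrightarrow> u \<in> carrier U \<Longrightarrow> v \<in> carrier V \<Longrightarrow> \<beta> (c \<odot>\<^bsub>U\<^esub> u) v = c \<odot>\<^bsub>W\<^esub> \<beta> u v"
    and "\<And>c u v. c \<in> carrier K \<Longrightarrow> u \<in> carrier U \<Longrightarrow> v \<in> carrier V \<Longrightarrow> \<beta> u (c \<odot>\<^bsub>V\<^esub> v) = c \<odot>\<^bsub>W\<^esub> \<beta> u v"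
  shows "\<beta> \<in> bilinear_maps K U V W"
  using assms by (auto simp: bilinear_maps_def linear_maps_def)

lemma bilinear_maps_right: "\<beta> \<in> bilinear_maps K U V W \<Longrightarrow> u \<in> carrier U \<Longrightarrow> \<beta> u \<in> linear_maps K V W"
  by (simp add: bilinear_maps_def)

lemma bilinear_maps_left:
  "\<beta> \<in> bilinear_maps K U V W \<Longrightarrow> v \<in> carrier V \<Longrightarrow> (\<lambda>u. \<beta> u v) \<in> linear_maps K U W"
  by (simp add: bilinear_maps_def)

lemma bilinear_maps_closed:
  "\<beta> \<in> bilinear_maps K U V W \<Longrightarrow> u \<in> carrier U \<Longrightarrow> v \<in> carrier V \<Longrightarrow> \<beta> u v \<in> carrier W"
  by (rule linear_maps_closed[OF bilinear_maps_right])

lemma bilinear_mapsI_linear: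
  assumes "\<And>u. u \<in> carrier U \<Longrightarrow> \<beta> u \<in> linear_maps K V W"
    "\<And>v. v \<in> carrier V \<Longrightarrow> (\<lambda>u. \<beta> u v) \<in> linear_maps K U W"
  shows "\<beta> \<in> bilinear_maps K U V W"
  using assms by (simp add: bilinear_maps_def)

lemma bilinear_maps_comp:
  assumes "f \<in> linear_maps K U' U" "g \<in> linear_maps K V' V" "\<beta> \<in> bilinear_maps K U V W"
    "h \<in> linear_maps K W W'"
  shows "(\<lambda>u v. h (\<beta> (f u) (g v))) \<in> bilinear_maps K U' V' W'"
proof (rule bilinear_mapsI_linear)
  fix u assume "u \<in> carrier U'"
  then show "(\<lambda>v. h (\<beta> (f u) (g v))) \<in> linear_maps K V' W'"
    by (intro linear_maps_comp[OF _ assms(4)] linear_maps_comp[OF assms(2)]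
        bilinear_maps_right[OF assms(3)] linear_maps_closed[OF assms(1)])
next
  fix v assume "v \<in> carrier V'"
  then have "(\<lambda>u. \<beta> u (g v)) \<in> linear_maps K U W"
    by (intro bilinear_maps_left[OF assms(3)] linear_maps_closed[OF assms(2)])
  from linear_maps_comp[OF linear_maps_comp[OF assms(1) this] assms(4)]
  show "(\<lambda>u. h (\<beta> (f u) (g v))) \<in> linear_maps K U' W'" .
qed

lemma bilinear_maps_swap:
  "\<beta> \<in> bilinear_maps K U V W \<Longrightarrow> (\<lambda>v u. \<beta> u v) \<in> bilinear_maps K V U W"
  by (simp add: bilinear_maps_def)

text \<open>One variable is frozen at a time: for \<open>s\<close> in \<open>S\<close> the maps
  agree in the second variable because of \<open>T\<close>, and then for every \<open>v\<close> they
  agree in the first because of \<open>S\<close>.\<close>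

lemma bilinear_maps_eqI:
  assumes "module K U" "module K V" "module K W"
    and \<beta>: "\<beta> \<in> bilinear_maps K U V W" and \<gamma>: "\<gamma> \<in> bilinear_maps K U V W"
    and S: "spans K U S" and T: "spans K V T"
    and eq: "\<And>s t. s \<in> S \<Longrightarrow> t \<in> T \<Longrightarrow> \<beta> s t = \<gamma> s t"
    and u: "u \<in> carrier U" and v: "v \<in> carrier V"
  shows "\<beta> u v = \<gamma> u v"
proof -
  have "\<beta> s v = \<gamma> s v" if "s \<in> S" for s
  proof -
    have "s \<in> carrier U" using that S by (auto simp: spans_def)
    then show ?thesis
      by (intro linear_maps_eqI[OF assms(2,3) bilinear_maps_right[OF \<beta>] bilinear_maps_right[OF \<gamma>] T eq[OF that] v])
  qed
  then show ?thesis
    by (rule linear_maps_eqI[OF assms(1,3) bilinear_maps_left[OF \<beta> v] bilinear_maps_left[OF \<gamma> v] S _ u])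
qed

lemma bilinear_maps_finsum:
  assumes "module K U" "module K V" "module K W" "\<beta> \<in> bilinear_maps K U V W"
    "\<And>i. i \<in> I \<Longrightarrow> f i \<in> carrier U" "\<And>j. j \<in> J \<Longrightarrow> g j \<in> carrier V"
  shows "\<beta> (\<Oplus>\<^bsub>U\<^esub>i\<in>I. f i) (\<Oplus>\<^bsub>V\<^esub>j\<in>J. g j) = (\<Oplus>\<^bsub>W\<^esub>i\<in>I. \<Oplus>\<^bsub>W\<^esub>j\<in>J. \<beta> (f i) (g j))"
proof -
  interpret U: module K U by fact
  interpret V: module K V by fact
  interpret W: module K W by fact
  have g: "(\<Oplus>\<^bsub>V\<^esub>j\<in>J. g j) \<in> carrier V"
    by (intro V.finsum_closed Pi_I assms(6))
  have "\<beta> (\<Oplus>\<^bsub>U\<^esub>i\<in>I. f i) (\<Oplus>\<^bsub>V\<^esub>j\<in>J. g j) = (\<Oplus>\<^bsub>W\<^esub>i\<in>I. \<beta> (f i) (\<Oplus>\<^bsub>V\<^esub>j\<in>J. g j))"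
    by (rule linear_maps_finsum[OF assms(1,3) bilinear_maps_left[OF assms(4) g] assms(5)])
  also have "\<dots> = (\<Oplus>\<^bsub>W\<^esub>i\<in>I. \<Oplus>\<^bsub>W\<^esub>j\<in>J. \<beta> (f i) (g j))"
  proof (rule W.finsum_cong'[OF refl])
    show "\<beta> (f i) (\<Oplus>\<^bsub>V\<^esub>j\<in>J. g j) = (\<Oplus>\<^bsub>W\<^esub>j\<in>J. \<beta> (f i) (g j))" if "i \<in> I" for i
      by (rule linear_maps_finsum[OF assms(2,3) bilinear_maps_right[OF assms(4) assms(5)[OF that]] assms(6)])
    show "(\<lambda>i. \<Oplus>\<^bsub>W\<^esub>j\<in>J. \<beta> (f i) (g j)) \<in> I \<rightarrow> carrier W"
      by (rule Pi_I, rule W.finsum_closed, rule Pi_I) (rule bilinear_maps_closed[OF assms(4-6)])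
  qed
  finally show ?thesis .
qed

section \<open>Free modules, quotients and direct sums\<close>

lemma free_module_simps [simp]:
  "\<zero>\<^bsub>free_module K B\<^esub> = (\<lambda>_. \<zero>\<^bsub>K\<^esub>)"
  "f \<oplus>\<^bsub>free_module K B\<^esub> g = (\<lambda>b. f b \<oplus>\<^bsub>K\<^esub> g b)"
  "c \<odot>\<^bsub>free_module K B\<^esub> f = (\<lambda>b. c \<otimes>\<^bsub>K\<^esub> f b)"
  by (simp_all add: free_module_def)

lemma mem_free_module:
  "f \<in> carrier (free_module K B) \<longleftrightarrow>
     (\<forall>b. f b \<in> carrier K) \<and> finite {b. f b \<noteq> \<zero>\<^bsub>K\<^esub>} \<and> (\<forall>b. f b \<noteq> \<zero>\<^bsub>K\<^esub> \<longrightarrow> b \<in> B)"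
  by (auto simp: free_module_def)

lemma free_module_coeff: "f \<in> carrier (free_module K B) \<Longrightarrow> f b \<in> carrier K"
  by (auto simp: mem_free_module)

lemma free_module_mono: "B \<subseteq> C \<Longrightarrow> carrier (free_module K B) \<subseteq> carrier (free_module K C)"
  unfolding subset_iff mem_free_module by blast

lemma module_free_module:
  assumes "cring K"
  shows "module K (free_module K B)"
proof -
  interpret K: cring K by fact
  have add: "f \<oplus>\<^bsub>free_module K B\<^esub> g \<in> carrier (free_module K B)"
    if "f \<in> carrier (free_module K B)" "g \<in> carrier (free_module K B)" for f g
  proof -
    have sub: "{b. f b \<oplus>\<^bsub>K\<^esub> g b \<noteq> \<zero>\<^bsub>K\<^esub>} \<subseteq> {b. f b \<noteq> \<zero>\<^bsub>K\<^esub>} \<union> {b. g b \<noteq> \<zero>\<^bsub>K\<^esub>}"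
      by auto
    then have "finite {b. f b \<oplus>\<^bsub>K\<^esub> g b \<noteq> \<zero>\<^bsub>K\<^esub>}"
      by (rule finite_subset) (use that in \<open>simp add: mem_free_module\<close>)
    with that sub show ?thesis by (auto simp: mem_free_module)
  qed
  have smult: "c \<odot>\<^bsub>free_module K B\<^esub> f \<in> carrier (free_module K B)"
    if "c \<in> carrier K" "f \<in> carrier (free_module K B)" for c f
  proof -
    have sub: "{b. c \<otimes>\<^bsub>K\<^esub> f b \<noteq> \<zero>\<^bsub>K\<^esub>} \<subseteq> {b. f b \<noteq> \<zero>\<^bsub>K\<^esub>}"
      using that(1) by auto
    then have "finite {b. c \<otimes>\<^bsub>K\<^esub> f b \<noteq> \<zero>\<^bsub>K\<^esub>}"
      by (rule finite_subset) (use that in \<open>simp add: mem_free_module\<close>)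
    with that sub show ?thesis by (auto simp: mem_free_module)
  qed
  have zero: "(\<lambda>_. \<zero>\<^bsub>K\<^esub>) \<in> carrier (free_module K B)"
    by (auto simp: mem_free_module)
  note coeff = free_module_coeff[of _ K B]
  \<comment> \<open>The additive inverse is obtained by scaling with minus one, for which closure
    has just been shown.\<close>
  have inv: "\<exists>g\<in>carrier (free_module K B). g \<oplus>\<^bsub>free_module K B\<^esub> f = \<zero>\<^bsub>free_module K B\<^esub>"
    if f: "f \<in> carrier (free_module K B)" for f
  proof
    show "(\<ominus>\<^bsub>K\<^esub> \<one>\<^bsub>K\<^esub>) \<odot>\<^bsub>free_module K B\<^esub> f \<in> carrier (free_module K B)"
      using f by (intro smult) auto
    show "(\<ominus>\<^bsub>K\<^esub> \<one>\<^bsub>K\<^esub>) \<odot>\<^bsub>free_module K B\<^esub> f \<oplus>\<^bsub>free_module K B\<^esub> f = \<zero>\<^bsub>free_module K B\<^esub>"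
      using coeff[OF f] by (auto simp: K.l_minus K.l_neg)
  qed
  show ?thesis
  proof (intro moduleI abelian_groupI)
  qed (use assms add smult zero inv in \<open>auto simp: coeff K.a_ac K.m_ac K.l_distr K.r_distr\<close>)
qed

lemma basis_vec_closed:
  assumes "cring K" "b \<in> B"
  shows "basis_vec K b \<in> carrier (free_module K B)"
proof -
  interpret K: cring K by fact
  have "{c. basis_vec K b c \<noteq> \<zero>\<^bsub>K\<^esub>} \<subseteq> {b}"
    by (auto simp: basis_vec_def)
  with assms(2) show ?thesis
    by (auto simp: mem_free_module basis_vec_def dest: finite_subset split: if_splits)
qed

lemma spans_free_module:
  assumes "cring K"
  shows "spans K (free_module K B) (basis_vec K ` B)"
proof -
  interpret K: cring K by fact
  let ?F = "free_module K B" and ?S = "basis_vec K ` B"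
  have S: "?S \<subseteq> carrier ?F"
    by (auto intro: basis_vec_closed[OF assms])
  note N = submodule_closed[OF module_free_module[OF assms] submodule_lin_span[OF module_free_module[OF assms] S]]
  \<comment> \<open>The induction runs over a finite superset of the support, one point being
    cleared at each step. A point of the superset that lies outside \<open>B\<close> carries the
    coefficient zero and can simply be dropped.\<close>
  have "f \<in> lin_span K ?F ?S" if "finite A" "f \<in> carrier ?F" "{b. f b \<noteq> \<zero>\<^bsub>K\<^esub>} \<subseteq> A" for f A
    using that
  proof (induction A arbitrary: f rule: finite_induct)
    case empty
    then have "f = (\<lambda>_. \<zero>\<^bsub>K\<^esub>)" by auto
    with N(2) show ?case by simp
  next
    case (insert a A)
    note f = free_module_coeff[OF insert.prems(1)]
    let ?g = "f(a := \<zero>\<^bsub>K\<^esub>)"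
    show ?case
    proof (cases "a \<in> B")
      case True
      have "finite {b. ?g b \<noteq> \<zero>\<^bsub>K\<^esub>}"
        by (rule finite_subset[of _ "{b. f b \<noteq> \<zero>\<^bsub>K\<^esub>}"]) (use insert.prems in \<open>auto simp: mem_free_module\<close>)
      then have gc: "?g \<in> carrier ?F"
        using insert.prems(1) unfolding mem_free_module by simp
      then have g: "?g \<in> lin_span K ?F ?S"
        by (rule insert.IH) (use insert.prems(2) in auto)
      have "f = ?g \<oplus>\<^bsub>?F\<^esub> f a \<odot>\<^bsub>?F\<^esub> basis_vec K a"
        using f by (auto simp: basis_vec_def fun_eq_iff)
      also have "\<dots> \<in> lin_span K ?F ?S"
        using True by (intro N(3,4) g f lin_span_base imageI)
      finally show ?thesis .
    next
      case False
      then have "f a = \<zero>\<^bsub>K\<^esub>"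
        using insert.prems(1) by (auto simp: mem_free_module)
      then show ?thesis
        using insert.prems by (intro insert.IH) auto
    qed
  qed
  with S show ?thesis
    by (auto simp: spans_def mem_free_module)
qed

text \<open>\<open>lin_ext\<close> sums over the support of its argument, and two functions and
  their sum have different supports. Linearity is proved by bringing all of them to a common index
  set.\<close>

lemma lin_ext_superset:
  assumes "module K V" "\<phi> \<in> B \<rightarrow> carrier V" "f \<in> carrier (free_module K B)"
    "finite A" "{b. f b \<noteq> \<zero>\<^bsub>K\<^esub>} \<subseteq> A" "A \<subseteq> B"
  shows "lin_ext K V \<phi> f = (\<Oplus>\<^bsub>V\<^esub>b\<in>A. f b \<odot>\<^bsub>V\<^esub> \<phi> b)"
proof -
  interpret V: module K V by fact
  show ?thesis
    unfolding lin_ext_def using assms(2,4-) free_module_coeff[OF assms(3)]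
    by (intro V.add.finprod_mono_neutral_cong_left) (auto intro!: V.smult_l_null V.smult_closed)
qed

lemma lin_ext_linear:
  assumes "module K V" "\<phi> \<in> B \<rightarrow> carrier V"
  shows "lin_ext K V \<phi> \<in> linear_maps K (free_module K B) V"
proof -
  interpret V: module K V by fact
  let ?F = "free_module K B"
  interpret F: module K ?F by (rule module_free_module[OF V.is_cring])
  note coeff = free_module_coeff[of _ K B]
  have supp: "finite {b. f b \<noteq> \<zero>\<^bsub>K\<^esub>}" "{b. f b \<noteq> \<zero>\<^bsub>K\<^esub>} \<subseteq> B" if "f \<in> carrier ?F" for f
    using that by (auto simp: mem_free_module)
  show ?thesis
  proof (rule linear_mapsI)
    fix f assume f: "f \<in> carrier ?F"
    show "lin_ext K V \<phi> f \<in> carrier V"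
      unfolding lin_ext_def using assms(2) coeff[OF f] supp[OF f] by (intro V.finsum_closed) auto
  next
    fix f g assume f: "f \<in> carrier ?F" and g: "g \<in> carrier ?F"
    let ?A = "{b. f b \<noteq> \<zero>\<^bsub>K\<^esub>} \<union> {b. g b \<noteq> \<zero>\<^bsub>K\<^esub>}"
    have A: "finite ?A" "?A \<subseteq> B"
      using supp[OF f] supp[OF g] by auto
    then have phi: "\<phi> b \<in> carrier V" if "b \<in> ?A" for b
      using assms(2) that by auto
    have "lin_ext K V \<phi> (f \<oplus>\<^bsub>?F\<^esub> g) = (\<Oplus>\<^bsub>V\<^esub>b\<in>?A. (f \<oplus>\<^bsub>?F\<^esub> g) b \<odot>\<^bsub>V\<^esub> \<phi> b)"
      using f g by (intro lin_ext_superset[OF assms] F.a_closed A) auto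
    also have "\<dots> = (\<Oplus>\<^bsub>V\<^esub>b\<in>?A. f b \<odot>\<^bsub>V\<^esub> \<phi> b \<oplus>\<^bsub>V\<^esub> g b \<odot>\<^bsub>V\<^esub> \<phi> b)"
      using phi coeff[OF f] coeff[OF g] by (intro V.finsum_cong' refl) (auto simp: V.smult_l_distr)
    also have "\<dots> = (\<Oplus>\<^bsub>V\<^esub>b\<in>?A. f b \<odot>\<^bsub>V\<^esub> \<phi> b) \<oplus>\<^bsub>V\<^esub> (\<Oplus>\<^bsub>V\<^esub>b\<in>?A. g b \<odot>\<^bsub>V\<^esub> \<phi> b)"
      using phi coeff[OF f] coeff[OF g] by (intro V.finsum_addf) auto
    also have "(\<Oplus>\<^bsub>V\<^esub>b\<in>?A. f b \<odot>\<^bsub>V\<^esub> \<phi> b) = lin_ext K V \<phi> f"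
      by (intro lin_ext_superset[OF assms, symmetric] f A) auto
    also have "(\<Oplus>\<^bsub>V\<^esub>b\<in>?A. g b \<odot>\<^bsub>V\<^esub> \<phi> b) = lin_ext K V \<phi> g"
      by (intro lin_ext_superset[OF assms, symmetric] g A) auto
    finally show "lin_ext K V \<phi> (f \<oplus>\<^bsub>?F\<^esub> g) = lin_ext K V \<phi> f \<oplus>\<^bsub>V\<^esub> lin_ext K V \<phi> g" .
  next
    fix c f assume c: "c \<in> carrier K" and f: "f \<in> carrier ?F"
    let ?A = "{b. f b \<noteq> \<zero>\<^bsub>K\<^esub>}"
    note A = supp[OF f]
    then have phi: "\<phi> b \<in> carrier V" if "b \<in> ?A" for b
      using assms(2) that by auto
    have "lin_ext K V \<phi> (c \<odot>\<^bsub>?F\<^esub> f) = (\<Oplus>\<^bsub>V\<^esub>b\<in>?A. (c \<odot>\<^bsub>?F\<^esub> f) b \<odot>\<^bsub>V\<^esub> \<phi> b)"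
      using c f by (intro lin_ext_superset[OF assms] F.smult_closed A) auto
    also have "\<dots> = (\<Oplus>\<^bsub>V\<^esub>b\<in>?A. c \<odot>\<^bsub>V\<^esub> (f b \<odot>\<^bsub>V\<^esub> \<phi> b))"
      using phi c coeff[OF f] by (intro V.finsum_cong' refl) (auto simp: V.smult_assoc1)
    also have "\<dots> = c \<odot>\<^bsub>V\<^esub> lin_ext K V \<phi> f"
      unfolding lin_ext_def
      using phi c coeff[OF f] A by (intro V.finsum_smult_ldistr[symmetric]) auto
    finally show "lin_ext K V \<phi> (c \<odot>\<^bsub>?F\<^esub> f) = c \<odot>\<^bsub>V\<^esub> lin_ext K V \<phi> f" .
  qed
qed

lemma lin_ext_basis_vec:
  assumes "module K V" "\<phi> b \<in> carrier V"
  shows "lin_ext K V \<phi> (basis_vec K b) = \<phi> b"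
proof -
  interpret V: module K V by fact
  \<comment> \<open>The set \<open>{b}\<close> is used as a superset of the support: over the zero
    ring the support of the basis vector is empty.\<close>
  have "lin_ext K V \<phi> (basis_vec K b) = (\<Oplus>\<^bsub>V\<^esub>c\<in>{b}. basis_vec K b c \<odot>\<^bsub>V\<^esub> \<phi> c)"
    using assms(2)
    by (intro lin_ext_superset[OF assms(1), of _ "{b}"] basis_vec_closed V.is_cring)
       (auto simp: basis_vec_def)
  also have "\<dots> = \<phi> b"
    using assms(2) by (simp add: basis_vec_def)
  finally show ?thesis .
qed

section \<open>Quotient modules\<close>

lemma quotient_module_zero [simp]: "\<zero>\<^bsub>quotient_module V N\<^esub> = N"
  by (simp add: quotient_module_def)

lemma quotient_module_carrier: "carrier (quotient_module V N) = (\<lambda>x. N +>\<^bsub>V\<^esub> x) ` carrier V"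
  by (auto simp: quotient_module_def A_RCOSETS_def')

lemma abelian_subgroup_submodule:
  assumes "module K V" "submodule N K V"
  shows "abelian_subgroup N V"
  using assms by (intro abelian_subgroupI3 additive_subgroup.intro module_abelian_group) (auto dest: submodule.axioms(1))

lemma coset_eq_iff:
  assumes "module K V" "submodule N K V" "x \<in> carrier V" "y \<in> carrier V"
  shows "N +>\<^bsub>V\<^esub> x = N +>\<^bsub>V\<^esub> y \<longleftrightarrow> x \<ominus>\<^bsub>V\<^esub> y \<in> N"
proof -
  interpret abelian_subgroup N V
    by (rule abelian_subgroup_submodule) fact+
  have "N +>\<^bsub>V\<^esub> x = N +>\<^bsub>V\<^esub> y \<longleftrightarrow> x \<in> N +>\<^bsub>V\<^esub> y"
    using a_rcos_self[OF assms(3)] a_repr_independence[OF _ assms(4)] by (metis a_subgroup)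
  also have "\<dots> \<longleftrightarrow> x \<ominus>\<^bsub>V\<^esub> y \<in> N"
    using assms(3,4) by (simp add: a_rcos_module a_minus_def)
  finally show ?thesis .
qed

lemma coset_self:
  assumes "module K V" "submodule N K V" "x \<in> carrier V"
  shows "x \<in> N +>\<^bsub>V\<^esub> x"
  by (rule abelian_subgroup.a_rcos_self[OF abelian_subgroup_submodule[OF assms(1,2)] assms(3)])

lemma coset_closed:
  assumes "module K V" "submodule N K V" "x \<in> carrier V" "y \<in> N +>\<^bsub>V\<^esub> x"
  shows "y \<in> carrier V" "N +>\<^bsub>V\<^esub> y = N +>\<^bsub>V\<^esub> x"
proof -
  interpret abelian_subgroup N V
    by (rule abelian_subgroup_submodule) fact+
  show "y \<in> carrier V"
    using a_elemrcos_carrier[OF assms(3,4)] .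
  show "N +>\<^bsub>V\<^esub> y = N +>\<^bsub>V\<^esub> x"
    using a_repr_independence[OF assms(4,3)] by (metis a_subgroup)
qed

lemma coset_zero:
  assumes "module K V" "submodule N K V"
  shows "N +>\<^bsub>V\<^esub> \<zero>\<^bsub>V\<^esub> = N"
proof -
  interpret abelian_subgroup N V
    by (rule abelian_subgroup_submodule) fact+
  show ?thesis
    using a_subset by simp
qed

lemma coset_add:
  assumes "module K V" "submodule N K V" "x \<in> carrier V" "y \<in> carrier V"
  shows "(N +>\<^bsub>V\<^esub> x) \<oplus>\<^bsub>quotient_module V N\<^esub> (N +>\<^bsub>V\<^esub> y) = N +>\<^bsub>V\<^esub> (x \<oplus>\<^bsub>V\<^esub> y)"
  by (simp add: quotient_module_def) (rule abelian_subgroup.a_rcos_sum[OF abelian_subgroup_submodule[OF assms(1,2)] assms(3,4)])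

text \<open>The multiple of a coset is encoded as a union of cosets over all representatives.
  Representatives differ by elements of \<open>N\<close>, and \<open>N\<close> is closed under
  scalars, so all members of the union coincide.\<close>

lemma coset_smult:
  assumes "module K V" "submodule N K V" "c \<in> carrier K" "x \<in> carrier V"
  shows "c \<odot>\<^bsub>quotient_module V N\<^esub> (N +>\<^bsub>V\<^esub> x) = N +>\<^bsub>V\<^esub> (c \<odot>\<^bsub>V\<^esub> x)"
proof -
  interpret V: module K V by fact
  have "N +>\<^bsub>V\<^esub> (c \<odot>\<^bsub>V\<^esub> y) = N +>\<^bsub>V\<^esub> (c \<odot>\<^bsub>V\<^esub> x)" if "y \<in> N +>\<^bsub>V\<^esub> x" for y
  proof -
    note y = coset_closed[OF assms(1,2,4) that]
    have "y \<ominus>\<^bsub>V\<^esub> x \<in> N"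
      using y assms by (simp add: coset_eq_iff[symmetric])
    then have "c \<odot>\<^bsub>V\<^esub> (y \<ominus>\<^bsub>V\<^esub> x) \<in> N"
      by (rule submodule_closed(4)[OF assms(1,2,3)])
    then have "c \<odot>\<^bsub>V\<^esub> y \<ominus>\<^bsub>V\<^esub> c \<odot>\<^bsub>V\<^esub> x \<in> N"
      using assms y by (simp add: a_minus_def V.smult_r_distr V.smult_r_minus)
    then show ?thesis
      using assms y by (simp add: coset_eq_iff)
  qed
  then have "(\<Union>y\<in>N +>\<^bsub>V\<^esub> x. N +>\<^bsub>V\<^esub> (c \<odot>\<^bsub>V\<^esub> y)) = (\<Union>y\<in>N +>\<^bsub>V\<^esub> x. N +>\<^bsub>V\<^esub> (c \<odot>\<^bsub>V\<^esub> x))"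
    by (rule SUP_cong[OF refl])
  also have "\<dots> = N +>\<^bsub>V\<^esub> (c \<odot>\<^bsub>V\<^esub> x)"
    using coset_self[OF assms(1,2,4)] by auto
  finally show ?thesis by (simp add: quotient_module_def)
qed

lemma coset_linear:
  assumes "module K V" "submodule N K V"
  shows "(\<lambda>x. N +>\<^bsub>V\<^esub> x) \<in> linear_maps K V (quotient_module V N)"
  by (intro linear_mapsI) (simp_all add: coset_smult[OF assms] coset_add[OF assms] quotient_module_carrier)

lemma module_quotient_module:
  assumes "module K V" "submodule N K V"
  shows "module K (quotient_module V N)"
proof -
  interpret V: module K V by fact
  let ?Q = "quotient_module V N"
  note zero = coset_zero[OF assms] and add = coset_add[OF assms] and smult = coset_smult[OF assms]
  have l_zero: "N \<oplus>\<^bsub>?Q\<^esub> (N +>\<^bsub>V\<^esub> x) = N +>\<^bsub>V\<^esub> x" if "x \<in> carrier V" for x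
    using add[OF V.zero_closed that] that by (simp add: zero)
  have inv: "\<exists>y\<in>carrier V. N +>\<^bsub>V\<^esub> (x \<oplus>\<^bsub>V\<^esub> y) = N" if "x \<in> carrier V" for x
    using that by (intro bexI[of _ "\<ominus>\<^bsub>V\<^esub> x"]) (simp_all add: V.r_neg zero)
  show ?thesis
  proof (intro moduleI abelian_groupI V.is_cring)
    show "\<zero>\<^bsub>?Q\<^esub> \<in> carrier ?Q"
      unfolding quotient_module_carrier using zero by (intro image_eqI[of _ _ "\<zero>\<^bsub>V\<^esub>"]) simp_all
  qed (unfold quotient_module_carrier quotient_module_zero, safe,
      simp_all add: smult add l_zero inv V.smult_l_distr V.smult_r_distr V.smult_assoc1 V.a_ac)
qed

text \<open>A linear map vanishing on \<open>N\<close> is constant on each coset, so its image is a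
  singleton and \<open>the_elem\<close> returns the common value. All induced maps of the
  development are evaluated through this fact or its two-variable form.\<close>

lemma quotient_lift_eq:
  assumes "module K V" "module K W" "submodule N K V" "f \<in> linear_maps K V W"
    and ker: "\<And>x. x \<in> N \<Longrightarrow> f x = \<zero>\<^bsub>W\<^esub>" and x: "x \<in> carrier V"
  shows "the_elem (f ` (N +>\<^bsub>V\<^esub> x)) = f x"
proof -
  interpret V: module K V by fact
  interpret W: module K W by fact
  have "f y = f x" if y: "y \<in> N +>\<^bsub>V\<^esub> x" for y
  proof -
    note y' = coset_closed[OF assms(1,3) x y]
    then have "y \<ominus>\<^bsub>V\<^esub> x \<in> N"
      using x by (simp add: coset_eq_iff[OF assms(1,3), symmetric])
    then have "f y \<ominus>\<^bsub>W\<^esub> f x = \<zero>\<^bsub>W\<^esub>"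
      using ker y' x by (simp add: linear_maps_minus[OF assms(1,2,4), symmetric])
    then show ?thesis
      using y' x linear_maps_closed[OF assms(4)] W.minus_equality[of "f y" "\<ominus>\<^bsub>W\<^esub> f x"]
      by (simp add: a_minus_def)
  qed
  then have "f ` (N +>\<^bsub>V\<^esub> x) = (\<lambda>_. f x) ` (N +>\<^bsub>V\<^esub> x)"
    by (rule image_cong[OF refl])
  also have "\<dots> = {f x}"
    using coset_self[OF assms(1,3) x] by auto
  finally show ?thesis by simp
qed

lemma quotient_lift_linear:
  assumes "module K V" "module K W" "submodule N K V" "f \<in> linear_maps K V W"
    and ker: "\<And>x. x \<in> N \<Longrightarrow> f x = \<zero>\<^bsub>W\<^esub>"
  shows "(\<lambda>A. the_elem (f ` A)) \<in> linear_maps K (quotient_module V N) W"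
proof -
  interpret V: module K V by fact
  note eq = quotient_lift_eq[OF assms]
  show ?thesis
    by (intro linear_mapsI)
       (auto simp: quotient_module_carrier coset_add[OF assms(1,3)] coset_smult[OF assms(1,3)] eq
         linear_maps_add[OF assms(4)] linear_maps_smult[OF assms(4)] linear_maps_closed[OF assms(4)])
qed

lemma spans_quotient_module:
  assumes "module K V" "submodule N K V" "spans K V S"
  shows "spans K (quotient_module V N) ((\<lambda>x. N +>\<^bsub>V\<^esub> x) ` S)"
  using assms
  by (intro spans_image[OF _ _ coset_linear] module_quotient_module)
     (auto simp: quotient_module_carrier)

section \<open>Direct sums\<close>

lemma mem_direct_sum:
  "f \<in> carrier (direct_sum I V) \<longleftrightarrow> f \<in> (\<Pi>\<^sub>E i\<in>I. carrier (V i)) \<and> finite {i \<in> I. f i \<noteq> \<zero>\<^bsub>V i\<^esub>}"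
  by (simp add: direct_sum_def)

lemma direct_sum_simps [simp]:
  "\<zero>\<^bsub>direct_sum I V\<^esub> = (\<lambda>i\<in>I. \<zero>\<^bsub>V i\<^esub>)"
  "f \<oplus>\<^bsub>direct_sum I V\<^esub> g = (\<lambda>i\<in>I. f i \<oplus>\<^bsub>V i\<^esub> g i)"
  "c \<odot>\<^bsub>direct_sum I V\<^esub> f = (\<lambda>i\<in>I. c \<odot>\<^bsub>V i\<^esub> f i)"
  by (simp_all add: direct_sum_def)

lemma direct_sum_component: "f \<in> carrier (direct_sum I V) \<Longrightarrow> i \<in> I \<Longrightarrow> f i \<in> carrier (V i)"
  by (auto simp: mem_direct_sum)

text \<open>Elements of a direct sum are extensional functions, hence determined by their components
  at the indices in \<open>I\<close>.\<close>

lemma direct_sum_eqI: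
  assumes "f \<in> carrier (direct_sum I V)" "g \<in> carrier (direct_sum I V)" "\<And>i. i \<in> I \<Longrightarrow> f i = g i"
  shows "f = g"
  using assms by (auto simp: mem_direct_sum intro: PiE_ext)

lemma module_direct_sum:
  assumes "cring K" "\<And>i. i \<in> I \<Longrightarrow> module K (V i)"
  shows "module K (direct_sum I V)"
proof -
  interpret K: cring K by fact
  let ?D = "direct_sum I V"
  have ag: "abelian_group (V i)" if "i \<in> I" for i
    using assms(2)[OF that] by (rule module_abelian_group)
  have add: "f \<oplus>\<^bsub>?D\<^esub> g \<in> carrier ?D" if "f \<in> carrier ?D" "g \<in> carrier ?D" for f g
  proof -
    have "f i \<oplus>\<^bsub>V i\<^esub> g i = \<zero>\<^bsub>V i\<^esub>" if "i \<in> I" "f i = \<zero>\<^bsub>V i\<^esub>" "g i = \<zero>\<^bsub>V i\<^esub>" for i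
      using abelian_groupE(5)[OF ag[OF that(1)]] that abelian_groupE(2)[OF ag[OF that(1)]] by simp
    then have "{i\<in>I. f i \<oplus>\<^bsub>V i\<^esub> g i \<noteq> \<zero>\<^bsub>V i\<^esub>} \<subseteq> {i\<in>I. f i \<noteq> \<zero>\<^bsub>V i\<^esub>} \<union> {i\<in>I. g i \<noteq> \<zero>\<^bsub>V i\<^esub>}"
      by auto
    then have "finite {i\<in>I. f i \<oplus>\<^bsub>V i\<^esub> g i \<noteq> \<zero>\<^bsub>V i\<^esub>}"
      by (rule finite_subset) (use that in \<open>simp add: mem_direct_sum\<close>)
    then have "finite {i\<in>I. (f \<oplus>\<^bsub>?D\<^esub> g) i \<noteq> \<zero>\<^bsub>V i\<^esub>}"
      by (rule rev_finite_subset) auto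
    moreover have "f \<oplus>\<^bsub>?D\<^esub> g \<in> (\<Pi>\<^sub>E i\<in>I. carrier (V i))"
      using that by (simp add: restrict_PiE_iff abelian_groupE(1)[OF ag] direct_sum_component)
    ultimately show ?thesis by (simp only: mem_direct_sum)
  qed
  have smult: "c \<odot>\<^bsub>?D\<^esub> f \<in> carrier ?D" if "c \<in> carrier K" "f \<in> carrier ?D" for c f
  proof -
    have "{i\<in>I. c \<odot>\<^bsub>V i\<^esub> f i \<noteq> \<zero>\<^bsub>V i\<^esub>} \<subseteq> {i\<in>I. f i \<noteq> \<zero>\<^bsub>V i\<^esub>}"
      using module.smult_r_null[OF assms(2) that(1)] by auto
    then have "finite {i\<in>I. c \<odot>\<^bsub>V i\<^esub> f i \<noteq> \<zero>\<^bsub>V i\<^esub>}"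
      by (rule finite_subset) (use that in \<open>simp add: mem_direct_sum\<close>)
    then have "finite {i\<in>I. (c \<odot>\<^bsub>?D\<^esub> f) i \<noteq> \<zero>\<^bsub>V i\<^esub>}"
      by (rule rev_finite_subset) auto
    moreover have "c \<odot>\<^bsub>?D\<^esub> f \<in> (\<Pi>\<^sub>E i\<in>I. carrier (V i))"
      using that by (simp add: restrict_PiE_iff module.smult_closed[OF assms(2)] direct_sum_component)
    ultimately show ?thesis by (simp only: mem_direct_sum)
  qed
  have zero: "\<zero>\<^bsub>?D\<^esub> \<in> carrier ?D"
    using abelian_groupE(2)[OF ag] by (auto simp: mem_direct_sum)
  have inv: "\<exists>g\<in>carrier ?D. g \<oplus>\<^bsub>?D\<^esub> f = \<zero>\<^bsub>?D\<^esub>" if f: "f \<in> carrier ?D" for f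
  proof (rule bexI)
    show "(\<ominus>\<^bsub>K\<^esub> \<one>\<^bsub>K\<^esub>) \<odot>\<^bsub>?D\<^esub> f \<in> carrier ?D"
      using f by (intro smult) auto
    have "(\<ominus>\<^bsub>K\<^esub> \<one>\<^bsub>K\<^esub>) \<odot>\<^bsub>V i\<^esub> f i \<oplus>\<^bsub>V i\<^esub> f i = \<zero>\<^bsub>V i\<^esub>" if "i \<in> I" for i
    proof -
      interpret Vi: module K "V i" using assms(2)[OF that] .
      show ?thesis
        using direct_sum_component[OF f that] by (simp add: Vi.smult_l_minus Vi.l_neg)
    qed
    then show "(\<ominus>\<^bsub>K\<^esub> \<one>\<^bsub>K\<^esub>) \<odot>\<^bsub>?D\<^esub> f \<oplus>\<^bsub>?D\<^esub> f = \<zero>\<^bsub>?D\<^esub>"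
      by auto
  qed
  show ?thesis
  proof (rule moduleI[OF assms(1)], rule abelian_groupI)
    fix f g h assume f: "f \<in> carrier ?D" and g: "g \<in> carrier ?D" and h: "h \<in> carrier ?D"
    note c = f[THEN direct_sum_component] g[THEN direct_sum_component] h[THEN direct_sum_component]
    show "f \<oplus>\<^bsub>?D\<^esub> g \<in> carrier ?D" by (rule add[OF f g])
    show "\<exists>g\<in>carrier ?D. g \<oplus>\<^bsub>?D\<^esub> f = \<zero>\<^bsub>?D\<^esub>" by (rule inv[OF f])
    show "f \<oplus>\<^bsub>?D\<^esub> g \<oplus>\<^bsub>?D\<^esub> h = f \<oplus>\<^bsub>?D\<^esub> (g \<oplus>\<^bsub>?D\<^esub> h)"
      using c by (auto simp: restrict_def fun_eq_iff abelian_groupE(3)[OF ag])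
    show "f \<oplus>\<^bsub>?D\<^esub> g = g \<oplus>\<^bsub>?D\<^esub> f"
      using c by (auto simp: restrict_def fun_eq_iff abelian_groupE(4)[OF ag])
    show "\<zero>\<^bsub>?D\<^esub> \<oplus>\<^bsub>?D\<^esub> f = f"
      using c by (intro direct_sum_eqI[OF add[OF zero f] f]) (simp add: abelian_groupE(5)[OF ag])
  next
    fix a b f g assume a: "a \<in> carrier K" and b: "b \<in> carrier K"
      and f: "f \<in> carrier ?D" and g: "g \<in> carrier ?D"
    note c = f[THEN direct_sum_component] g[THEN direct_sum_component]
    show "a \<odot>\<^bsub>?D\<^esub> f \<in> carrier ?D" by (rule smult[OF a f])
    show "(a \<oplus>\<^bsub>K\<^esub> b) \<odot>\<^bsub>?D\<^esub> f = a \<odot>\<^bsub>?D\<^esub> f \<oplus>\<^bsub>?D\<^esub> b \<odot>\<^bsub>?D\<^esub> f"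
      using a b c by (auto simp: restrict_def fun_eq_iff module.smult_l_distr[OF assms(2)])
    show "a \<odot>\<^bsub>?D\<^esub> (f \<oplus>\<^bsub>?D\<^esub> g) = a \<odot>\<^bsub>?D\<^esub> f \<oplus>\<^bsub>?D\<^esub> a \<odot>\<^bsub>?D\<^esub> g"
      using a c by (auto simp: restrict_def fun_eq_iff module.smult_r_distr[OF assms(2)])
    show "(a \<otimes>\<^bsub>K\<^esub> b) \<odot>\<^bsub>?D\<^esub> f = a \<odot>\<^bsub>?D\<^esub> (b \<odot>\<^bsub>?D\<^esub> f)"
      using a b c by (auto simp: restrict_def fun_eq_iff module.smult_assoc1[OF assms(2)])
  next
    fix f assume f: "f \<in> carrier ?D"
    note c = f[THEN direct_sum_component]
    show "\<one>\<^bsub>K\<^esub> \<odot>\<^bsub>?D\<^esub> f = f"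
      using c by (intro direct_sum_eqI[OF smult[OF _ f] f]) (auto simp: module.smult_one[OF assms(2)])
  qed (rule zero)
qed

lemma direct_sum_component_linear:
  "i \<in> I \<Longrightarrow> (\<lambda>f. f i) \<in> linear_maps K (direct_sum I V) (V i)"
  by (intro linear_mapsI) (auto intro: direct_sum_component)

lemma ds_inj_linear:
  assumes "\<And>i. i \<in> I \<Longrightarrow> module K (V i)"
  shows "j \<in> I \<Longrightarrow> ds_inj I V j \<in> linear_maps K (V j) (direct_sum I V)"
proof (rule linear_mapsI)
  assume j: "j \<in> I"
  note ag = module_abelian_group[OF assms]
  fix x y c assume x: "x \<in> carrier (V j)" and y: "y \<in> carrier (V j)"
  have "finite {i \<in> I. ds_inj I V j x i \<noteq> \<zero>\<^bsub>V i\<^esub>}"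
    by (rule finite_subset[of _ "{j}"]) (auto simp: ds_inj_def)
  then show "ds_inj I V j x \<in> carrier (direct_sum I V)"
    using x abelian_groupE(2)[OF ag] by (auto simp: mem_direct_sum) (auto simp: ds_inj_def)
  show "ds_inj I V j (x \<oplus>\<^bsub>V j\<^esub> y) = ds_inj I V j x \<oplus>\<^bsub>direct_sum I V\<^esub> ds_inj I V j y"
    using abelian_groupE(2,5)[OF ag] by (auto simp: ds_inj_def restrict_def fun_eq_iff)
next
  fix x c assume "j \<in> I" "c \<in> carrier K" "x \<in> carrier (V j)"
  then show "ds_inj I V j (c \<odot>\<^bsub>V j\<^esub> x) = c \<odot>\<^bsub>direct_sum I V\<^esub> ds_inj I V j x"
    using module.smult_r_null[OF assms] by (auto simp: ds_inj_def restrict_def fun_eq_iff)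
qed

lemma ds_inj_component: "i \<in> I \<Longrightarrow> ds_inj I V j x i = (if i = j then x else \<zero>\<^bsub>V i\<^esub>)"
  by (simp add: ds_inj_def)

lemma direct_sum_expand:
  assumes "cring K" "\<And>i. i \<in> I \<Longrightarrow> module K (V i)" "f \<in> carrier (direct_sum I V)"
  shows "(\<Oplus>\<^bsub>direct_sum I V\<^esub>i\<in>{i\<in>I. f i \<noteq> \<zero>\<^bsub>V i\<^esub>}. ds_inj I V i (f i)) = f"
proof -
  let ?D = "direct_sum I V" and ?A = "{i\<in>I. f i \<noteq> \<zero>\<^bsub>V i\<^esub>}"
  have D: "module K ?D" by (rule module_direct_sum[OF assms(1,2)])
  interpret D: module K ?D by (rule D)
  have inj: "ds_inj I V i (f i) \<in> carrier ?D" if "i \<in> I" for i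
    by (rule linear_maps_closed[OF ds_inj_linear[where V=V, OF assms(2) that] direct_sum_component[OF assms(3) that]])
  have fin: "finite ?A"
    using assms(3) by (simp add: mem_direct_sum)
  show ?thesis
  proof (rule direct_sum_eqI[OF _ assms(3)])
    show "(\<Oplus>\<^bsub>?D\<^esub>i\<in>?A. ds_inj I V i (f i)) \<in> carrier ?D"
      using inj by (intro D.finsum_closed) auto
    fix j assume j: "j \<in> I"
    interpret Vj: module K "V j" using assms(2)[OF j] .
    note fj = direct_sum_component[OF assms(3) j]
    have "(\<Oplus>\<^bsub>?D\<^esub>i\<in>?A. ds_inj I V i (f i)) j = (\<Oplus>\<^bsub>V j\<^esub>i\<in>?A. ds_inj I V i (f i) j)"
      by (rule linear_maps_finsum[OF D Vj.module_axioms direct_sum_component_linear[OF j]])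
         (simp add: inj)
    also have "\<dots> = (\<Oplus>\<^bsub>V j\<^esub>i\<in>?A. if j = i then f i else \<zero>\<^bsub>V j\<^esub>)"
      using fj j by (intro Vj.finsum_cong') (auto simp: ds_inj_component)
    also have "\<dots> = f j"
    \<comment> \<open>The index \<open>j\<close> belongs to the index set of the sum only if
      \<open>f j\<close> is nonzero. Otherwise all summands vanish, in accordance with the value
      zero of \<open>f j\<close>.\<close>
    proof (cases "f j = \<zero>\<^bsub>V j\<^esub>")
      case True
      then show ?thesis
        using j by (intro trans[OF Vj.add.finprod_one_eqI]) auto
    next
      case False
      \<comment> \<open>The elements \<open>f i\<close> with \<open>i\<close> different from
        \<open>j\<close> belong to other modules. Replacing them by \<open>f j\<close> under the
        condition puts every term into the carrier of \<open>V j\<close>, as the rule for sums with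
        one nonzero term requires.\<close>
      have "(\<Oplus>\<^bsub>V j\<^esub>i\<in>?A. if j = i then f i else \<zero>\<^bsub>V j\<^esub>) = (\<Oplus>\<^bsub>V j\<^esub>i\<in>?A. if j = i then f j else \<zero>\<^bsub>V j\<^esub>)"
        using fj by (intro Vj.finsum_cong') auto
      also have "\<dots> = f j"
        using False j fin fj by (intro Vj.finsum_singleton) auto
      finally show ?thesis .
    qed
    finally show "(\<Oplus>\<^bsub>?D\<^esub>i\<in>?A. ds_inj I V i (f i)) j = f j" .
  qed
qed

text \<open>Every element is the finite sum of its injected components, and the injection carries
  the span of \<open>S i\<close> into the span of the union.\<close>

lemma spans_direct_sum:
  assumes "cring K" "\<And>i. i \<in> I \<Longrightarrow> module K (V i)" "\<And>i. i \<in> I \<Longrightarrow> spans K (V i) (S i)"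
  shows "spans K (direct_sum I V) (\<Union>i\<in>I. ds_inj I V i ` S i)"
proof -
  let ?D = "direct_sum I V" and ?T = "\<Union>i\<in>I. ds_inj I V i ` S i"
  have D: "module K ?D" by (rule module_direct_sum[OF assms(1,2)])
  have S: "S i \<subseteq> carrier (V i)" if "i \<in> I" for i
    using assms(3)[OF that] by (simp add: spans_def)
  have T: "?T \<subseteq> carrier ?D"
    using S by (auto intro!: linear_maps_closed[OF ds_inj_linear[where V=V, OF assms(2)]])
  note N = submodule_lin_span[OF D T]
  have "f \<in> lin_span K ?D ?T" if f: "f \<in> carrier ?D" for f
  proof -
    have "ds_inj I V i (f i) \<in> lin_span K ?D ?T" if i: "i \<in> I" for i
    proof (rule linear_maps_span[OF assms(2)[OF i] D ds_inj_linear[where V=V, OF assms(2) i] N S[OF i]])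
      show "f i \<in> lin_span K (V i) (S i)"
        using direct_sum_component[OF f i] assms(3)[OF i] by (auto simp: spans_def)
      show "ds_inj I V i s \<in> lin_span K ?D ?T" if "s \<in> S i" for s
        using that i by (intro lin_span_base) auto
    qed
    then have "(\<Oplus>\<^bsub>?D\<^esub>i\<in>{i\<in>I. f i \<noteq> \<zero>\<^bsub>V i\<^esub>}. ds_inj I V i (f i)) \<in> lin_span K ?D ?T"
      by (intro submodule_finsum_closed[OF D N]) auto
    then show ?thesis
      by (simp only: direct_sum_expand[OF assms(1,2) f])
  qed
  with T show ?thesis by (auto simp: spans_def)
qed

text \<open>From here on these modules are treated through the module laws. Rewriting sums and
  multiples to pointwise functions would hide the operations to which the laws of linear maps
  apply.\<close>

declare free_module_simps [simp del] direct_sum_simps [simp del]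

section \<open>Tensor products\<close>

text \<open>Names the bilinearity relations that \<open>tensor_rel\<close> writes out inside its
  span, so that membership of a single generator can be stated.\<close>

definition tensor_gens ::
    "('k, 'm) ring_scheme \<Rightarrow> ('k, 'v, 'p) module_scheme \<Rightarrow> ('k, 'w, 'q) module_scheme \<Rightarrow> ('v \<times> 'w \<Rightarrow> 'k) set"
  where "tensor_gens K V W =
    (let F = free_module K (carrier V \<times> carrier W); e = (\<lambda>v w. basis_vec K (v, w)) in
      {e (v \<oplus>\<^bsub>V\<^esub> v') w \<ominus>\<^bsub>F\<^esub> (e v w \<oplus>\<^bsub>F\<^esub> e v' w) | v v' w.
          v \<in> carrier V \<and> v' \<in> carrier V \<and> w \<in> carrier W} \<union>
      {e v (w \<oplus>\<^bsub>W\<^esub> w') \<ominus>\<^bsub>F\<^esub> (e v w \<oplus>\<^bsub>F\<^esub> e v w') | v w w'.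
          v \<in> carrier V \<and> w \<in> carrier W \<and> w' \<in> carrier W} \<union>
      {e (c \<odot>\<^bsub>V\<^esub> v) w \<ominus>\<^bsub>F\<^esub> (c \<odot>\<^bsub>F\<^esub> e v w) | c v w.
          c \<in> carrier K \<and> v \<in> carrier V \<and> w \<in> carrier W} \<union>
      {e v (c \<odot>\<^bsub>W\<^esub> w) \<ominus>\<^bsub>F\<^esub> (c \<odot>\<^bsub>F\<^esub> e v w) | c v w.
          c \<in> carrier K \<and> v \<in> carrier V \<and> w \<in> carrier W})"

lemma tensor_rel_eq:
  "tensor_rel K V W = lin_span K (free_module K (carrier V \<times> carrier W)) (tensor_gens K V W)"
  by (simp add: tensor_rel_def tensor_gens_def Let_def)

lemma tensor_gens_closed:
  assumes "module K V" "module K W"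
  shows "tensor_gens K V W \<subseteq> carrier (free_module K (carrier V \<times> carrier W))"
proof -
  interpret V: module K V by fact
  interpret W: module K W by fact
  interpret F: module K "free_module K (carrier V \<times> carrier W)"
    by (rule module_free_module[OF V.is_cring])
  have "basis_vec K (v, w) \<in> carrier (free_module K (carrier V \<times> carrier W))"
    if "v \<in> carrier V" "w \<in> carrier W" for v w
    using that by (intro basis_vec_closed V.is_cring) auto
  then show ?thesis
    unfolding tensor_gens_def Let_def by auto
qed

lemma submodule_tensor_rel:
  assumes "module K V" "module K W"
  shows "submodule (tensor_rel K V W) K (free_module K (carrier V \<times> carrier W))"
  unfolding tensor_rel_eq
  by (intro submodule_lin_span tensor_gens_closed module_free_module module_cring[OF assms(1)] assms)

lemma module_tensor:
  assumes "module K V" "module K W"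
  shows "module K (tensor K V W)"
  unfolding tensor_def
  by (intro module_quotient_module submodule_tensor_rel module_free_module module_cring[OF assms(1)] assms)

text \<open>Each generator of \<open>tensor_rel\<close> is the difference of the two sides of one of
  the bilinearity laws; the two sides therefore lie in the same coset.\<close>

lemma pure_tensor_bilinear:
  assumes "module K V" "module K W"
  shows "pure_tensor K V W \<in> bilinear_maps K V W (tensor K V W)"
proof -
  interpret V: module K V by fact
  interpret W: module K W by fact
  let ?F = "free_module K (carrier V \<times> carrier W)" and ?T = "tensor K V W"
  have F: "module K ?F" by (rule module_free_module[OF V.is_cring])
  interpret F: module K ?F by (rule F)
  note N = submodule_tensor_rel[OF assms]
  have e: "basis_vec K (v, w) \<in> carrier ?F" if "v \<in> carrier V" "w \<in> carrier W" for v w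
    using that by (intro basis_vec_closed V.is_cring) auto
  have lin: "(\<lambda>x. tensor_rel K V W +>\<^bsub>?F\<^esub> x) \<in> linear_maps K ?F ?T"
    unfolding tensor_def by (rule coset_linear[OF F N])
  have eqI: "tensor_rel K V W +>\<^bsub>?F\<^esub> x = tensor_rel K V W +>\<^bsub>?F\<^esub> y"
    if "x \<in> carrier ?F" "y \<in> carrier ?F" "x \<ominus>\<^bsub>?F\<^esub> y \<in> tensor_gens K V W" for x y
    by (subst coset_eq_iff[OF F N that(1,2)]) (simp add: tensor_rel_eq lin_span_base that(3))
  show ?thesis
  proof (rule bilinear_mapsI)
    fix v w assume "v \<in> carrier V" "w \<in> carrier W"
    then show "pure_tensor K V W v w \<in> carrier ?T"
      unfolding pure_tensor_def by (intro linear_maps_closed[OF lin] e)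
  next
    fix v v' w assume v: "v \<in> carrier V" "v' \<in> carrier V" "w \<in> carrier W"
    have "pure_tensor K V W (v \<oplus>\<^bsub>V\<^esub> v') w =
        tensor_rel K V W +>\<^bsub>?F\<^esub> (basis_vec K (v, w) \<oplus>\<^bsub>?F\<^esub> basis_vec K (v', w))"
      unfolding pure_tensor_def
      by (rule eqI) (use v e in \<open>auto simp: tensor_gens_def Let_def\<close>)
    also have "\<dots> = pure_tensor K V W v w \<oplus>\<^bsub>?T\<^esub> pure_tensor K V W v' w"
      unfolding pure_tensor_def by (intro linear_maps_add[OF lin] e v)
    finally show "pure_tensor K V W (v \<oplus>\<^bsub>V\<^esub> v') w = pure_tensor K V W v w \<oplus>\<^bsub>?T\<^esub> pure_tensor K V W v' w" .
  next
    fix v w w' assume v: "v \<in> carrier V" "w \<in> carrier W" "w' \<in> carrier W"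
    have "pure_tensor K V W v (w \<oplus>\<^bsub>W\<^esub> w') =
        tensor_rel K V W +>\<^bsub>?F\<^esub> (basis_vec K (v, w) \<oplus>\<^bsub>?F\<^esub> basis_vec K (v, w'))"
      unfolding pure_tensor_def
      by (rule eqI) (use v e in \<open>auto simp: tensor_gens_def Let_def\<close>)
    also have "\<dots> = pure_tensor K V W v w \<oplus>\<^bsub>?T\<^esub> pure_tensor K V W v w'"
      unfolding pure_tensor_def by (intro linear_maps_add[OF lin] e v)
    finally show "pure_tensor K V W v (w \<oplus>\<^bsub>W\<^esub> w') = pure_tensor K V W v w \<oplus>\<^bsub>?T\<^esub> pure_tensor K V W v w'" .
  next
    fix c v w assume v: "c \<in> carrier K" "v \<in> carrier V" "w \<in> carrier W"
    have "pure_tensor K V W (c \<odot>\<^bsub>V\<^esub> v) w = tensor_rel K V W +>\<^bsub>?F\<^esub> (c \<odot>\<^bsub>?F\<^esub> basis_vec K (v, w))"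
      unfolding pure_tensor_def
      by (rule eqI) (use v e in \<open>auto simp: tensor_gens_def Let_def\<close>)
    also have "\<dots> = c \<odot>\<^bsub>?T\<^esub> pure_tensor K V W v w"
      unfolding pure_tensor_def by (intro linear_maps_smult[OF lin] e v)
    finally show "pure_tensor K V W (c \<odot>\<^bsub>V\<^esub> v) w = c \<odot>\<^bsub>?T\<^esub> pure_tensor K V W v w" .
    have "pure_tensor K V W v (c \<odot>\<^bsub>W\<^esub> w) = tensor_rel K V W +>\<^bsub>?F\<^esub> (c \<odot>\<^bsub>?F\<^esub> basis_vec K (v, w))"
      unfolding pure_tensor_def
      by (rule eqI) (use v e in \<open>auto simp: tensor_gens_def Let_def\<close>)
    also have "\<dots> = c \<odot>\<^bsub>?T\<^esub> pure_tensor K V W v w"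
      unfolding pure_tensor_def by (intro linear_maps_smult[OF lin] e v)
    finally show "pure_tensor K V W v (c \<odot>\<^bsub>W\<^esub> w) = c \<odot>\<^bsub>?T\<^esub> pure_tensor K V W v w" .
  qed
qed

lemma pure_tensor_closed:
  "module K V \<Longrightarrow> module K W \<Longrightarrow> v \<in> carrier V \<Longrightarrow> w \<in> carrier W \<Longrightarrow>
    pure_tensor K V W v w \<in> carrier (tensor K V W)"
  by (rule bilinear_maps_closed[OF pure_tensor_bilinear])

text \<open>A bilinear map annihilates all four kinds of generators, hence their span. So its
  extension to the free module passes to the quotient.\<close>

lemma bilinear_lin_ext:
  assumes "module K V" "module K W" "module K U" "\<beta> \<in> bilinear_maps K V W U"
  shows "lin_ext K U (\<lambda>(v, w). \<beta> v w) \<in> linear_maps K (free_module K (carrier V \<times> carrier W)) U"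
    and "x \<in> tensor_rel K V W \<Longrightarrow> lin_ext K U (\<lambda>(v, w). \<beta> v w) x = \<zero>\<^bsub>U\<^esub>"
proof -
  interpret V: module K V by fact
  interpret W: module K W by fact
  interpret U: module K U by fact
  let ?F = "free_module K (carrier V \<times> carrier W)" and ?f = "lin_ext K U (\<lambda>(v, w). \<beta> v w)"
  have F: "module K ?F" by (rule module_free_module[OF V.is_cring])
  interpret F: module K ?F by (rule F)
  note cl = bilinear_maps_closed[OF assms(4)]
  show f: "?f \<in> linear_maps K ?F U"
    by (rule lin_ext_linear) (use assms cl in auto)
  have e: "basis_vec K (v, w) \<in> carrier ?F" if "v \<in> carrier V" "w \<in> carrier W" for v w
    using that by (intro basis_vec_closed V.is_cring) auto
  have fe: "?f (basis_vec K (v, w)) = \<beta> v w" if "v \<in> carrier V" "w \<in> carrier W" for v w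
    using cl[OF that] by (simp add: lin_ext_basis_vec[OF assms(3)])
  note simps = linear_maps_minus[OF F assms(3) f] linear_maps_add[OF f] linear_maps_smult[OF f] fe e
  have r: "x \<ominus>\<^bsub>U\<^esub> x = \<zero>\<^bsub>U\<^esub>" if "x \<in> carrier U" for x
    using that by (simp add: a_minus_def U.r_neg)
  have "?f x \<in> {\<zero>\<^bsub>U\<^esub>}" if "x \<in> tensor_gens K V W" for x
    using that unfolding tensor_gens_def Let_def
    by (auto simp: simps r cl linear_maps_add[OF bilinear_maps_right[OF assms(4)]]
      linear_maps_add[OF bilinear_maps_left[OF assms(4)]] linear_maps_smult[OF bilinear_maps_right[OF assms(4)]]
      linear_maps_smult[OF bilinear_maps_left[OF assms(4)]])
  from linear_maps_span[OF F assms(3) f submodule_zero[OF assms(3)] tensor_gens_closed[OF assms(1,2)] this]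
  show "x \<in> tensor_rel K V W \<Longrightarrow> ?f x = \<zero>\<^bsub>U\<^esub>"
    by (simp add: tensor_rel_eq)
qed

text \<open>With \<open>tensor_lift_pure\<close> this is the existence half of the universal
  property of the tensor product; uniqueness is \<open>tensor_eqI\<close>.\<close>

lemma tensor_lift_linear:
  assumes "module K V" "module K W" "module K U" "\<beta> \<in> bilinear_maps K V W U"
  shows "tensor_lift K U \<beta> \<in> linear_maps K (tensor K V W) U"
  using quotient_lift_linear[OF module_free_module[OF module_cring[OF assms(1)]] assms(3)
      submodule_tensor_rel[OF assms(1,2)] bilinear_lin_ext(1)[OF assms] bilinear_lin_ext(2)[OF assms]]
  unfolding tensor_lift_def[abs_def] tensor_def .

lemma tensor_lift_pure:
  assumes "module K V" "module K W" "module K U" "\<beta> \<in> bilinear_maps K V W U"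
    "v \<in> carrier V" "w \<in> carrier W"
  shows "tensor_lift K U \<beta> (pure_tensor K V W v w) = \<beta> v w"
proof -
  note K = module_cring[OF assms(1)]
  have "tensor_lift K U \<beta> (pure_tensor K V W v w) = lin_ext K U (\<lambda>(v, w). \<beta> v w) (basis_vec K (v, w))"
    unfolding tensor_lift_def pure_tensor_def
    by (rule quotient_lift_eq[OF module_free_module[OF K] assms(3)
        submodule_tensor_rel[OF assms(1,2)] bilinear_lin_ext(1)[OF assms(1-4)] bilinear_lin_ext(2)[OF assms(1-4)]])
       (use assms K in \<open>auto intro: basis_vec_closed\<close>)
  also have "\<dots> = \<beta> v w"
    using bilinear_maps_closed[OF assms(4-6)] by (simp add: lin_ext_basis_vec[OF assms(3)])
  finally show ?thesis .
qed

text \<open>The basis of the free module consists of all pairs, so its images, the pure tensors of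
  arbitrary elements, span the quotient. Each of them is then reduced to \<open>S\<close> and
  \<open>T\<close> by linearity in one factor after the other.\<close>

lemma spans_tensor:
  assumes "module K V" "module K W" "spans K V S" "spans K W T"
  shows "spans K (tensor K V W) ((\<lambda>(v, w). pure_tensor K V W v w) ` (S \<times> T))"
proof -
  let ?F = "free_module K (carrier V \<times> carrier W)" and ?Q = "tensor K V W"
  let ?P = "\<lambda>S T. (\<lambda>(v, w). pure_tensor K V W v w) ` (S \<times> T)"
  have F: "module K ?F" by (rule module_free_module[OF module_cring[OF assms(1)]])
  note Q = module_tensor[OF assms(1,2)] and bil = pure_tensor_bilinear[OF assms(1,2)]
  have S: "S \<subseteq> carrier V" and T: "T \<subseteq> carrier W"
    using assms(3,4) by (auto simp: spans_def)
  have P: "?P S T \<subseteq> carrier ?Q"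
    using S T by (auto intro!: pure_tensor_closed[OF assms(1,2)])
  note N = submodule_lin_span[OF Q P]
  have "spans K ?Q ((\<lambda>x. tensor_rel K V W +>\<^bsub>?F\<^esub> x) ` basis_vec K ` (carrier V \<times> carrier W))"
    unfolding tensor_def
    by (rule spans_quotient_module[OF F submodule_tensor_rel[OF assms(1,2)]
        spans_free_module[OF module_cring[OF assms(1)]]])
  also have "(\<lambda>x. tensor_rel K V W +>\<^bsub>?F\<^esub> x) ` basis_vec K ` (carrier V \<times> carrier W) =
      ?P (carrier V) (carrier W)"
    by (force simp: pure_tensor_def)
  finally have "spans K ?Q (?P (carrier V) (carrier W))" .
  moreover have "pure_tensor K V W v w \<in> lin_span K ?Q (?P S T)"
    if v: "v \<in> carrier V" and w: "w \<in> carrier W" for v w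
  proof (rule linear_maps_span[OF assms(1) Q bilinear_maps_left[OF bil w] N S])
    show "v \<in> lin_span K V S"
      using v assms(3) by (auto simp: spans_def)
    fix s assume s: "s \<in> S"
    then have s': "s \<in> carrier V" using S by auto
    show "pure_tensor K V W s w \<in> lin_span K ?Q (?P S T)"
    proof (rule linear_maps_span[OF assms(2) Q bilinear_maps_right[OF bil s'] N T])
      show "w \<in> lin_span K W T"
        using w assms(4) by (auto simp: spans_def)
      show "pure_tensor K V W s t \<in> lin_span K ?Q (?P S T)" if "t \<in> T" for t
        using s that by (intro lin_span_base) auto
    qed
  qed
  ultimately show ?thesis
    by (intro spans_trans[OF Q _ P]) auto
qed

lemma tensor_eqI:
  assumes "module K V" "module K W" "module K U"
    "f \<in> linear_maps K (tensor K V W) U" "g \<in> linear_maps K (tensor K V W) U"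
    "spans K V S" "spans K W T"
    "\<And>s t. s \<in> S \<Longrightarrow> t \<in> T \<Longrightarrow> f (pure_tensor K V W s t) = g (pure_tensor K V W s t)"
    "x \<in> carrier (tensor K V W)"
  shows "f x = g x"
  by (rule linear_maps_eqI[OF module_tensor[OF assms(1,2)] assms(3-5) spans_tensor[OF assms(1,2,6,7)] _ assms(9)])
     (use assms(8) in auto)

lemmas tensor_eqI' = tensor_eqI[OF _ _ _ _ _ spans_carrier spans_carrier]

text \<open>The associator and the product of tensors are nested lifts. Before the outer lift can be
  formed, the inner one has to be linear in the variables that are still free.\<close>

lemma tensor_lift_linear_param:
  assumes "module K A" "module K V" "module K W" "module K U"
    and bil: "\<And>a. a \<in> carrier A \<Longrightarrow> \<beta> a \<in> bilinear_maps K V W U"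
    and lin: "\<And>v w. v \<in> carrier V \<Longrightarrow> w \<in> carrier W \<Longrightarrow> (\<lambda>a. \<beta> a v w) \<in> linear_maps K A U"
    and t: "t \<in> carrier (tensor K V W)"
  shows "(\<lambda>a. tensor_lift K U (\<beta> a) t) \<in> linear_maps K A U"
proof (rule linear_maps_param[OF assms(1) module_tensor[OF assms(2,3)] assms(4)
      spans_tensor[OF assms(2,3) spans_carrier spans_carrier] tensor_lift_linear[OF assms(2-4) bil] _ t])
  interpret A: module K A by fact
  fix s assume "s \<in> (\<lambda>(v, w). pure_tensor K V W v w) ` (carrier V \<times> carrier W)"
  then obtain v w where s: "s = pure_tensor K V W v w" and v: "v \<in> carrier V" and w: "w \<in> carrier W"
    by auto
  show "(\<lambda>a. tensor_lift K U (\<beta> a) s) \<in> linear_maps K A U"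
    by (rule linear_maps_cong[OF assms(1) lin[OF v w]])
       (simp add: s tensor_lift_pure[OF assms(2-4) bil v w])
qed

lemma tensor_map_bilinear:
  assumes "module K V" "module K W" "f \<in> linear_maps K V0 V" "g \<in> linear_maps K W0 W"
  shows "(\<lambda>v w. pure_tensor K V W (f v) (g w)) \<in> bilinear_maps K V0 W0 (tensor K V W)"
  using bilinear_maps_comp[OF assms(3,4) pure_tensor_bilinear[OF assms(1,2)] linear_maps_id] .

lemma tensor_map_linear:
  assumes "module K V0" "module K W0" "module K V" "module K W"
    "f \<in> linear_maps K V0 V" "g \<in> linear_maps K W0 W"
  shows "tensor_map K V W f g \<in> linear_maps K (tensor K V0 W0) (tensor K V W)"
  unfolding tensor_map_def
  by (rule tensor_lift_linear[OF assms(1,2) module_tensor[OF assms(3,4)] tensor_map_bilinear[OF assms(3-6)]])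

lemma tensor_map_pure:
  assumes "module K V0" "module K W0" "module K V" "module K W"
    "f \<in> linear_maps K V0 V" "g \<in> linear_maps K W0 W" "v \<in> carrier V0" "w \<in> carrier W0"
  shows "tensor_map K V W f g (pure_tensor K V0 W0 v w) = pure_tensor K V W (f v) (g w)"
  unfolding tensor_map_def
  by (rule tensor_lift_pure[OF assms(1,2) module_tensor[OF assms(3,4)] tensor_map_bilinear[OF assms(3-6)] assms(7,8)])

text \<open>Functoriality, with the composites replaced by maps that agree with them on carriers. In
  this form the naturality of \<open>fock_class\<close> can be fed in as a hypothesis when the
  coproduct is shown to be natural.\<close>

lemma tensor_map_comp:
  assumes "module K V0" "module K W0" "module K V1" "module K W1" "module K V2" "module K W2"
    "f \<in> linear_maps K V0 V1" "g \<in> linear_maps K W0 W1" "f' \<in> linear_maps K V1 V2" "g' \<in> linear_maps K W1 W2"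
    "f'' \<in> linear_maps K V0 V2" "g'' \<in> linear_maps K W0 W2"
    "\<And>v. v \<in> carrier V0 \<Longrightarrow> f' (f v) = f'' v" "\<And>w. w \<in> carrier W0 \<Longrightarrow> g' (g w) = g'' w"
    "t \<in> carrier (tensor K V0 W0)"
  shows "tensor_map K V2 W2 f' g' (tensor_map K V1 W1 f g t) = tensor_map K V2 W2 f'' g'' t"
proof -
  note l01 = tensor_map_linear[OF assms(1-4,7,8)] and l12 = tensor_map_linear[OF assms(3-6,9,10)]
    and l02 = tensor_map_linear[OF assms(1,2,5,6,11,12)]
  show ?thesis
    by (rule tensor_eqI'[OF assms(1,2) module_tensor[OF assms(5,6)] linear_maps_comp[OF l01 l12] l02 _ assms(15)])
       (simp add: tensor_map_pure[OF assms(1-4,7,8)] tensor_map_pure[OF assms(3-6,9,10)]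
         tensor_map_pure[OF assms(1,2,5,6,11,12)] assms(13,14) linear_maps_closed[OF assms(7)]
         linear_maps_closed[OF assms(8)])
qed

text \<open>For fixed \<open>w\<close> the expression is bilinear in \<open>u\<close> and
  \<open>v\<close> and can be lifted. For pure tensors it is linear in \<open>w\<close>, hence for
  all tensors by linearity in the parameter, and so the outer lift is legitimate too.\<close>

lemma tensor_assoc_bilinear:
  assumes "module K U" "module K V" "module K W"
  defines "T \<equiv> tensor K U (tensor K V W)"
  shows "w \<in> carrier W \<Longrightarrow>
      (\<lambda>u v. pure_tensor K U (tensor K V W) u (pure_tensor K V W v w)) \<in> bilinear_maps K U V T"
    and "(\<lambda>t w. tensor_lift K T (\<lambda>u v. pure_tensor K U (tensor K V W) u (pure_tensor K V W v w)) t)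
      \<in> bilinear_maps K (tensor K U V) W T"
proof -
  note VW = module_tensor[OF assms(2,3)]
  note bVW = pure_tensor_bilinear[OF assms(2,3)] and bU = pure_tensor_bilinear[OF assms(1) VW]
  have T: "module K T"
    unfolding T_def by (rule module_tensor[OF assms(1) VW])
  show b: "(\<lambda>u v. pure_tensor K U (tensor K V W) u (pure_tensor K V W v w)) \<in> bilinear_maps K U V T"
    if "w \<in> carrier W" for w
    using bilinear_maps_comp[OF linear_maps_id bilinear_maps_left[OF bVW that] bU linear_maps_id]
    by (simp add: T_def)
  show "(\<lambda>t w. tensor_lift K T (\<lambda>u v. pure_tensor K U (tensor K V W) u (pure_tensor K V W v w)) t)
      \<in> bilinear_maps K (tensor K U V) W T"
  proof (rule bilinear_mapsI_linear)
    fix t assume t: "t \<in> carrier (tensor K U V)"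
    show "(\<lambda>w. tensor_lift K T (\<lambda>u v. pure_tensor K U (tensor K V W) u (pure_tensor K V W v w)) t)
        \<in> linear_maps K W T"
    proof (rule tensor_lift_linear_param[OF assms(3,1,2) T b _ t])
      fix u v assume "u \<in> carrier U" "v \<in> carrier V"
      then show "(\<lambda>w. pure_tensor K U (tensor K V W) u (pure_tensor K V W v w)) \<in> linear_maps K W T"
        unfolding T_def
        by (rule linear_maps_comp[OF bilinear_maps_right[OF bVW] bilinear_maps_right[OF bU], rotated])
    qed
  next
    fix w assume "w \<in> carrier W"
    then show "(\<lambda>t. tensor_lift K T (\<lambda>u v. pure_tensor K U (tensor K V W) u (pure_tensor K V W v w)) t)
      \<in> linear_maps K (tensor K U V) T"
      by (rule tensor_lift_linear[OF assms(1,2) T b])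
  qed
qed

lemma tensor_assoc_linear:
  assumes "module K U" "module K V" "module K W"
  shows "tensor_assoc K U V W \<in> linear_maps K (tensor K (tensor K U V) W) (tensor K U (tensor K V W))"
  unfolding tensor_assoc_def Let_def
  by (rule tensor_lift_linear[OF module_tensor[OF assms(1,2)] assms(3)
      module_tensor[OF assms(1) module_tensor[OF assms(2,3)]] tensor_assoc_bilinear(2)[OF assms]])

lemma tensor_assoc_pure:
  assumes "module K U" "module K V" "module K W" "u \<in> carrier U" "v \<in> carrier V" "w \<in> carrier W"
  shows "tensor_assoc K U V W (pure_tensor K (tensor K U V) W (pure_tensor K U V u v) w) =
    pure_tensor K U (tensor K V W) u (pure_tensor K V W v w)"
  unfolding tensor_assoc_def Let_def
  by (subst tensor_lift_pure[OF module_tensor[OF assms(1,2)] assms(3)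
      module_tensor[OF assms(1) module_tensor[OF assms(2,3)]] tensor_assoc_bilinear(2)[OF assms(1-3)]
      pure_tensor_closed[OF assms(1,2,4,5)] assms(6)])
     (rule tensor_lift_pure[OF assms(1,2) module_tensor[OF assms(1) module_tensor[OF assms(2,3)]]
      tensor_assoc_bilinear(1)[OF assms(1-3,6)] assms(4,5)])

lemma tensor_mult_bilinear:
  assumes "module K V" "module K W" "module K V1" "module K W1" "module K V2" "module K W2"
    and \<mu>: "\<mu> \<in> bilinear_maps K V1 V2 V" and \<nu>: "\<nu> \<in> bilinear_maps K W1 W2 W"
  shows "a \<in> carrier V1 \<Longrightarrow> b \<in> carrier W1 \<Longrightarrow>
      (\<lambda>a' b'. pure_tensor K V W (\<mu> a a') (\<nu> b b')) \<in> bilinear_maps K V2 W2 (tensor K V W)"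
    and "t \<in> carrier (tensor K V2 W2) \<Longrightarrow>
      (\<lambda>a b. tensor_lift K (tensor K V W) (\<lambda>a' b'. pure_tensor K V W (\<mu> a a') (\<nu> b b')) t)
        \<in> bilinear_maps K V1 W1 (tensor K V W)"
    and "tensor_mult K V W \<mu> \<nu> \<in> bilinear_maps K (tensor K V1 W1) (tensor K V2 W2) (tensor K V W)"
proof -
  let ?T = "tensor K V W"
  note T = module_tensor[OF assms(1,2)]
  show 1: "(\<lambda>a' b'. pure_tensor K V W (\<mu> a a') (\<nu> b b')) \<in> bilinear_maps K V2 W2 ?T"
    if "a \<in> carrier V1" "b \<in> carrier W1" for a b
    by (rule tensor_map_bilinear[OF assms(1,2) bilinear_maps_right[OF \<mu> that(1)] bilinear_maps_right[OF \<nu> that(2)]])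
  \<comment> \<open>With the right-hand elements held fixed, the same expression is bilinear in the
    left-hand ones. This supplies linearity of the inner lift in its parameters.\<close>
  have flip: "(\<lambda>a b. pure_tensor K V W (\<mu> a a') (\<nu> b b')) \<in> bilinear_maps K V1 W1 ?T"
    if "a' \<in> carrier V2" "b' \<in> carrier W2" for a' b'
    by (rule tensor_map_bilinear[OF assms(1,2) bilinear_maps_left[OF \<mu> that(1)] bilinear_maps_left[OF \<nu> that(2)]])
  show 2: "(\<lambda>a b. tensor_lift K ?T (\<lambda>a' b'. pure_tensor K V W (\<mu> a a') (\<nu> b b')) t) \<in> bilinear_maps K V1 W1 ?T"
    if t: "t \<in> carrier (tensor K V2 W2)" for t
  proof (rule bilinear_mapsI_linear)
    fix a assume a: "a \<in> carrier V1"
    show "(\<lambda>b. tensor_lift K ?T (\<lambda>a' b'. pure_tensor K V W (\<mu> a a') (\<nu> b b')) t) \<in> linear_maps K W1 ?T"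
      by (rule tensor_lift_linear_param[OF assms(4,5,6) T 1[OF a] bilinear_maps_right[OF flip a] t])
  next
    fix b assume b: "b \<in> carrier W1"
    show "(\<lambda>a. tensor_lift K ?T (\<lambda>a' b'. pure_tensor K V W (\<mu> a a') (\<nu> b b')) t) \<in> linear_maps K V1 ?T"
      by (rule tensor_lift_linear_param[OF assms(3,5,6) T 1[OF _ b] bilinear_maps_left[OF flip b] t])
  qed
  show "tensor_mult K V W \<mu> \<nu> \<in> bilinear_maps K (tensor K V1 W1) (tensor K V2 W2) ?T"
    unfolding tensor_mult_def[abs_def]
  proof (rule bilinear_mapsI_linear)
    fix s assume s: "s \<in> carrier (tensor K V1 W1)"
    show "(\<lambda>t. tensor_lift K ?T (\<lambda>a b. tensor_lift K ?T (\<lambda>a' b'. pure_tensor K V W (\<mu> a a') (\<nu> b b')) t) s)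
        \<in> linear_maps K (tensor K V2 W2) ?T"
      by (rule tensor_lift_linear_param[OF module_tensor[OF assms(5,6)] assms(3,4) T 2 tensor_lift_linear[OF assms(5,6) T 1] s])
  next
    fix t assume t: "t \<in> carrier (tensor K V2 W2)"
    show "(\<lambda>s. tensor_lift K ?T (\<lambda>a b. tensor_lift K ?T (\<lambda>a' b'. pure_tensor K V W (\<mu> a a') (\<nu> b b')) t) s)
        \<in> linear_maps K (tensor K V1 W1) ?T"
      by (rule tensor_lift_linear[OF assms(3,4) T 2[OF t]])
  qed
qed

lemma tensor_mult_pure:
  assumes "module K V" "module K W" "module K V1" "module K W1" "module K V2" "module K W2"
    and \<mu>: "\<mu> \<in> bilinear_maps K V1 V2 V" and \<nu>: "\<nu> \<in> bilinear_maps K W1 W2 W"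
    and "a \<in> carrier V1" "b \<in> carrier W1" "a' \<in> carrier V2" "b' \<in> carrier W2"
  shows "tensor_mult K V W \<mu> \<nu> (pure_tensor K V1 W1 a b) (pure_tensor K V2 W2 a' b') =
    pure_tensor K V W (\<mu> a a') (\<nu> b b')"
proof -
  note bil = tensor_mult_bilinear[OF assms(1-8)]
  note T = module_tensor[OF assms(1,2)]
  show ?thesis
    unfolding tensor_mult_def
    by (subst tensor_lift_pure[OF assms(3,4) T bil(2)[OF pure_tensor_closed[OF assms(5,6,11,12)]] assms(9,10)])
       (rule tensor_lift_pure[OF assms(5,6) T bil(1)[OF assms(9,10)] assms(11,12)])
qed

section \<open>The Fock space of a species\<close>

text \<open>Keeps the lower bound of the standard sets \<open>{1..n}\<close> from being rewritten to
  a successor.\<close>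

declare One_nat_def [simp del]

section \<open>Linear maps out of a direct sum\<close>

lemma direct_sum_lift_superset:
  assumes "module K W" "\<And>i. i \<in> I \<Longrightarrow> module K (V i)" "\<And>i. i \<in> I \<Longrightarrow> q i \<in> linear_maps K (V i) W"
    "f \<in> carrier (direct_sum I V)" "finite A" "{i \<in> I. f i \<noteq> \<zero>\<^bsub>V i\<^esub>} \<subseteq> A" "A \<subseteq> I"
  shows "(\<Oplus>\<^bsub>W\<^esub>i\<in>{i \<in> I. f i \<noteq> \<zero>\<^bsub>V i\<^esub>}. q i (f i)) = (\<Oplus>\<^bsub>W\<^esub>i\<in>A. q i (f i))"
proof -
  interpret W: module K W by fact
  have "q i (f i) \<in> carrier W" if "i \<in> I" for i
    using linear_maps_closed[OF assms(3)[OF that] direct_sum_component[OF assms(4) that]] .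
  moreover have "q i \<zero>\<^bsub>V i\<^esub> = \<zero>\<^bsub>W\<^esub>" if "i \<in> I" for i
    by (rule linear_maps_zero[OF assms(2)[OF that] assms(1) assms(3)[OF that]])
  ultimately show ?thesis
    using assms(5-7) by (intro W.add.finprod_mono_neutral_cong_left) auto
qed

lemma direct_sum_lift_linear:
  assumes "module K W" "\<And>i. i \<in> I \<Longrightarrow> module K (V i)" "\<And>i. i \<in> I \<Longrightarrow> q i \<in> linear_maps K (V i) W"
  shows "(\<lambda>f. \<Oplus>\<^bsub>W\<^esub>i\<in>{i \<in> I. f i \<noteq> \<zero>\<^bsub>V i\<^esub>}. q i (f i)) \<in> linear_maps K (direct_sum I V) W"
    (is "?L \<in> _")
proof -
  interpret W: module K W by fact
  let ?D = "direct_sum I V"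
  have D: "module K ?D"
    by (rule module_direct_sum[OF module_cring[OF assms(1)] assms(2)])
  interpret D: module K ?D by (rule D)
  have sup: "(\<Oplus>\<^bsub>W\<^esub>i\<in>{i \<in> I. f i \<noteq> \<zero>\<^bsub>V i\<^esub>}. q i (f i)) = (\<Oplus>\<^bsub>W\<^esub>i\<in>A. q i (f i))"
    if "f \<in> carrier ?D" "finite A" "{i \<in> I. f i \<noteq> \<zero>\<^bsub>V i\<^esub>} \<subseteq> A" "A \<subseteq> I" for f A
    by (rule direct_sum_lift_superset[OF assms that])
  have q: "q i (f i) \<in> carrier W" if "f \<in> carrier ?D" "i \<in> I" for f i
    using linear_maps_closed[OF assms(3)[OF that(2)] direct_sum_component[OF that]] .
  have fin: "finite {i \<in> I. f i \<noteq> \<zero>\<^bsub>V i\<^esub>}" if "f \<in> carrier ?D" for f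
    using that by (simp add: mem_direct_sum)
  show ?thesis
  proof (rule linear_mapsI)
    fix f assume f: "f \<in> carrier ?D"
    show "?L f \<in> carrier W"
      using q[OF f] by (intro W.finsum_closed) auto
  next
    fix f g assume f: "f \<in> carrier ?D" and g: "g \<in> carrier ?D"
    \<comment> \<open>The support of the sum is put into the index set along with the other two, so
      all three expressions can be read as sums over \<open>?A\<close>.\<close>
    let ?A = "{i \<in> I. f i \<noteq> \<zero>\<^bsub>V i\<^esub>} \<union> {i \<in> I. g i \<noteq> \<zero>\<^bsub>V i\<^esub>} \<union> {i \<in> I. (f \<oplus>\<^bsub>?D\<^esub> g) i \<noteq> \<zero>\<^bsub>V i\<^esub>}"
    have A: "finite ?A" "?A \<subseteq> I"
      using fin[OF f] fin[OF g] fin[OF D.a_closed[OF f g]] by auto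
    have "?L (f \<oplus>\<^bsub>?D\<^esub> g) = (\<Oplus>\<^bsub>W\<^esub>i\<in>?A. q i ((f \<oplus>\<^bsub>?D\<^esub> g) i))"
      by (rule sup[OF D.a_closed[OF f g] A(1) _ A(2)]) auto
    also have "\<dots> = (\<Oplus>\<^bsub>W\<^esub>i\<in>?A. q i (f i) \<oplus>\<^bsub>W\<^esub> q i (g i))"
    proof (rule W.finsum_cong'[OF refl])
      show "(\<lambda>i. q i (f i) \<oplus>\<^bsub>W\<^esub> q i (g i)) \<in> ?A \<rightarrow> carrier W"
        using q[OF f] q[OF g] by auto
      show "q i ((f \<oplus>\<^bsub>?D\<^esub> g) i) = q i (f i) \<oplus>\<^bsub>W\<^esub> q i (g i)" if "i \<in> ?A" for i
        using that direct_sum_component[OF f] direct_sum_component[OF g]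
        by (auto simp: direct_sum_simps linear_maps_add[OF assms(3)])
    qed
    also have "\<dots> = (\<Oplus>\<^bsub>W\<^esub>i\<in>?A. q i (f i)) \<oplus>\<^bsub>W\<^esub> (\<Oplus>\<^bsub>W\<^esub>i\<in>?A. q i (g i))"
      using q[OF f] q[OF g] by (intro W.finsum_addf) auto
    also have "(\<Oplus>\<^bsub>W\<^esub>i\<in>?A. q i (f i)) = ?L f"
      by (rule sup[OF f A(1) _ A(2), symmetric]) auto
    also have "(\<Oplus>\<^bsub>W\<^esub>i\<in>?A. q i (g i)) = ?L g"
      by (rule sup[OF g A(1) _ A(2), symmetric]) auto
    finally show "?L (f \<oplus>\<^bsub>?D\<^esub> g) = ?L f \<oplus>\<^bsub>W\<^esub> ?L g" .
  next
    fix c f assume c: "c \<in> carrier K" and f: "f \<in> carrier ?D"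
    let ?A = "{i \<in> I. f i \<noteq> \<zero>\<^bsub>V i\<^esub>}"
    have sub: "{i \<in> I. (c \<odot>\<^bsub>?D\<^esub> f) i \<noteq> \<zero>\<^bsub>V i\<^esub>} \<subseteq> ?A"
      using module.smult_r_null[OF assms(2) c] by (auto simp: direct_sum_simps)
    have "?L (c \<odot>\<^bsub>?D\<^esub> f) = (\<Oplus>\<^bsub>W\<^esub>i\<in>?A. q i ((c \<odot>\<^bsub>?D\<^esub> f) i))"
      by (rule sup[OF D.smult_closed[OF c f] fin[OF f] sub]) auto
    also have "\<dots> = (\<Oplus>\<^bsub>W\<^esub>i\<in>?A. c \<odot>\<^bsub>W\<^esub> q i (f i))"
    proof (rule W.finsum_cong'[OF refl])
      show "(\<lambda>i. c \<odot>\<^bsub>W\<^esub> q i (f i)) \<in> ?A \<rightarrow> carrier W"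
        using q[OF f] c by auto
      show "q i ((c \<odot>\<^bsub>?D\<^esub> f) i) = c \<odot>\<^bsub>W\<^esub> q i (f i)" if "i \<in> ?A" for i
        using that direct_sum_component[OF f] c
        by (auto simp: direct_sum_simps linear_maps_smult[OF assms(3)])
    qed
    also have "\<dots> = c \<odot>\<^bsub>W\<^esub> ?L f"
      using q[OF f] c fin[OF f] by (intro W.finsum_smult_ldistr[symmetric]) auto
    finally show "?L (c \<odot>\<^bsub>?D\<^esub> f) = c \<odot>\<^bsub>W\<^esub> ?L f" .
  qed
qed

lemma direct_sum_lift_inj:
  assumes "module K W" "\<And>i. i \<in> I \<Longrightarrow> module K (V i)" "\<And>i. i \<in> I \<Longrightarrow> q i \<in> linear_maps K (V i) W"
    "j \<in> I" "x \<in> carrier (V j)"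
  shows "(\<Oplus>\<^bsub>W\<^esub>i\<in>{i \<in> I. ds_inj I V j x i \<noteq> \<zero>\<^bsub>V i\<^esub>}. q i (ds_inj I V j x i)) = q j x"
proof -
  interpret W: module K W by fact
  have "(\<Oplus>\<^bsub>W\<^esub>i\<in>{i \<in> I. ds_inj I V j x i \<noteq> \<zero>\<^bsub>V i\<^esub>}. q i (ds_inj I V j x i)) =
      (\<Oplus>\<^bsub>W\<^esub>i\<in>{j}. q i (ds_inj I V j x i))"
    by (rule direct_sum_lift_superset[OF assms(1-3) linear_maps_closed[OF ds_inj_linear[where V=V, OF assms(2,4)] assms(5)]])
       (use assms(4) in \<open>auto simp: ds_inj_component split: if_splits\<close>)
  also have "\<dots> = q j x"
    using linear_maps_closed[OF assms(3)[OF assms(4)] assms(5)] assms(4)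
    by (simp add: ds_inj_component)
  finally show ?thesis .
qed

section \<open>Functoriality of a species over a commutative ring\<close>

locale cring_species =
  fixes K :: "('k, 'm) ring_scheme" and E :: "('a, 'k, 'v, 'z) species_scheme"
  assumes cring_K: "cring K" and linear_species: "linear_species K E"
begin

lemma module_obj: "finite X \<Longrightarrow> module K (sp_obj E X)"
  using linear_species by (simp add: linear_species_def)

lemma map_linear:
  "finite X \<Longrightarrow> bij_betw \<sigma> X X' \<Longrightarrow> sp_map E X X' \<sigma> \<in> linear_maps K (sp_obj E X') (sp_obj E X)"
  using linear_species by (simp add: linear_species_def)

lemma map_closed:
  "finite X \<Longrightarrow> bij_betw \<sigma> X X' \<Longrightarrow> v \<in> carrier (sp_obj E X') \<Longrightarrow> sp_map E X X' \<sigma> v \<in> carrier (sp_obj E X)"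
  by (rule linear_maps_closed[OF map_linear])

lemma map_cong:
  "finite X \<Longrightarrow> bij_betw \<sigma> X X' \<Longrightarrow> (\<And>i. i \<in> X \<Longrightarrow> \<sigma> i = \<tau> i) \<Longrightarrow> v \<in> carrier (sp_obj E X') \<Longrightarrow>
    sp_map E X X' \<sigma> v = sp_map E X X' \<tau> v"
  using linear_species by (simp add: linear_species_def)

lemma map_id: "finite X \<Longrightarrow> v \<in> carrier (sp_obj E X) \<Longrightarrow> sp_map E X X id v = v"
  using linear_species by (simp add: linear_species_def)

lemma map_comp:
  "finite X \<Longrightarrow> bij_betw \<sigma> X X' \<Longrightarrow> bij_betw \<tau> X' X'' \<Longrightarrow> v \<in> carrier (sp_obj E X'') \<Longrightarrow>
    sp_map E X X' \<sigma> (sp_map E X' X'' \<tau> v) = sp_map E X X'' (\<tau> \<circ> \<sigma>) v"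
  using linear_species by (simp add: linear_species_def)

end

text \<open>Lists are indexed from 0 while the standard sets begin at 1, hence the shift by one in
  front of the lookup.\<close>

lemma bij_betw_sorted_list_nth:
  assumes "finite (X :: nat set)"
  shows "bij_betw (\<lambda>i. sorted_list_of_set X ! (i - 1)) {1..card X} X"
proof -
  have "bij_betw (\<lambda>i. i - 1) {1..card X} {..<card X}"
    by (rule bij_betw_byWitness[where f' = Suc]) auto
  moreover have "bij_betw ((!) (sorted_list_of_set X)) {..<card X} X"
    using assms by (intro bij_betw_nth) auto
  ultimately show ?thesis
    using bij_betw_trans by (fastforce simp: comp_def)
qed

text \<open>The candidate for the linear map out of the Fock space with values
  \<open>\<phi> n\<close> on representatives in degree \<open>n\<close>. The sum runs over the
  support because only there can a component contribute; \<open>fock_comult\<close> is literally of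
  this shape.\<close>

definition fock_lift ::
    "('k, 'm) ring_scheme \<Rightarrow> (nat, 'k, 'v, 'z) species_scheme \<Rightarrow> ('k, 'w, 'q) module_scheme \<Rightarrow>
      (nat \<Rightarrow> 'v \<Rightarrow> 'w) \<Rightarrow> (nat \<Rightarrow> 'v set) \<Rightarrow> 'w"
  where "fock_lift K E W \<phi> f =
    (\<Oplus>\<^bsub>W\<^esub>n\<in>{n. f n \<noteq> \<zero>\<^bsub>coinvariants K E n\<^esub>}. the_elem (\<phi> n ` f n))"

text \<open>A family of linear maps invariant under the symmetric groups, which is exactly the datum
  of a linear map out of the direct sum of the coinvariants.\<close>

definition fock_cone ::
    "('k, 'm) ring_scheme \<Rightarrow> (nat, 'k, 'v, 'z) species_scheme \<Rightarrow> ('k, 'w, 'q) module_scheme \<Rightarrow>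
      (nat \<Rightarrow> 'v \<Rightarrow> 'w) \<Rightarrow> bool"
  where "fock_cone K E W \<phi> \<longleftrightarrow>
    (\<forall>n. \<phi> n \<in> linear_maps K (sp_obj E {1..n}) W) \<and>
    (\<forall>n \<sigma>. \<forall>v\<in>carrier (sp_obj E {1..n}). bij_betw \<sigma> {1..n} {1..n} \<longrightarrow>
      \<phi> n (sp_map E {1..n} {1..n} \<sigma> v) = \<phi> n v)"

locale fock_species = cring_species K E
  for K :: "('k, 'm) ring_scheme" and E :: "(nat, 'k, 'v, 'z) species_scheme"
begin

abbreviation "F \<equiv> fock K E"
abbreviation "obj \<equiv> \<lambda>n. sp_obj E {1..n}"
abbreviation "coset \<equiv> \<lambda>n x. coinv_rel K E n +>\<^bsub>obj n\<^esub> x"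

lemma module_n: "module K (obj n)"
  by (rule module_obj) simp

definition "coinv_gens n = {v \<ominus>\<^bsub>obj n\<^esub> sp_map E {1..n} {1..n} \<sigma> v | v \<sigma>.
         v \<in> carrier (obj n) \<and> bij_betw \<sigma> {1..n} {1..n}}"

lemma coinv_gens_closed: "coinv_gens n \<subseteq> carrier (obj n)"
proof -
  interpret V: module K "obj n" by (rule module_n)
  show ?thesis
    by (auto simp: coinv_gens_def intro!: map_closed)
qed

lemma coinv_rel_eq: "coinv_rel K E n = lin_span K (obj n) (coinv_gens n)"
  by (simp add: coinv_rel_def coinv_gens_def)

lemma submodule_coinv_rel: "submodule (coinv_rel K E n) K (obj n)"
  unfolding coinv_rel_eq by (rule submodule_lin_span[OF module_n coinv_gens_closed])

lemma module_coinvariants: "module K (coinvariants K E n)"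
  unfolding coinvariants_def by (rule module_quotient_module[OF module_n submodule_coinv_rel])

lemma module_fock: "module K F"
  unfolding fock_def by (rule module_direct_sum[OF cring_K module_coinvariants])

lemma coset_n_linear: "coset n \<in> linear_maps K (obj n) (coinvariants K E n)"
  unfolding coinvariants_def by (rule coset_linear[OF module_n submodule_coinv_rel])

lemma coset_sp_map:
  assumes "bij_betw \<sigma> {1..n} {1..n}" "v \<in> carrier (obj n)"
  shows "coset n (sp_map E {1..n} {1..n} \<sigma> v) = coset n v"
proof -
  have "coset n v = coset n (sp_map E {1..n} {1..n} \<sigma> v)"
    unfolding coset_eq_iff[OF module_n submodule_coinv_rel assms(2) map_closed[OF finite_atLeastAtMost assms]]
    unfolding coinv_rel_eq by (rule lin_span_base) (use assms in \<open>auto simp: coinv_gens_def\<close>)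
  then show ?thesis ..
qed

lemma ds_inj_fock_linear: "ds_inj UNIV (coinvariants K E) n \<in> linear_maps K (coinvariants K E n) F"
  unfolding fock_def by (rule ds_inj_linear[OF module_coinvariants UNIV_I])

lemma fock_class_linear:
  assumes "finite X"
  shows "fock_class K E X \<in> linear_maps K (sp_obj E X) F"
  unfolding fock_class_def[abs_def]
  by (rule linear_maps_comp[OF linear_maps_comp[OF map_linear[OF _ bij_betw_sorted_list_nth[OF assms]]
      coset_n_linear] ds_inj_fock_linear]) simp

lemma fock_class_closed: "finite X \<Longrightarrow> x \<in> carrier (sp_obj E X) \<Longrightarrow> fock_class K E X x \<in> carrier F"
  by (rule linear_maps_closed[OF fock_class_linear])

text \<open>Two bijections from \<open>{1..n}\<close> onto \<open>X\<close> differ by a permutation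
  of \<open>{1..n}\<close>, and coinvariants do not see permutations. So the increasing bijection in
  \<open>fock_class\<close> is no real choice.\<close>

lemma fock_class_bij:
  assumes "bij_betw \<tau> {1..n} X" "x \<in> carrier (sp_obj E X)"
  shows "fock_class K E X x = ds_inj UNIV (coinvariants K E) n (coset n (sp_map E {1..n} X \<tau> x))"
proof -
  let ?e = "\<lambda>i. sorted_list_of_set X ! (i - 1)"
  have fin: "finite X" and n: "card X = n"
    using bij_betw_finite[OF assms(1)] bij_betw_same_card[OF assms(1)] by auto
  have e: "bij_betw ?e {1..n} X"
    using bij_betw_sorted_list_nth[OF fin] n by simp
  \<comment> \<open>The permutation with \<open>\<tau> = ?e \<circ> \<pi>\<close> on
    \<open>{1..n}\<close>. By contravariance, relabelling along \<open>\<tau>\<close> is relabelling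
    along \<open>?e\<close> followed by the action of \<open>\<pi>\<close>.\<close>
  define \<pi> where "\<pi> = inv_into {1..n} ?e \<circ> \<tau>"
  have \<pi>: "bij_betw \<pi> {1..n} {1..n}"
    unfolding \<pi>_def by (rule bij_betw_trans[OF assms(1) bij_betw_inv_into[OF e]])
  have "sp_map E {1..n} X \<tau> x = sp_map E {1..n} X (?e \<circ> \<pi>) x"
    using assms bij_betw_inv_into_right[OF e] bij_betw_apply[OF assms(1)]
    by (intro map_cong) (auto simp: \<pi>_def)
  also have "\<dots> = sp_map E {1..n} {1..n} \<pi> (sp_map E {1..n} X ?e x)"
    by (rule map_comp[OF _ \<pi> e assms(2), symmetric]) simp
  finally have "coset n (sp_map E {1..n} X \<tau> x) = coset n (sp_map E {1..n} X ?e x)"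
    using coset_sp_map[OF \<pi> map_closed[OF _ e assms(2)]] by simp
  then show ?thesis
    by (simp add: fock_class_def n)
qed

text \<open>Transport to \<open>X\<close> followed by the increasing enumeration of \<open>X\<close>
  is transport along some bijection from the standard set to \<open>X'\<close>, and any such
  bijection computes the class on \<open>X'\<close>.\<close>

lemma fock_class_natural:
  assumes "finite X" "bij_betw \<sigma> X X'" "x \<in> carrier (sp_obj E X')"
  shows "fock_class K E X (sp_map E X X' \<sigma> x) = fock_class K E X' x"
proof -
  let ?n = "card X"
  note e = bij_betw_sorted_list_nth[OF assms(1)]
  have "fock_class K E X (sp_map E X X' \<sigma> x) = ds_inj UNIV (coinvariants K E) ?n
      (coset ?n (sp_map E {1..?n} X (\<lambda>i. sorted_list_of_set X ! (i - 1)) (sp_map E X X' \<sigma> x)))"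
    by (rule fock_class_bij[OF e map_closed[OF assms]])
  also have "sp_map E {1..?n} X (\<lambda>i. sorted_list_of_set X ! (i - 1)) (sp_map E X X' \<sigma> x) =
      sp_map E {1..?n} X' (\<sigma> \<circ> (\<lambda>i. sorted_list_of_set X ! (i - 1))) x"
    by (rule map_comp[OF _ e assms(2,3)]) simp
  also have "ds_inj UNIV (coinvariants K E) ?n (coset ?n \<dots>) = fock_class K E X' x"
    by (rule fock_class_bij[OF bij_betw_trans[OF e assms(2)] assms(3), symmetric])
  finally show ?thesis .
qed

lemma fock_class_n:
  assumes "x \<in> carrier (obj n)"
  shows "fock_class K E {1..n} x = ds_inj UNIV (coinvariants K E) n (coset n x)"
  using fock_class_bij[OF bij_betw_id assms] map_id[OF _ assms] by simp

lemma fock_class_to_n: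
  assumes "finite X" "x \<in> carrier (sp_obj E X)"
  obtains y where "y \<in> carrier (obj (card X))" "fock_class K E X x = fock_class K E {1..card X} y"
    "y = sp_map E {1..card X} X (\<lambda>i. sorted_list_of_set X ! (i - 1)) x"
  using fock_class_natural[OF _ bij_betw_sorted_list_nth[OF assms(1)] assms(2)]
    map_closed[OF _ bij_betw_sorted_list_nth[OF assms(1)] assms(2)] that by simp

lemma spans_fock: "spans K F (\<Union>n. fock_class K E {1..n} ` carrier (obj n))"
proof -
  have "spans K F (\<Union>n\<in>UNIV. ds_inj UNIV (coinvariants K E) n ` (coset n ` carrier (obj n)))"
    unfolding fock_def
  proof (rule spans_direct_sum[OF cring_K module_coinvariants])
    show "spans K (coinvariants K E n) (coset n ` carrier (obj n))" for n
      unfolding coinvariants_def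
      by (rule spans_quotient_module[OF module_n submodule_coinv_rel spans_carrier])
  qed
  also have "(\<Union>n\<in>UNIV. ds_inj UNIV (coinvariants K E) n ` (coset n ` carrier (obj n))) =
      (\<Union>n. fock_class K E {1..n} ` carrier (obj n))"
    by (intro SUP_cong refl) (simp add: image_image fock_class_n cong: image_cong)
  finally show ?thesis .
qed

lemma fock_eqI:
  assumes "module K W" "f \<in> linear_maps K F W" "g \<in> linear_maps K F W"
    "\<And>n x. x \<in> carrier (obj n) \<Longrightarrow> f (fock_class K E {1..n} x) = g (fock_class K E {1..n} x)"
    "u \<in> carrier F"
  shows "f u = g u"
  by (rule linear_maps_eqI[OF module_fock assms(1-3) spans_fock _ assms(5)]) (use assms(4) in auto)

lemma fock_coneI:
  assumes "\<And>n. \<phi> n \<in> linear_maps K (obj n) W"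
    and "\<And>n \<sigma> v. v \<in> carrier (obj n) \<Longrightarrow> bij_betw \<sigma> {1..n} {1..n} \<Longrightarrow>
      \<phi> n (sp_map E {1..n} {1..n} \<sigma> v) = \<phi> n v"
  shows "fock_cone K E W \<phi>"
  using assms by (simp add: fock_cone_def)

lemma fock_cone_linear: "fock_cone K E W \<phi> \<Longrightarrow> \<phi> n \<in> linear_maps K (obj n) W"
  by (simp add: fock_cone_def)

lemma fock_cone_ker:
  assumes "module K W" "fock_cone K E W \<phi>" "x \<in> coinv_rel K E n"
  shows "\<phi> n x = \<zero>\<^bsub>W\<^esub>"
proof -
  interpret W: module K W by fact
  note lin = fock_cone_linear[OF assms(2), of n]
  have "\<phi> n x \<in> {\<zero>\<^bsub>W\<^esub>}"
  proof (rule linear_maps_span[OF module_n assms(1) lin submodule_zero[OF assms(1)] coinv_gens_closed])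
    show "x \<in> lin_span K (obj n) (coinv_gens n)"
      using assms(3) by (simp add: coinv_rel_eq)
    fix s assume "s \<in> coinv_gens n"
    then obtain v \<sigma> where s: "s = v \<ominus>\<^bsub>obj n\<^esub> sp_map E {1..n} {1..n} \<sigma> v"
      and v: "v \<in> carrier (obj n)" and \<sigma>: "bij_betw \<sigma> {1..n} {1..n}"
      by (auto simp: coinv_gens_def)
    have "\<phi> n s = \<phi> n v \<ominus>\<^bsub>W\<^esub> \<phi> n (sp_map E {1..n} {1..n} \<sigma> v)"
      unfolding s by (rule linear_maps_minus[OF module_n assms(1) lin v map_closed[OF _ \<sigma> v]]) simp
    also have "\<dots> = \<zero>\<^bsub>W\<^esub>"
      using assms(2) v \<sigma> linear_maps_closed[OF lin v]
      by (simp add: fock_cone_def a_minus_def W.r_neg)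
    finally show "\<phi> n s \<in> {\<zero>\<^bsub>W\<^esub>}" by simp
  qed
  then show ?thesis by simp
qed

lemma fock_lift_linear:
  assumes "module K W" "fock_cone K E W \<phi>"
  shows "fock_lift K E W \<phi> \<in> linear_maps K F W"
proof -
  have "(\<lambda>A. the_elem (\<phi> n ` A)) \<in> linear_maps K (coinvariants K E n) W" for n
    unfolding coinvariants_def
    by (rule quotient_lift_linear[OF module_n assms(1) submodule_coinv_rel fock_cone_linear[OF assms(2)]
        fock_cone_ker[OF assms]])
  from direct_sum_lift_linear[OF assms(1) module_coinvariants this, where I=UNIV]
  show ?thesis
    by (simp add: fock_lift_def[abs_def] fock_def)
qed

lemma fock_lift_class:
  assumes "module K W" "fock_cone K E W \<phi>" "x \<in> carrier (obj n)"
  shows "fock_lift K E W \<phi> (fock_class K E {1..n} x) = \<phi> n x"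
proof -
  have lin: "(\<lambda>A. the_elem (\<phi> n ` A)) \<in> linear_maps K (coinvariants K E n) W" for n
    unfolding coinvariants_def
    by (rule quotient_lift_linear[OF module_n assms(1) submodule_coinv_rel fock_cone_linear[OF assms(2)]
        fock_cone_ker[OF assms(1,2)]])
  have "fock_lift K E W \<phi> (fock_class K E {1..n} x) = the_elem (\<phi> n ` coset n x)"
    using direct_sum_lift_inj[where I=UNIV and V="coinvariants K E" and q="\<lambda>n A. the_elem (\<phi> n ` A)",
        OF assms(1) module_coinvariants lin UNIV_I linear_maps_closed[OF coset_n_linear assms(3)]]
    by (simp add: fock_lift_def fock_class_n[OF assms(3)])
  also have "\<dots> = \<phi> n x"
    by (rule quotient_lift_eq[OF module_n assms(1) submodule_coinv_rel fock_cone_linear[OF assms(2)]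
        fock_cone_ker[OF assms(1,2)] assms(3)])
  finally show ?thesis .
qed

text \<open>The class of \<open>x\<close> on \<open>X\<close> is the class of its transport to
  \<open>{1..card X}\<close>, and naturality along this transport brings the value of the lift back
  to \<open>X\<close>. Hence a family natural for all bijections has a lift that can be evaluated on
  any finite set.\<close>

lemma fock_lift_natural:
  assumes "module K W"
    and lin: "\<And>X. finite X \<Longrightarrow> \<phi> X \<in> linear_maps K (sp_obj E X) W"
    and nat: "\<And>X X' \<sigma> x. finite X \<Longrightarrow> bij_betw \<sigma> X X' \<Longrightarrow> x \<in> carrier (sp_obj E X') \<Longrightarrow>
      \<phi> X (sp_map E X X' \<sigma> x) = \<phi> X' x"
  shows "fock_cone K E W (\<lambda>n. \<phi> {1..n})"
    and "finite X \<Longrightarrow> x \<in> carrier (sp_obj E X) \<Longrightarrow>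
      fock_lift K E W (\<lambda>n. \<phi> {1..n}) (fock_class K E X x) = \<phi> X x"
proof -
  show cone: "fock_cone K E W (\<lambda>n. \<phi> {1..n})"
    by (intro fock_coneI lin nat) auto
  assume X: "finite X" and x: "x \<in> carrier (sp_obj E X)"
  obtain y where y: "y \<in> carrier (obj (card X))" "fock_class K E X x = fock_class K E {1..card X} y"
    "y = sp_map E {1..card X} X (\<lambda>i. sorted_list_of_set X ! (i - 1)) x"
    by (rule fock_class_to_n[OF X x])
  have "\<phi> {1..card X} y = \<phi> X x"
    unfolding y(3) by (rule nat[OF _ bij_betw_sorted_list_nth[OF X] x]) simp
  with y show "fock_lift K E W (\<lambda>n. \<phi> {1..n}) (fock_class K E X x) = \<phi> X x"
    by (simp add: fock_lift_class[OF assms(1) cone])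
qed

text \<open>Serves the Fock product, a lift in the first factor of lifts in the second.\<close>

lemma fock_lift_linear_param:
  assumes "module K A" "module K W" "\<And>a. a \<in> carrier A \<Longrightarrow> fock_cone K E W (\<phi> a)"
    and lin: "\<And>n x. x \<in> carrier (obj n) \<Longrightarrow> (\<lambda>a. \<phi> a n x) \<in> linear_maps K A W"
    and u: "u \<in> carrier F"
  shows "(\<lambda>a. fock_lift K E W (\<phi> a) u) \<in> linear_maps K A W"
proof (rule linear_maps_param[OF assms(1) module_fock assms(2) spans_fock fock_lift_linear[OF assms(2,3)] _ u])
  fix s assume "s \<in> (\<Union>n. fock_class K E {1..n} ` carrier (obj n))"
  then obtain n x where s: "s = fock_class K E {1..n} x" and x: "x \<in> carrier (obj n)"
    by auto
  show "(\<lambda>a. fock_lift K E W (\<phi> a) s) \<in> linear_maps K A W"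
    by (rule linear_maps_cong[OF assms(1) lin[OF x]])
       (simp add: s fock_lift_class[OF assms(2,3) x])
qed

end

section \<open>The algebra structure of the Fock space\<close>

text \<open>The Fock algebra is the Fock space with its product and unit fields filled in. This
  lemma and the rewrite rules after it carry the linear notions across that record update.\<close>

lemma module_update_mult_one:
  assumes "module K V"
  shows "module K (V\<lparr>mult := m, one := u\<rparr>)"
proof -
  interpret V: module K V by fact
  show ?thesis
    by (intro moduleI abelian_groupI V.is_cring)
       (auto simp: V.a_ac V.smult_l_distr V.smult_r_distr V.smult_assoc1 intro: bexI[of _ "\<ominus>\<^bsub>V\<^esub> _"] V.l_neg)
qed

lemma linear_maps_update [simp]:
  "linear_maps K (V\<lparr>mult := m, one := u\<rparr>) W = linear_maps K V W"
  "linear_maps K V (W\<lparr>mult := m', one := u'\<rparr>) = linear_maps K V W"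
  by (simp_all add: linear_maps_def)

lemma bilinear_maps_update [simp]:
  "bilinear_maps K (U\<lparr>mult := m, one := u\<rparr>) V W = bilinear_maps K U V W"
  "bilinear_maps K U (V\<lparr>mult := m', one := u'\<rparr>) W = bilinear_maps K U V W"
  "bilinear_maps K U V (W\<lparr>mult := m'', one := u''\<rparr>) = bilinear_maps K U V W"
  by (simp_all add: bilinear_maps_def)

lemma tensor_rel_update [simp]:
  "tensor_rel K (V\<lparr>mult := m, one := u\<rparr>) W = tensor_rel K V W"
  "tensor_rel K V (W\<lparr>mult := m', one := u'\<rparr>) = tensor_rel K V W"
  by (simp_all add: tensor_rel_def)

lemma tensor_update [simp]:
  "tensor K (V\<lparr>mult := m, one := u\<rparr>) W = tensor K V W"
  "tensor K V (W\<lparr>mult := m', one := u'\<rparr>) = tensor K V W"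
  by (simp_all add: tensor_def)

lemma pure_tensor_update [simp]:
  "pure_tensor K (V\<lparr>mult := m, one := u\<rparr>) W = pure_tensor K V W"
  "pure_tensor K V (W\<lparr>mult := m', one := u'\<rparr>) = pure_tensor K V W"
  by (simp_all add: pure_tensor_def fun_eq_iff)

lemma tensor_map_update [simp]:
  "tensor_map K (V\<lparr>mult := m, one := u\<rparr>) W = tensor_map K V W"
  "tensor_map K V (W\<lparr>mult := m', one := u'\<rparr>) = tensor_map K V W"
  by (simp_all add: tensor_map_def fun_eq_iff)

lemma tensor_assoc_update [simp]:
  "tensor_assoc K (U\<lparr>mult := m, one := u\<rparr>) V W = tensor_assoc K U V W"
  "tensor_assoc K U (V\<lparr>mult := m', one := u'\<rparr>) W = tensor_assoc K U V W"
  "tensor_assoc K U V (W\<lparr>mult := m'', one := u''\<rparr>) = tensor_assoc K U V W"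
  by (simp_all add: tensor_assoc_def Let_def)

lemma tensor_mult_update [simp]:
  "tensor_mult K (V\<lparr>mult := m, one := u\<rparr>) W = tensor_mult K V W"
  "tensor_mult K V (W\<lparr>mult := m', one := u'\<rparr>) = tensor_mult K V W"
  by (simp_all add: tensor_mult_def fun_eq_iff)

lemma abelian_group_minus_eq_zero_iff:
  assumes "abelian_group W" "x \<in> carrier W" "y \<in> carrier W"
  shows "x \<ominus>\<^bsub>W\<^esub> y = \<zero>\<^bsub>W\<^esub> \<longleftrightarrow> x = y"
proof -
  interpret W: abelian_group W by fact
  show ?thesis
    using assms(2,3) W.minus_equality[of x "\<ominus>\<^bsub>W\<^esub> y"] by (auto simp: a_minus_def W.r_neg)
qed

text \<open>The two-variable form of \<open>quotient_lift_eq\<close>. Representatives are exchanged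
  one at a time, \<open>\<beta> a b = \<beta> u b = \<beta> u v\<close>, each equality coming from
  the vanishing of \<open>\<beta>\<close> on the relations of one factor.\<close>

lemma the_elem_image_coset_pair:
  assumes "module K U" "module K V" "module K W" "submodule M K U" "submodule N K V"
    and \<beta>: "\<beta> \<in> bilinear_maps K U V W"
    and kerM: "\<And>u v. u \<in> M \<Longrightarrow> v \<in> carrier V \<Longrightarrow> \<beta> u v = \<zero>\<^bsub>W\<^esub>"
    and kerN: "\<And>u v. u \<in> carrier U \<Longrightarrow> v \<in> N \<Longrightarrow> \<beta> u v = \<zero>\<^bsub>W\<^esub>"
    and u: "u \<in> carrier U" and v: "v \<in> carrier V"
  shows "the_elem ((\<lambda>(a, b). \<beta> a b) ` ((M +>\<^bsub>U\<^esub> u) \<times> (N +>\<^bsub>V\<^esub> v))) = \<beta> u v"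
proof -
  interpret U: module K U by fact
  interpret V: module K V by fact
  interpret W: module K W by fact
  have eq: "\<beta> a b = \<beta> u v" if a: "a \<in> M +>\<^bsub>U\<^esub> u" and b: "b \<in> N +>\<^bsub>V\<^esub> v" for a b
  proof -
    note a' = coset_closed[OF assms(1,4) u a] and b' = coset_closed[OF assms(2,5) v b]
    have "a \<ominus>\<^bsub>U\<^esub> u \<in> M" "b \<ominus>\<^bsub>V\<^esub> v \<in> N"
      using a'(2) b'(2) coset_eq_iff[OF assms(1,4) a'(1) u] coset_eq_iff[OF assms(2,5) b'(1) v] by auto
    then have "\<beta> (a \<ominus>\<^bsub>U\<^esub> u) b = \<zero>\<^bsub>W\<^esub>" "\<beta> u (b \<ominus>\<^bsub>V\<^esub> v) = \<zero>\<^bsub>W\<^esub>"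
      using kerM kerN b'(1) u by auto
    moreover have "\<beta> (a \<ominus>\<^bsub>U\<^esub> u) b = \<beta> a b \<ominus>\<^bsub>W\<^esub> \<beta> u b"
      by (rule linear_maps_minus[OF assms(1,3) bilinear_maps_left[OF \<beta> b'(1)] a'(1) u])
    moreover have "\<beta> u (b \<ominus>\<^bsub>V\<^esub> v) = \<beta> u b \<ominus>\<^bsub>W\<^esub> \<beta> u v"
      by (rule linear_maps_minus[OF assms(2,3) bilinear_maps_right[OF \<beta> u] b'(1) v])
    ultimately show ?thesis
      using bilinear_maps_closed[OF \<beta>] a'(1) b'(1) u v
      by (simp add: abelian_group_minus_eq_zero_iff[OF W.abelian_group_axioms])
  qed
  have "(\<lambda>(a, b). \<beta> a b) ` ((M +>\<^bsub>U\<^esub> u) \<times> (N +>\<^bsub>V\<^esub> v)) = (\<lambda>_. \<beta> u v) ` ((M +>\<^bsub>U\<^esub> u) \<times> (N +>\<^bsub>V\<^esub> v))"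
    by (rule image_cong[OF refl]) (use eq in force)
  also have "\<dots> = {\<beta> u v}"
    using coset_self[OF assms(1,4) u] coset_self[OF assms(2,5) v] by auto
  finally show ?thesis by simp
qed

locale fock_monoid = fock_species K E
  for K :: "('k, 'm) ring_scheme" and E :: "(nat, 'k, 'v, 'z) bimon_species_scheme" +
  assumes species_monoid: "species_monoid K E"
begin

abbreviation "A \<equiv> fock_algebra K E"

lemma mult_bilinear:
  "finite X \<Longrightarrow> finite Y \<Longrightarrow> X \<inter> Y = {} \<Longrightarrow>
    sp_mult E X Y \<in> bilinear_maps K (sp_obj E X) (sp_obj E Y) (sp_obj E (X \<union> Y))"
  using species_monoid by (simp add: species_monoid_def)

lemma mult_closed:
  "finite X \<Longrightarrow> finite Y \<Longrightarrow> X \<inter> Y = {} \<Longrightarrow> a \<in> carrier (sp_obj E X) \<Longrightarrow> b \<in> carrier (sp_obj E Y) \<Longrightarrow>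
    sp_mult E X Y a b \<in> carrier (sp_obj E (X \<union> Y))"
  by (rule bilinear_maps_closed[OF mult_bilinear])

lemma mult_natural:
  "finite X \<Longrightarrow> finite Y \<Longrightarrow> X \<inter> Y = {} \<Longrightarrow> X' \<inter> Y' = {} \<Longrightarrow> bij_betw \<sigma> X X' \<Longrightarrow> bij_betw \<sigma> Y Y' \<Longrightarrow>
    a \<in> carrier (sp_obj E X') \<Longrightarrow> b \<in> carrier (sp_obj E Y') \<Longrightarrow>
    sp_mult E X Y (sp_map E X X' \<sigma> a) (sp_map E Y Y' \<sigma> b) =
    sp_map E (X \<union> Y) (X' \<union> Y') \<sigma> (sp_mult E X' Y' a b)"
  using species_monoid by (simp add: species_monoid_def)

lemma mult_assoc:
  "finite X \<Longrightarrow> finite Y \<Longrightarrow> finite Z \<Longrightarrow> X \<inter> Y = {} \<Longrightarrow> X \<inter> Z = {} \<Longrightarrow> Y \<inter> Z = {} \<Longrightarrow>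
    a \<in> carrier (sp_obj E X) \<Longrightarrow> b \<in> carrier (sp_obj E Y) \<Longrightarrow> c \<in> carrier (sp_obj E Z) \<Longrightarrow>
    sp_mult E (X \<union> Y) Z (sp_mult E X Y a b) c = sp_mult E X (Y \<union> Z) a (sp_mult E Y Z b c)"
  using species_monoid by (simp add: species_monoid_def)

lemma unit_closed: "sp_unit E \<in> carrier (sp_obj E {})"
  using species_monoid by (simp add: species_monoid_def)

lemma unit_mult:
  "finite X \<Longrightarrow> a \<in> carrier (sp_obj E X) \<Longrightarrow> sp_mult E {} X (sp_unit E) a = a"
  "finite X \<Longrightarrow> a \<in> carrier (sp_obj E X) \<Longrightarrow> sp_mult E X {} a (sp_unit E) = a"
  using species_monoid by (simp_all add: species_monoid_def)

text \<open>The values lie in the single space \<open>F\<close> for all \<open>X\<close> and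
  \<open>Y\<close>, so products formed over different ground sets become comparable.\<close>

definition "class_mult X Y a b = fock_class K E (X \<union> Y) (sp_mult E X Y a b)"

lemma class_mult_bilinear:
  assumes "finite X" "finite Y" "X \<inter> Y = {}"
  shows "class_mult X Y \<in> bilinear_maps K (sp_obj E X) (sp_obj E Y) F"
  unfolding class_mult_def[abs_def] using assms
  by (intro bilinear_maps_comp[OF linear_maps_id linear_maps_id mult_bilinear fock_class_linear]) auto

lemma class_mult_natural:
  assumes "finite X" "finite Y" "X \<inter> Y = {}" "X' \<inter> Y' = {}" "bij_betw \<sigma> X X'" "bij_betw \<rho> Y Y'"
    "a \<in> carrier (sp_obj E X')" "b \<in> carrier (sp_obj E Y')"
  shows "class_mult X Y (sp_map E X X' \<sigma> a) (sp_map E Y Y' \<rho> b) = class_mult X' Y' a b"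
proof -
  \<comment> \<open>Naturality of the product takes one bijection of the union, whereas two
    independent ones are given here. They are glued along the disjoint sets \<open>X\<close> and
    \<open>Y\<close>.\<close>
  define \<tau> where "\<tau> i = (if i \<in> X then \<sigma> i else \<rho> i)" for i
  have \<tau>X: "bij_betw \<tau> X X'"
    using assms(5) by (rule bij_betw_cong[THEN iffD1, rotated]) (simp add: \<tau>_def)
  have \<tau>Y: "bij_betw \<tau> Y Y'"
    using assms(6) by (rule bij_betw_cong[THEN iffD1, rotated]) (use assms(3) in \<open>auto simp: \<tau>_def\<close>)
  have fin: "finite X'" "finite Y'"
    using assms(1,2,5,6) bij_betw_finite by auto
  have "sp_map E X X' \<sigma> a = sp_map E X X' \<tau> a"
    by (rule map_cong[OF assms(1,5) _ assms(7)]) (simp add: \<tau>_def)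
  moreover have "sp_map E Y Y' \<rho> b = sp_map E Y Y' \<tau> b"
    by (rule map_cong[OF assms(2,6) _ assms(8)]) (use assms(3) in \<open>auto simp: \<tau>_def\<close>)
  ultimately have "class_mult X Y (sp_map E X X' \<sigma> a) (sp_map E Y Y' \<rho> b) =
      class_mult X Y (sp_map E X X' \<tau> a) (sp_map E Y Y' \<tau> b)"
    by simp
  also have "\<dots> = fock_class K E (X \<union> Y) (sp_map E (X \<union> Y) (X' \<union> Y') \<tau> (sp_mult E X' Y' a b))"
    unfolding class_mult_def by (simp only: mult_natural[OF assms(1-4) \<tau>X \<tau>Y assms(7,8)])
  also have "\<dots> = class_mult X' Y' a b"
    unfolding class_mult_def
    by (rule fock_class_natural[OF _ bij_betw_combine[OF \<tau>X \<tau>Y assms(4)] mult_closed[OF fin assms(4,7,8)]])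
       (use assms in simp)
  finally show ?thesis .
qed

text \<open>Once \<open>a\<close> and \<open>b\<close> are given over \<open>B\<close> and
  \<open>C\<close>, the class of their product is independent of the disjoint sets to which they are
  moved and of the bijections used for that.\<close>

lemma class_mult_transport:
  assumes "finite X" "finite Y" "X \<inter> Y = {}" "finite X'" "finite Y'" "X' \<inter> Y' = {}"
    "bij_betw \<sigma> X B" "bij_betw \<sigma>' X' B" "bij_betw \<rho> Y C" "bij_betw \<rho>' Y' C"
    "a \<in> carrier (sp_obj E B)" "b \<in> carrier (sp_obj E C)"
  shows "class_mult X Y (sp_map E X B \<sigma> a) (sp_map E Y C \<rho> b) =
    class_mult X' Y' (sp_map E X' B \<sigma>' a) (sp_map E Y' C \<rho>' b)"
proof -
  \<comment> \<open>Transport along \<open>\<sigma>\<close> factors through transport along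
    \<open>\<sigma>'\<close>, by the bijection from \<open>X\<close> to \<open>X'\<close> that is
    \<open>\<sigma>\<close> followed by the inverse of \<open>\<sigma>'\<close>.\<close>
  have factor: "\<exists>\<kappa>. bij_betw \<kappa> X X' \<and> sp_map E X B \<sigma> a = sp_map E X X' \<kappa> (sp_map E X' B \<sigma>' a)"
    if "finite X" "bij_betw \<sigma> X B" "bij_betw \<sigma>' X' B" "a \<in> carrier (sp_obj E B)" for X X' B \<sigma> \<sigma>' a
  proof (intro exI conjI)
    show \<kappa>: "bij_betw (inv_into X' \<sigma>' \<circ> \<sigma>) X X'"
      by (rule bij_betw_trans[OF that(2) bij_betw_inv_into[OF that(3)]])
    have "sp_map E X X' (inv_into X' \<sigma>' \<circ> \<sigma>) (sp_map E X' B \<sigma>' a) =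
        sp_map E X B (\<sigma>' \<circ> (inv_into X' \<sigma>' \<circ> \<sigma>)) a"
      by (rule map_comp[OF that(1) \<kappa> that(3,4)])
    also have "\<dots> = sp_map E X B \<sigma> a"
      using bij_betw_inv_into_right[OF that(3)] bij_betw_apply[OF that(2)]
      by (intro map_cong[OF that(1) bij_betw_trans[OF \<kappa> that(3)] _ that(4)]) auto
    finally show "sp_map E X B \<sigma> a = sp_map E X X' (inv_into X' \<sigma>' \<circ> \<sigma>) (sp_map E X' B \<sigma>' a)" ..
  qed
  obtain \<kappa> where \<kappa>: "bij_betw \<kappa> X X'" "sp_map E X B \<sigma> a = sp_map E X X' \<kappa> (sp_map E X' B \<sigma>' a)"
    using factor[OF assms(1,7,8,11)] by auto
  obtain \<mu> where \<mu>: "bij_betw \<mu> Y Y'" "sp_map E Y C \<rho> b = sp_map E Y Y' \<mu> (sp_map E Y' C \<rho>' b)"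
    using factor[OF assms(2,9,10,12)] by auto
  show ?thesis
    unfolding \<kappa>(2) \<mu>(2)
    by (rule class_mult_natural[OF assms(1-3,6) \<kappa>(1) \<mu>(1) map_closed[OF assms(4,8,11)] map_closed[OF assms(5,10,12)]])
qed

text \<open>The expression on representatives to which \<open>fock_mult\<close> applies
  \<open>the_elem\<close>: shifting \<open>b\<close> past \<open>k\<close> makes the two standard
  sets disjoint.\<close>

definition "shift_mult k l a b =
  class_mult {1..k} {k + 1..k + l} a (sp_map E {k + 1..k + l} {1..l} (\<lambda>i. i - k) b)"

lemma bij_betw_shift: "bij_betw (\<lambda>i. i - k) {k + 1..k + l} {1..l::nat}"
  by (rule bij_betw_byWitness[where f' = "\<lambda>i. i + k"]) auto

lemma shift_mult_eq:
  "shift_mult k l a b = fock_class K E {1..k + l} (sp_mult E {1..k} {k + 1..k + l} a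
     (sp_map E {k + 1..k + l} {1..l} (\<lambda>i. i - k) b))"
proof -
  have "{1..k} \<union> {k + 1..k + l} = {1..k + l}" by auto
  then show ?thesis by (simp add: shift_mult_def class_mult_def)
qed

lemma shift_mult_bilinear: "shift_mult k l \<in> bilinear_maps K (obj k) (obj l) F"
  unfolding shift_mult_def[abs_def]
  by (rule bilinear_maps_comp[OF linear_maps_id map_linear[OF _ bij_betw_shift] class_mult_bilinear linear_maps_id])
     auto

lemma shift_mult_class_mult:
  assumes "finite X" "finite Y" "X \<inter> Y = {}" "bij_betw \<sigma> {1..k} B" "bij_betw \<rho> {1..l} C"
    "bij_betw \<sigma>' X B" "bij_betw \<rho>' Y C" "a \<in> carrier (sp_obj E B)" "b \<in> carrier (sp_obj E C)"
  shows "shift_mult k l (sp_map E {1..k} B \<sigma> a) (sp_map E {1..l} C \<rho> b) =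
    class_mult X Y (sp_map E X B \<sigma>' a) (sp_map E Y C \<rho>' b)"
proof -
  have eq: "sp_map E {k + 1..k + l} {1..l} (\<lambda>i. i - k) (sp_map E {1..l} C \<rho> b) =
      sp_map E {k + 1..k + l} C (\<rho> \<circ> (\<lambda>i. i - k)) b"
    by (rule map_comp[OF _ bij_betw_shift assms(5,9)]) simp
  show ?thesis
    unfolding shift_mult_def eq
    by (rule class_mult_transport[OF _ _ _ assms(1-4,6) bij_betw_trans[OF bij_betw_shift assms(5)] assms(7-9)])
       auto
qed

lemma fock_cone_shift_mult_right:
  assumes "a \<in> carrier (obj k)"
  shows "fock_cone K E F (\<lambda>l. shift_mult k l a)"
proof (rule fock_coneI)
  show "shift_mult k l a \<in> linear_maps K (obj l) F" for l
    by (rule bilinear_maps_right[OF shift_mult_bilinear assms])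
  fix l \<sigma> b assume b: "b \<in> carrier (obj l)" and \<sigma>: "bij_betw \<sigma> {1..l} {1..l}"
  \<comment> \<open>Identity relabellings are inserted so that both sides become instances of
    \<open>shift_mult_class_mult\<close>, with the same product over \<open>{1..k}\<close> and
    \<open>{k + 1..k + l}\<close> as common value.\<close>
  have "shift_mult k l (sp_map E {1..k} {1..k} id a) (sp_map E {1..l} {1..l} \<sigma> b) =
     shift_mult k l (sp_map E {1..k} {1..k} id a) (sp_map E {1..l} {1..l} id b)"
    by (rule trans[OF shift_mult_class_mult[OF _ _ _ bij_betw_id \<sigma> bij_betw_id bij_betw_shift[of k l] assms b]
      shift_mult_class_mult[OF _ _ _ bij_betw_id bij_betw_id bij_betw_id bij_betw_shift[of k l] assms b, symmetric]]) auto
  then show "shift_mult k l a (sp_map E {1..l} {1..l} \<sigma> b) = shift_mult k l a b"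
    by (simp add: map_id assms b)
qed

lemma shift_mult_natural_left:
  assumes "a \<in> carrier (obj k)" "b \<in> carrier (obj l)" "bij_betw \<sigma> {1..k} {1..k}"
  shows "shift_mult k l (sp_map E {1..k} {1..k} \<sigma> a) b = shift_mult k l a b"
proof -
  have "shift_mult k l (sp_map E {1..k} {1..k} \<sigma> a) (sp_map E {1..l} {1..l} id b) =
     shift_mult k l (sp_map E {1..k} {1..k} id a) (sp_map E {1..l} {1..l} id b)"
    by (rule trans[OF shift_mult_class_mult[OF _ _ _ assms(3) bij_betw_id bij_betw_id bij_betw_shift[of k l] assms(1,2)]
      shift_mult_class_mult[OF _ _ _ bij_betw_id bij_betw_id bij_betw_id bij_betw_shift[of k l] assms(1,2), symmetric]]) auto
  then show ?thesis
    by (simp add: map_id assms)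
qed

text \<open>Invariance under permutations of the first factor holds when \<open>g\<close> is a
  class. Both sides are linear in \<open>g\<close>, so it holds for every \<open>g\<close>.\<close>

lemma fock_cone_shift_mult_left:
  assumes g: "g \<in> carrier F"
  shows "fock_cone K E F (\<lambda>k a. fock_lift K E F (\<lambda>l. shift_mult k l a) g)"
proof (rule fock_coneI)
  show "(\<lambda>a. fock_lift K E F (\<lambda>l. shift_mult k l a) g) \<in> linear_maps K (obj k) F" for k
    by (rule fock_lift_linear_param[OF module_n module_fock fock_cone_shift_mult_right
        bilinear_maps_left[OF shift_mult_bilinear] g])
  fix k \<sigma> a assume a: "a \<in> carrier (obj k)" and \<sigma>: "bij_betw \<sigma> {1..k} {1..k}"
  have a': "sp_map E {1..k} {1..k} \<sigma> a \<in> carrier (obj k)"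
    by (rule map_closed[OF _ \<sigma> a]) simp
  note cone = fock_cone_shift_mult_right[OF a] fock_cone_shift_mult_right[OF a']
  show "fock_lift K E F (\<lambda>l. shift_mult k l (sp_map E {1..k} {1..k} \<sigma> a)) g =
      fock_lift K E F (\<lambda>l. shift_mult k l a) g"
    by (rule fock_eqI[OF module_fock fock_lift_linear[OF module_fock cone(2)]
        fock_lift_linear[OF module_fock cone(1)] _ g])
       (simp add: fock_lift_class[OF module_fock cone(1)] fock_lift_class[OF module_fock cone(2)]
        shift_mult_natural_left[OF a _ \<sigma>])
qed

lemma fock_component:
  assumes "f \<in> carrier F"
  obtains x where "x \<in> carrier (obj n)" "f n = coset n x"
proof -
  have "f n \<in> carrier (coinvariants K E n)"
    using assms unfolding fock_def by (rule direct_sum_component) simp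
  with that show thesis
    by (auto simp: coinvariants_def quotient_module_carrier)
qed

text \<open>The product evaluates \<open>the_elem\<close> on a pair of cosets at once, the nested
  lift on one coset after the other. Both yield the value at arbitrary representatives, because
  \<open>shift_mult\<close> vanishes as soon as one argument is a coinvariance relation.\<close>

lemma fock_mult_eq_lift:
  assumes f: "f \<in> carrier F" and g: "g \<in> carrier F"
  shows "fock_mult K E f g = fock_lift K E F (\<lambda>k a. fock_lift K E F (\<lambda>l. shift_mult k l a) g) f"
proof -
  interpret F: module K F by (rule module_fock)
  note cone = fock_cone_shift_mult_left[OF g]
  have ker_right: "shift_mult k l a b = \<zero>\<^bsub>F\<^esub>" if "a \<in> carrier (obj k)" "b \<in> coinv_rel K E l" for k l a b
    using fock_cone_ker[OF module_fock fock_cone_shift_mult_right[OF that(1)] that(2)] .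
  have ker_left: "shift_mult k l a b = \<zero>\<^bsub>F\<^esub>" if "a \<in> coinv_rel K E k" "b \<in> carrier (obj l)" for k l a b
  proof -
    have "shift_mult k l a b \<in> {\<zero>\<^bsub>F\<^esub>}"
    proof (rule linear_maps_span[OF module_n module_fock bilinear_maps_left[OF shift_mult_bilinear that(2)]
          submodule_zero[OF module_fock] coinv_gens_closed])
      show "a \<in> lin_span K (obj k) (coinv_gens k)"
        using that(1) by (simp add: coinv_rel_eq)
      fix s assume "s \<in> coinv_gens k"
      then obtain v \<sigma> where s: "s = v \<ominus>\<^bsub>obj k\<^esub> sp_map E {1..k} {1..k} \<sigma> v"
        and v: "v \<in> carrier (obj k)" and \<sigma>: "bij_betw \<sigma> {1..k} {1..k}"
        by (auto simp: coinv_gens_def)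
      have "shift_mult k l s b = shift_mult k l v b \<ominus>\<^bsub>F\<^esub> shift_mult k l (sp_map E {1..k} {1..k} \<sigma> v) b"
        unfolding s
        by (rule linear_maps_minus[OF module_n module_fock bilinear_maps_left[OF shift_mult_bilinear that(2)]
              v map_closed[OF _ \<sigma> v]]) simp
      also have "\<dots> = \<zero>\<^bsub>F\<^esub>"
        using bilinear_maps_closed[OF shift_mult_bilinear v that(2)]
        by (simp add: shift_mult_natural_left[OF v that(2) \<sigma>] a_minus_def F.r_neg)
      finally show "shift_mult k l s b \<in> {\<zero>\<^bsub>F\<^esub>}" by simp
    qed
    then show ?thesis by simp
  qed
  \<comment> \<open>For a fixed representative \<open>a\<close> of the component of
    \<open>f\<close>, evaluating on the pair of cosets amounts to evaluating on the second coset
    only. Closedness is recorded because congruence for \<open>finsum\<close> asks for it.\<close>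
  have inner: "the_elem ((\<lambda>(a, b). shift_mult k l a b) ` (f k \<times> g l)) = the_elem (shift_mult k l a ` g l)"
    and closed: "the_elem (shift_mult k l a ` g l) \<in> carrier F"
    if a: "a \<in> carrier (obj k)" "f k = coset k a" for k l a
  proof -
    obtain b where b: "b \<in> carrier (obj l)" "g l = coset l b"
      by (rule fock_component[OF g])
    have "the_elem ((\<lambda>(a, b). shift_mult k l a b) ` (f k \<times> g l)) = shift_mult k l a b"
      unfolding a(2) b(2)
      by (rule the_elem_image_coset_pair[OF module_n module_n module_fock submodule_coinv_rel
          submodule_coinv_rel shift_mult_bilinear ker_left ker_right a(1) b(1)])
    moreover have "the_elem (shift_mult k l a ` g l) = shift_mult k l a b"
      unfolding b(2)
      by (rule quotient_lift_eq[OF module_n module_fock submodule_coinv_rel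
          bilinear_maps_right[OF shift_mult_bilinear a(1)] ker_right[OF a(1)] b(1)])
    ultimately show "the_elem ((\<lambda>(a, b). shift_mult k l a b) ` (f k \<times> g l)) = the_elem (shift_mult k l a ` g l)"
      "the_elem (shift_mult k l a ` g l) \<in> carrier F"
      using bilinear_maps_closed[OF shift_mult_bilinear a(1) b(1)] by auto
  qed
  have step: "the_elem ((\<lambda>a. fock_lift K E F (\<lambda>l. shift_mult k l a) g) ` f k) =
      (\<Oplus>\<^bsub>F\<^esub>l\<in>{l. g l \<noteq> \<zero>\<^bsub>coinvariants K E l\<^esub>}. the_elem ((\<lambda>(a, b). shift_mult k l a b) ` (f k \<times> g l)))"
    for k
  proof -
    obtain a where a: "a \<in> carrier (obj k)" "f k = coset k a"
      by (rule fock_component[OF f])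
    have "the_elem ((\<lambda>a. fock_lift K E F (\<lambda>l. shift_mult k l a) g) ` f k) =
        fock_lift K E F (\<lambda>l. shift_mult k l a) g"
      unfolding a(2)
      by (rule quotient_lift_eq[OF module_n module_fock submodule_coinv_rel fock_cone_linear[OF cone]
          fock_cone_ker[OF module_fock cone] a(1)])
    also have "\<dots> = (\<Oplus>\<^bsub>F\<^esub>l\<in>{l. g l \<noteq> \<zero>\<^bsub>coinvariants K E l\<^esub>}.
        the_elem ((\<lambda>(a, b). shift_mult k l a b) ` (f k \<times> g l)))"
      unfolding fock_lift_def using closed[OF a]
      by (intro F.finsum_cong') (auto simp: inner[OF a])
    finally show ?thesis .
  qed
  have "fock_mult K E f g = (\<Oplus>\<^bsub>F\<^esub>k\<in>{k. f k \<noteq> \<zero>\<^bsub>coinvariants K E k\<^esub>}.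
      \<Oplus>\<^bsub>F\<^esub>l\<in>{l. g l \<noteq> \<zero>\<^bsub>coinvariants K E l\<^esub>}. the_elem ((\<lambda>(a, b). shift_mult k l a b) ` (f k \<times> g l)))"
    unfolding fock_mult_def shift_mult_eq[abs_def] ..
  also have "\<dots> = fock_lift K E F (\<lambda>k a. fock_lift K E F (\<lambda>l. shift_mult k l a) g) f"
    unfolding fock_lift_def[of K E F _ f] step[symmetric] ..
  finally show ?thesis .
qed

lemma fock_mult_bilinear: "fock_mult K E \<in> bilinear_maps K F F F"
proof (rule bilinear_mapsI_linear)
  fix f assume f: "f \<in> carrier F"
  have "(\<lambda>g. fock_lift K E F (\<lambda>k a. fock_lift K E F (\<lambda>l. shift_mult k l a) g) f) \<in> linear_maps K F F"
    by (rule fock_lift_linear_param[OF module_fock module_fock fock_cone_shift_mult_left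
        fock_lift_linear[OF module_fock fock_cone_shift_mult_right] f])
  then show "fock_mult K E f \<in> linear_maps K F F"
    by (rule linear_maps_cong[OF module_fock]) (rule fock_mult_eq_lift[OF f])
next
  fix g assume g: "g \<in> carrier F"
  show "(\<lambda>f. fock_mult K E f g) \<in> linear_maps K F F"
    by (rule linear_maps_cong[OF module_fock fock_lift_linear[OF module_fock fock_cone_shift_mult_left[OF g]]])
       (rule fock_mult_eq_lift[OF _ g])
qed

text \<open>The class of the product does not depend on the ground sets, so the factors need not be
  moved to initial intervals. Through this formula the laws of the species become laws of the Fock
  algebra.\<close>

lemma fock_mult_class:
  assumes "finite X" "finite Y" "X \<inter> Y = {}" "a \<in> carrier (sp_obj E X)" "b \<in> carrier (sp_obj E Y)"
  shows "fock_mult K E (fock_class K E X a) (fock_class K E Y b) = fock_class K E (X \<union> Y) (sp_mult E X Y a b)"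
proof -
  let ?k = "card X" and ?l = "card Y"
  note eX = bij_betw_sorted_list_nth[OF assms(1)] and eY = bij_betw_sorted_list_nth[OF assms(2)]
  obtain a' where a': "a' \<in> carrier (obj ?k)" "fock_class K E X a = fock_class K E {1..?k} a'"
    "a' = sp_map E {1..?k} X (\<lambda>i. sorted_list_of_set X ! (i - 1)) a"
    by (rule fock_class_to_n[OF assms(1,4)])
  obtain b' where b': "b' \<in> carrier (obj ?l)" "fock_class K E Y b = fock_class K E {1..?l} b'"
    "b' = sp_map E {1..?l} Y (\<lambda>i. sorted_list_of_set Y ! (i - 1)) b"
    by (rule fock_class_to_n[OF assms(2,5)])
  have closed: "fock_class K E {1..?k} a' \<in> carrier F" "fock_class K E {1..?l} b' \<in> carrier F"
    using a'(1) b'(1) by (auto intro: fock_class_closed)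
  have "fock_mult K E (fock_class K E X a) (fock_class K E Y b) = shift_mult ?k ?l a' b'"
    unfolding a'(2) b'(2) fock_mult_eq_lift[OF closed]
    by (simp add: fock_lift_class[OF module_fock fock_cone_shift_mult_left[OF closed(2)] a'(1)]
        fock_lift_class[OF module_fock fock_cone_shift_mult_right[OF a'(1)] b'(1)])
  also have "\<dots> = class_mult X Y (sp_map E X X id a) (sp_map E Y Y id b)"
    unfolding a'(3) b'(3)
    by (rule shift_mult_class_mult[OF assms(1-3) eX eY bij_betw_id bij_betw_id assms(4,5)])
  finally show ?thesis
    using assms by (simp add: map_id class_mult_def)
qed

text \<open>Frees a class from its standard set, so that several classes can be represented over
  pairwise disjoint sets before they are multiplied.\<close>

lemma fock_class_shift:
  assumes "x \<in> carrier (obj n)"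
  obtains y where "y \<in> carrier (sp_obj E {k + 1..k + n})"
    "fock_class K E {1..n} x = fock_class K E {k + 1..k + n} y"
  using map_closed[OF _ bij_betw_shift assms, of k] fock_class_natural[OF _ bij_betw_shift assms, of k] that
  by simp

lemma fock_algebra_simps [simp]:
  "carrier A = carrier F" "\<zero>\<^bsub>A\<^esub> = \<zero>\<^bsub>F\<^esub>" "(\<oplus>\<^bsub>A\<^esub>) = (\<oplus>\<^bsub>F\<^esub>)" "(\<odot>\<^bsub>A\<^esub>) = (\<odot>\<^bsub>F\<^esub>)"
  "mult A = fock_mult K E" "\<one>\<^bsub>A\<^esub> = fock_class K E {} (sp_unit E)"
  by (simp_all add: fock_algebra_def)

lemma module_fock_algebra: "module K A"
  unfolding fock_algebra_def by (rule module_update_mult_one[OF module_fock])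

lemma one_closed: "fock_class K E {} (sp_unit E) \<in> carrier F"
  by (rule fock_class_closed[OF _ unit_closed]) simp

lemma fock_mult_closed: "f \<in> carrier F \<Longrightarrow> g \<in> carrier F \<Longrightarrow> fock_mult K E f g \<in> carrier F"
  by (rule bilinear_maps_closed[OF fock_mult_bilinear])

lemma fock_mult_one:
  assumes "f \<in> carrier F"
  shows "fock_mult K E (fock_class K E {} (sp_unit E)) f = f"
    and "fock_mult K E f (fock_class K E {} (sp_unit E)) = f"
proof -
  show "fock_mult K E (fock_class K E {} (sp_unit E)) f = f"
    by (rule fock_eqI[OF module_fock bilinear_maps_right[OF fock_mult_bilinear one_closed] linear_maps_id _ assms])
       (simp add: fock_mult_class unit_closed unit_mult)
  show "fock_mult K E f (fock_class K E {} (sp_unit E)) = f"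
    by (rule fock_eqI[OF module_fock bilinear_maps_left[OF fock_mult_bilinear one_closed] linear_maps_id _ assms])
       (simp add: fock_mult_class unit_closed unit_mult)
qed

lemma fock_mult_assoc:
  assumes f: "f \<in> carrier F" and g: "g \<in> carrier F" and h: "h \<in> carrier F"
  shows "fock_mult K E (fock_mult K E f g) h = fock_mult K E f (fock_mult K E g h)"
proof -
  note bil = fock_mult_bilinear
  note R = bilinear_maps_right[OF bil] and L = bilinear_maps_left[OF bil]
  have "fock_mult K E (fock_mult K E (fock_class K E {1..k} a) (fock_class K E {1..l} b)) (fock_class K E {1..m} c) =
      fock_mult K E (fock_class K E {1..k} a) (fock_mult K E (fock_class K E {1..l} b) (fock_class K E {1..m} c))"
    if a: "a \<in> carrier (obj k)" and b: "b \<in> carrier (obj l)" and c: "c \<in> carrier (obj m)" for k l m a b c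
  proof -
    \<comment> \<open>The three factors are placed on consecutive intervals, whence every product
      that occurs is one over disjoint sets.\<close>
    obtain b' where b': "b' \<in> carrier (sp_obj E {k + 1..k + l})"
      "fock_class K E {1..l} b = fock_class K E {k + 1..k + l} b'"
      by (rule fock_class_shift[OF b])
    obtain c' where c': "c' \<in> carrier (sp_obj E {(k + l) + 1..(k + l) + m})"
      "fock_class K E {1..m} c = fock_class K E {(k + l) + 1..(k + l) + m} c'"
      by (rule fock_class_shift[OF c])
    have disj: "{1..k} \<inter> {k + 1..k + l} = {}" "{1..k} \<inter> {(k + l) + 1..(k + l) + m} = {}"
      "{k + 1..k + l} \<inter> {(k + l) + 1..(k + l) + m} = {}"
      by auto
    show ?thesis
      unfolding b'(2) c'(2) using a b'(1) c'(1) disj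
      by (simp add: fock_mult_class mult_closed mult_assoc Int_Un_distrib Int_Un_distrib2 Un_assoc)
  qed
  \<comment> \<open>Linearity now frees the arguments one after the other: \<open>f\<close> first,
    then \<open>g\<close>, and \<open>h\<close> at the end.\<close>
  note base = this
  have "fock_mult K E (fock_mult K E f (fock_class K E {1..l} b)) (fock_class K E {1..m} c) =
      fock_mult K E f (fock_mult K E (fock_class K E {1..l} b) (fock_class K E {1..m} c))"
    if b: "b \<in> carrier (obj l)" and c: "c \<in> carrier (obj m)" for l m b c
  proof -
    have cl: "fock_class K E {1..l} b \<in> carrier F" "fock_class K E {1..m} c \<in> carrier F"
      using b c by (auto intro: fock_class_closed)
    show ?thesis
      by (rule fock_eqI[OF module_fock linear_maps_comp[OF L[OF cl(1)] L[OF cl(2)]] L[OF fock_mult_closed[OF cl]] base[OF _ b c] f])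
  qed
  note base = this
  have "fock_mult K E (fock_mult K E f g) (fock_class K E {1..m} c) =
      fock_mult K E f (fock_mult K E g (fock_class K E {1..m} c))"
    if c: "c \<in> carrier (obj m)" for m c
  proof -
    have cl: "fock_class K E {1..m} c \<in> carrier F"
      using c by (auto intro: fock_class_closed)
    show ?thesis
      by (rule fock_eqI[OF module_fock linear_maps_comp[OF R[OF f] L[OF cl]] linear_maps_comp[OF L[OF cl] R[OF f]] base[OF _ c] g])
  qed
  from fock_eqI[OF module_fock R[OF fock_mult_closed[OF f g]] linear_maps_comp[OF R[OF g] R[OF f]] this h]
  show ?thesis .
qed

lemma ring_fock_algebra: "ring A"
proof (rule ringI)
  show "abelian_group A"
    by (rule module_abelian_group[OF module_fock_algebra])
  show "Group.monoid A"
    by (rule monoidI) (simp_all add: fock_mult_closed one_closed fock_mult_assoc fock_mult_one)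
qed (simp_all add: linear_maps_add[OF bilinear_maps_left[OF fock_mult_bilinear]]
      linear_maps_add[OF bilinear_maps_right[OF fock_mult_bilinear]])

text \<open>When the second class has been moved off the first standard set, commutativity of the
  species compares two elements over the same union, so their classes agree.\<close>

lemma cring_fock_algebra:
  assumes "species_commutative E"
  shows "cring A"
proof (rule cring.intro[OF ring_fock_algebra])
  have swap: "fock_mult K E f g = fock_mult K E g f" if f: "f \<in> carrier F" and g: "g \<in> carrier F" for f g
  proof (rule bilinear_maps_eqI[OF module_fock module_fock module_fock fock_mult_bilinear
        bilinear_maps_swap[OF fock_mult_bilinear] spans_fock spans_fock _ f g])
    fix s t assume "s \<in> (\<Union>n. fock_class K E {1..n} ` carrier (obj n))"
      and "t \<in> (\<Union>n. fock_class K E {1..n} ` carrier (obj n))"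
    then obtain k a l b where a: "a \<in> carrier (obj k)" and s: "s = fock_class K E {1..k} a"
      and b: "b \<in> carrier (obj l)" and t: "t = fock_class K E {1..l} b"
      by auto
    obtain b' where b': "b' \<in> carrier (sp_obj E {k + 1..k + l})"
      "fock_class K E {1..l} b = fock_class K E {k + 1..k + l} b'"
      by (rule fock_class_shift[OF b])
    have disj: "{1..k} \<inter> {k + 1..k + l} = {}" "{k + 1..k + l} \<inter> {1..k} = {}"
      by auto
    have "sp_mult E {1..k} {k + 1..k + l} a b' = sp_mult E {k + 1..k + l} {1..k} b' a"
      using assms a b'(1) disj(1) by (simp add: species_commutative_def)
    then show "fock_mult K E s t = fock_mult K E t s"
      unfolding s t b'(2) by (simp add: fock_mult_class a b'(1) disj Un_commute)
  qed
  show "comm_monoid A"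
    using ring.is_monoid[OF ring_fock_algebra] by (rule monoid.monoid_comm_monoidI) (simp add: swap)
qed

end

section \<open>The coalgebra structure of the Fock space\<close>

lemma finsum_reindex_bij_betw:
  assumes "abelian_group W" "bij_betw h A B" "\<And>b. b \<in> B \<Longrightarrow> f b \<in> carrier W"
  shows "(\<Oplus>\<^bsub>W\<^esub>b\<in>B. f b) = (\<Oplus>\<^bsub>W\<^esub>a\<in>A. f (h a))"
proof -
  interpret W: abelian_group W by fact
  have B: "B = h ` A" and inj: "inj_on h A"
    using assms(2) by (auto simp: bij_betw_def)
  show ?thesis
    using assms(3) unfolding B by (intro W.finsum_reindex inj) auto
qed

text \<open>Iterated coproducts give sums over a subset and then over a subset of it or of its
  complement. Flattening them to one sum over pairs makes a change of indices possible.\<close>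

lemma finsum_Sigma:
  assumes "abelian_group W" "finite I" "\<And>i. i \<in> I \<Longrightarrow> finite (J i)"
    "\<And>i j. i \<in> I \<Longrightarrow> j \<in> J i \<Longrightarrow> h i j \<in> carrier W"
  shows "(\<Oplus>\<^bsub>W\<^esub>i\<in>I. \<Oplus>\<^bsub>W\<^esub>j\<in>J i. h i j) = (\<Oplus>\<^bsub>W\<^esub>p\<in>Sigma I J. case p of (i, j) \<Rightarrow> h i j)"
proof -
  interpret W: abelian_group W by fact
  show ?thesis
    using assms(2-4)
  proof (induction I rule: finite_induct)
    case (insert i I)
    have eq: "Sigma (insert i I) J = Pair i ` J i \<union> Sigma I J" by auto
    have fin: "finite (Sigma I J)"
      using insert by (intro finite_SigmaI) auto
    have "(\<Oplus>\<^bsub>W\<^esub>p\<in>Sigma (insert i I) J. case p of (i, j) \<Rightarrow> h i j) =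
        (\<Oplus>\<^bsub>W\<^esub>p\<in>Pair i ` J i. case p of (i, j) \<Rightarrow> h i j) \<oplus>\<^bsub>W\<^esub> (\<Oplus>\<^bsub>W\<^esub>p\<in>Sigma I J. case p of (i, j) \<Rightarrow> h i j)"
      unfolding eq using insert fin by (intro W.finsum_Un_disjoint) auto
    also have "(\<Oplus>\<^bsub>W\<^esub>p\<in>Pair i ` J i. case p of (i, j) \<Rightarrow> h i j) = (\<Oplus>\<^bsub>W\<^esub>j\<in>J i. h i j)"
      using insert.prems by (subst W.finsum_reindex) (auto simp: inj_on_def)
    also have "(\<Oplus>\<^bsub>W\<^esub>p\<in>Sigma I J. case p of (i, j) \<Rightarrow> h i j) = (\<Oplus>\<^bsub>W\<^esub>i\<in>I. \<Oplus>\<^bsub>W\<^esub>j\<in>J i. h i j)"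
      using insert by simp
    also have "(\<Oplus>\<^bsub>W\<^esub>j\<in>J i. h i j) \<oplus>\<^bsub>W\<^esub> (\<Oplus>\<^bsub>W\<^esub>i\<in>I. \<Oplus>\<^bsub>W\<^esub>j\<in>J i. h i j) =
        (\<Oplus>\<^bsub>W\<^esub>i\<in>insert i I. \<Oplus>\<^bsub>W\<^esub>j\<in>J i. h i j)"
      using insert by (intro W.finsum_insert[symmetric] Pi_I W.finsum_closed) auto
    finally show ?case ..
  qed simp
qed

text \<open>Both composites send \<open>u\<close>, \<open>v\<close>, \<open>w\<close> to the tensor
  of \<open>f u\<close>, \<open>g v\<close> and \<open>h w\<close> bracketed to the right. It allows
  the class maps to be pulled out of the associator.\<close>

lemma tensor_assoc_natural:
  assumes U: "module K U0" "module K U" and V: "module K V0" "module K V" and W: "module K W0" "module K W"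
    and f: "f \<in> linear_maps K U0 U" and g: "g \<in> linear_maps K V0 V" and h: "h \<in> linear_maps K W0 W"
    and t: "t \<in> carrier (tensor K (tensor K U0 V0) W0)"
  shows "tensor_assoc K U V W (tensor_map K (tensor K U V) W (tensor_map K U V f g) h t) =
    tensor_map K U (tensor K V W) f (tensor_map K V W g h) (tensor_assoc K U0 V0 W0 t)"
proof -
  note m = module_tensor
  note fg = tensor_map_linear[OF U(1) V(1) U(2) V(2) f g] and gh = tensor_map_linear[OF V(1) W(1) V(2) W(2) g h]
  note fgh = tensor_map_linear[OF m[OF U(1) V(1)] W(1) m[OF U(2) V(2)] W(2) fg h]
    and fgh' = tensor_map_linear[OF U(1) m[OF V(1) W(1)] U(2) m[OF V(2) W(2)] f gh]
  note fc = linear_maps_closed[OF f] and gc = linear_maps_closed[OF g] and hc = linear_maps_closed[OF h]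
  show ?thesis
  proof (rule tensor_eqI[OF m[OF U(1) V(1)] W(1) m[OF U(2) m[OF V(2) W(2)]]
        linear_maps_comp[OF fgh tensor_assoc_linear[OF U(2) V(2) W(2)]]
        linear_maps_comp[OF tensor_assoc_linear[OF U(1) V(1) W(1)] fgh']
        spans_tensor[OF U(1) V(1) spans_carrier spans_carrier] spans_carrier _ t])
    fix s w assume "s \<in> (\<lambda>(u, v). pure_tensor K U0 V0 u v) ` (carrier U0 \<times> carrier V0)" and w: "w \<in> carrier W0"
    then obtain u v where s: "s = pure_tensor K U0 V0 u v" and u: "u \<in> carrier U0" and v: "v \<in> carrier V0"
      by auto
    show "tensor_assoc K U V W (tensor_map K (tensor K U V) W (tensor_map K U V f g) h (pure_tensor K (tensor K U0 V0) W0 s w)) =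
        tensor_map K U (tensor K V W) f (tensor_map K V W g h) (tensor_assoc K U0 V0 W0 (pure_tensor K (tensor K U0 V0) W0 s w))"
      unfolding s tensor_map_pure[OF m[OF U(1) V(1)] W(1) m[OF U(2) V(2)] W(2) fg h pure_tensor_closed[OF U(1) V(1) u v] w]
        tensor_map_pure[OF U(1) V(1) U(2) V(2) f g u v] tensor_assoc_pure[OF U(2) V(2) W(2) fc[OF u] gc[OF v] hc[OF w]]
        tensor_assoc_pure[OF U(1) V(1) W(1) u v w]
        tensor_map_pure[OF U(1) m[OF V(1) W(1)] U(2) m[OF V(2) W(2)] f gh u pure_tensor_closed[OF V(1) W(1) v w]]
        tensor_map_pure[OF V(1) W(1) V(2) W(2) g h v w] ..
  qed
qed

locale fock_comonoid = fock_species K E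
  for K :: "('k, 'm) ring_scheme" and E :: "(nat, 'k, 'v, 'z) bimon_species_scheme" +
  assumes species_comonoid: "species_comonoid_no_counit K E"
begin

abbreviation "obj2 \<equiv> \<lambda>X Y. tensor K (sp_obj E X) (sp_obj E Y)"
abbreviation "FF \<equiv> tensor K F F"
abbreviation "class2 \<equiv> \<lambda>X Y. tensor_map K F F (fock_class K E X) (fock_class K E Y)"

lemma module_FF: "module K FF"
  by (rule module_tensor[OF module_fock module_fock])

lemma module_obj2: "finite X \<Longrightarrow> finite Y \<Longrightarrow> module K (obj2 X Y)"
  by (intro module_tensor module_obj)

lemma comult_linear:
  assumes "finite X" "Z \<subseteq> X"
  shows "(\<lambda>x. sp_comult E X x Z) \<in> linear_maps K (sp_obj E X) (obj2 Z (X - Z))"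
proof -
  have "sp_comult E X \<in> linear_maps K (sp_obj E X) (direct_sum (Pow X) (\<lambda>Z. obj2 Z (X - Z)))"
    using species_comonoid assms(1) by (simp add: species_comonoid_no_counit_def species_tensor_def)
  then show ?thesis
    by (rule linear_maps_comp[OF _ direct_sum_component_linear]) (use assms(2) in simp)
qed

lemma comult_closed:
  "finite X \<Longrightarrow> Z \<subseteq> X \<Longrightarrow> x \<in> carrier (sp_obj E X) \<Longrightarrow> sp_comult E X x Z \<in> carrier (obj2 Z (X - Z))"
  by (rule linear_maps_closed[OF comult_linear])

lemma comult_natural:
  assumes "finite X" "bij_betw \<sigma> X X'" "x \<in> carrier (sp_obj E X')" "Z \<subseteq> X"
  shows "sp_comult E X (sp_map E X X' \<sigma> x) Z =
    tensor_map K (sp_obj E Z) (sp_obj E (X - Z)) (sp_map E Z (\<sigma> ` Z) \<sigma>)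
      (sp_map E (X - Z) (X' - \<sigma> ` Z) \<sigma>) (sp_comult E X' x (\<sigma> ` Z))"
proof -
  have "sp_comult E X (sp_map E X X' \<sigma> x) = sp_map (species_tensor K E E) X X' \<sigma> (sp_comult E X' x)"
    using species_comonoid assms(1-3) by (simp add: species_comonoid_no_counit_def)
  then show ?thesis
    using assms(4) by (simp add: species_tensor_def)
qed

lemma comult_assoc:
  assumes "finite X" "finite Y" "finite Z" "X \<inter> Y = {}" "X \<inter> Z = {}" "Y \<inter> Z = {}"
    "x \<in> carrier (sp_obj E (X \<union> Y \<union> Z))"
  shows "tensor_assoc K (sp_obj E X) (sp_obj E Y) (sp_obj E Z)
      (tensor_map K (obj2 X Y) (sp_obj E Z) (\<lambda>y. sp_comult E (X \<union> Y) y X) id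
        (sp_comult E (X \<union> Y \<union> Z) x (X \<union> Y))) =
    tensor_map K (sp_obj E X) (obj2 Y Z) id (\<lambda>y. sp_comult E (Y \<union> Z) y Y)
      (sp_comult E (X \<union> Y \<union> Z) x X)"
  by (rule species_comonoid[unfolded species_comonoid_no_counit_def, THEN conjunct2, THEN conjunct2,
        THEN conjunct2, rule_format, OF _ assms(7)])
     (simp add: assms)

lemma class2_linear: "finite X \<Longrightarrow> finite Y \<Longrightarrow> class2 X Y \<in> linear_maps K (obj2 X Y) FF"
  by (intro tensor_map_linear module_obj module_fock fock_class_linear)

lemma class2_pure:
  "finite X \<Longrightarrow> finite Y \<Longrightarrow> x \<in> carrier (sp_obj E X) \<Longrightarrow> y \<in> carrier (sp_obj E Y) \<Longrightarrow>
    class2 X Y (pure_tensor K (sp_obj E X) (sp_obj E Y) x y) =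
    pure_tensor K F F (fock_class K E X x) (fock_class K E Y y)"
  by (intro tensor_map_pure module_obj module_fock fock_class_linear)

text \<open>The coproduct of the Fock space before passing to coinvariants, and over an arbitrary
  finite set: the direct sum over subsets collapses to a sum in the single space
  \<open>FF\<close>.\<close>

definition "class_comult X x = (\<Oplus>\<^bsub>FF\<^esub>Z\<in>Pow X. class2 Z (X - Z) (sp_comult E X x Z))"

lemma class_comult_summand_linear:
  assumes "finite X" "Z \<subseteq> X"
  shows "(\<lambda>x. class2 Z (X - Z) (sp_comult E X x Z)) \<in> linear_maps K (sp_obj E X) FF"
  by (rule linear_maps_comp[OF comult_linear[OF assms] class2_linear])
     (use assms finite_subset in auto)

lemma class_comult_linear:
  "finite X \<Longrightarrow> class_comult X \<in> linear_maps K (sp_obj E X) FF"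
  unfolding class_comult_def[abs_def]
  by (rule linear_maps_finsum_fun[OF module_FF class_comult_summand_linear]) auto

text \<open>A bijection of the ground sets permutes the summands, sending the one at
  \<open>Z\<close> to the one at its image. Naturality of the species coproduct together with
  naturality of the classes identifies corresponding summands.\<close>

lemma class_comult_natural:
  assumes "finite X" "bij_betw \<sigma> X X'" "x \<in> carrier (sp_obj E X')"
  shows "class_comult X (sp_map E X X' \<sigma> x) = class_comult X' x"
proof -
  interpret FF: module K FF by (rule module_FF)
  have fin: "finite X'"
    using assms(1,2) bij_betw_finite by blast
  have summand: "class2 Z (X' - Z) (sp_comult E X' x Z) \<in> carrier FF" if "Z \<subseteq> X'" for Z
    by (rule linear_maps_closed[OF class_comult_summand_linear[OF fin that] assms(3)])
  have "class2 Z (X - Z) (sp_comult E X (sp_map E X X' \<sigma> x) Z) =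
      class2 (\<sigma> ` Z) (X' - \<sigma> ` Z) (sp_comult E X' x (\<sigma> ` Z))" if Z: "Z \<subseteq> X" for Z
  proof -
    have finZ: "finite Z" "finite (X - Z)" "finite (\<sigma> ` Z)" "finite (X' - \<sigma> ` Z)"
      using Z assms(1) fin finite_subset by auto
    have \<sigma>: "bij_betw \<sigma> Z (\<sigma> ` Z)" "bij_betw \<sigma> (X - Z) (X' - \<sigma> ` Z)"
      using bij_betw_subset[OF assms(2) Z] bij_betw_DiffI[OF assms(2) bij_betw_subset[OF assms(2) Z]]
        Z bij_betw_imp_surj_on[OF assms(2)] by auto
    have Z': "\<sigma> ` Z \<subseteq> X'"
      using Z bij_betw_imp_surj_on[OF assms(2)] by auto
    note M = module_obj[OF finZ(1)] module_obj[OF finZ(2)] module_obj[OF finZ(3)] module_obj[OF finZ(4)]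
    show ?thesis
      unfolding comult_natural[OF assms Z]
      by (rule tensor_map_comp[OF M(3,4,1,2) module_fock module_fock map_linear[OF finZ(1) \<sigma>(1)]
          map_linear[OF finZ(2) \<sigma>(2)] fock_class_linear[OF finZ(1)] fock_class_linear[OF finZ(2)]
          fock_class_linear[OF finZ(3)] fock_class_linear[OF finZ(4)]
          fock_class_natural[OF finZ(1) \<sigma>(1)] fock_class_natural[OF finZ(2) \<sigma>(2)] comult_closed[OF fin Z' assms(3)]])
  qed
  moreover have "class2 (\<sigma> ` Z) (X' - \<sigma> ` Z) (sp_comult E X' x (\<sigma> ` Z)) \<in> carrier FF" if "Z \<subseteq> X" for Z
    using that bij_betw_imp_surj_on[OF assms(2)] by (intro summand) auto
  ultimately have "class_comult X (sp_map E X X' \<sigma> x) =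
      (\<Oplus>\<^bsub>FF\<^esub>Z\<in>Pow X. class2 (\<sigma> ` Z) (X' - \<sigma> ` Z) (sp_comult E X' x (\<sigma> ` Z)))"
    unfolding class_comult_def by (intro FF.finsum_cong') auto
  also have "\<dots> = class_comult X' x"
    unfolding class_comult_def
    by (rule finsum_reindex_bij_betw[OF FF.abelian_group_axioms bij_betw_Pow[OF assms(2)], symmetric])
       (simp add: summand)
  finally show ?thesis .
qed

lemma fock_comult_eq: "fock_comult K E = fock_lift K E FF (\<lambda>n. class_comult {1..n})"
  by (simp add: fock_comult_def fock_lift_def class_comult_def[abs_def] fun_eq_iff)

lemma fock_comult_linear: "fock_comult K E \<in> linear_maps K F FF"
  unfolding fock_comult_eq
  by (rule fock_lift_linear[OF module_FF
      fock_lift_natural(1)[where \<phi>=class_comult, OF module_FF class_comult_linear class_comult_natural]])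

lemma fock_comult_class:
  "finite X \<Longrightarrow> x \<in> carrier (sp_obj E X) \<Longrightarrow> fock_comult K E (fock_class K E X x) = class_comult X x"
  unfolding fock_comult_eq
  by (rule fock_lift_natural(2)[where \<phi>=class_comult, OF module_FF class_comult_linear class_comult_natural])

abbreviation "class3 \<equiv> \<lambda>X Y Z. tensor_map K F FF (fock_class K E X) (class2 Y Z)"

lemma class3_linear:
  "finite X \<Longrightarrow> finite Y \<Longrightarrow> finite Z \<Longrightarrow>
    class3 X Y Z \<in> linear_maps K (tensor K (sp_obj E X) (obj2 Y Z)) (tensor K F FF)"
  by (intro tensor_map_linear module_obj module_obj2 module_fock module_FF fock_class_linear class2_linear)

text \<open>Moves the class maps to the outside. What remains inside \<open>class3\<close> is one
  side of coassociativity in the species, with first two blocks \<open>W\<close> and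
  \<open>X - W\<close>.\<close>

lemma comult_left_class2:
  assumes "finite X" "finite Y" "X \<inter> Y = {}" and t: "t \<in> carrier (obj2 X Y)"
  shows "tensor_assoc K F F F (tensor_map K FF F (fock_comult K E) id (class2 X Y t)) =
    (\<Oplus>\<^bsub>tensor K F FF\<^esub>W\<in>Pow X. class3 W (X - W) Y
      (tensor_assoc K (sp_obj E W) (sp_obj E (X - W)) (sp_obj E Y)
        (tensor_map K (obj2 W (X - W)) (sp_obj E Y) (\<lambda>x. sp_comult E X x W) id t)))"
proof -
  note FM = module_fock and FFM = module_FF
  note FFF = module_tensor[OF FM FFM] and FFF' = module_tensor[OF FFM FM]
  interpret FFF: module K "tensor K F FF" by (rule FFF)
  note MX = module_obj[OF assms(1)] and MY = module_obj[OF assms(2)]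
  have fin: "finite W" "finite (X - W)" if "W \<subseteq> X" for W
    using that assms(1) finite_subset by auto
  note assoc = tensor_assoc_linear[OF FM FM FM]
  note lin1 = tensor_map_linear[OF FM FM FFM FM fock_comult_linear linear_maps_id']
  have lin2: "(\<lambda>t. tensor_map K (obj2 W (X - W)) (sp_obj E Y) (\<lambda>x. sp_comult E X x W) id t)
      \<in> linear_maps K (obj2 X Y) (tensor K (obj2 W (X - W)) (sp_obj E Y))" if W: "W \<subseteq> X" for W
    by (rule tensor_map_linear[OF MX MY module_obj2[OF fin[OF W]] MY comult_linear[OF assms(1) W] linear_maps_id'])
  have lin3: "(\<lambda>t. class3 W (X - W) Y (tensor_assoc K (sp_obj E W) (sp_obj E (X - W)) (sp_obj E Y)
        (tensor_map K (obj2 W (X - W)) (sp_obj E Y) (\<lambda>x. sp_comult E X x W) id t)))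
      \<in> linear_maps K (obj2 X Y) (tensor K F FF)" if "W \<in> Pow X" for W
  proof -
    have W: "W \<subseteq> X" using that by simp
    show ?thesis
      by (rule linear_maps_comp[OF linear_maps_comp[OF lin2[OF W]
          tensor_assoc_linear[OF module_obj[OF fin(1)[OF W]] module_obj[OF fin(2)[OF W]] MY]]
          class3_linear[OF fin[OF W] assms(2)]])
  qed
  show ?thesis
  proof (rule tensor_eqI'[OF MX MY FFF linear_maps_comp[OF linear_maps_comp[OF class2_linear[OF assms(1,2)] lin1] assoc]
        linear_maps_finsum_fun[OF FFF lin3] _ t])
    fix x y assume x: "x \<in> carrier (sp_obj E X)" and y: "y \<in> carrier (sp_obj E Y)"
    let ?x = "fock_class K E X x" and ?y = "fock_class K E Y y"
    have cl: "?x \<in> carrier F" "?y \<in> carrier F"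
      using x y assms by (auto intro: fock_class_closed)
    have lin4: "(\<lambda>s. tensor_assoc K F F F (pure_tensor K FF F s ?y)) \<in> linear_maps K FF (tensor K F FF)"
      by (rule linear_maps_comp[OF bilinear_maps_left[OF pure_tensor_bilinear[OF FFM FM] cl(2)] assoc])
    have summand: "class2 W (X - W) (sp_comult E X x W) \<in> carrier FF" if "W \<subseteq> X" for W
      by (rule linear_maps_closed[OF class_comult_summand_linear[OF assms(1) that] x])
    have "tensor_assoc K F F F (tensor_map K FF F (fock_comult K E) id
        (class2 X Y (pure_tensor K (sp_obj E X) (sp_obj E Y) x y))) =
        tensor_assoc K F F F (pure_tensor K FF F (class_comult X x) ?y)"
      unfolding class2_pure[OF assms(1,2) x y] tensor_map_pure[OF FM FM FFM FM fock_comult_linear linear_maps_id' cl]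
        fock_comult_class[OF assms(1) x] id_apply ..
    also have "\<dots> = (\<Oplus>\<^bsub>tensor K F FF\<^esub>W\<in>Pow X. tensor_assoc K F F F
        (pure_tensor K FF F (class2 W (X - W) (sp_comult E X x W)) ?y))"
      unfolding class_comult_def
      by (rule linear_maps_finsum[OF FFM FFF lin4]) (simp add: summand)
    also have "\<dots> = (\<Oplus>\<^bsub>tensor K F FF\<^esub>W\<in>Pow X. class3 W (X - W) Y
      (tensor_assoc K (sp_obj E W) (sp_obj E (X - W)) (sp_obj E Y)
        (tensor_map K (obj2 W (X - W)) (sp_obj E Y) (\<lambda>x. sp_comult E X x W) id
          (pure_tensor K (sp_obj E X) (sp_obj E Y) x y))))"
    proof (rule FFF.finsum_cong'[OF refl])
      show "(\<lambda>W. class3 W (X - W) Y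
      (tensor_assoc K (sp_obj E W) (sp_obj E (X - W)) (sp_obj E Y)
        (tensor_map K (obj2 W (X - W)) (sp_obj E Y) (\<lambda>x. sp_comult E X x W) id
          (pure_tensor K (sp_obj E X) (sp_obj E Y) x y)))) \<in> Pow X \<rightarrow> carrier (tensor K F FF)"
        by (rule Pi_I) (rule linear_maps_closed[OF lin3 pure_tensor_closed[OF MX MY x y]])
      fix W assume "W \<in> Pow X"
      then have W: "W \<subseteq> X" by simp
      note MW = module_obj[OF fin(1)[OF W]] module_obj[OF fin(2)[OF W]] and M2 = module_obj2[OF fin[OF W]]
      note d = comult_closed[OF assms(1) W x]
      have "tensor_assoc K F F F (pure_tensor K FF F (class2 W (X - W) (sp_comult E X x W)) ?y) =
          tensor_assoc K F F F (tensor_map K FF F (class2 W (X - W)) (fock_class K E Y)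
            (pure_tensor K (obj2 W (X - W)) (sp_obj E Y) (sp_comult E X x W) y))"
        unfolding tensor_map_pure[OF M2 MY FFM FM class2_linear[OF fin[OF W]] fock_class_linear[OF assms(2)] d y] ..
      also have "\<dots> = class3 W (X - W) Y (tensor_assoc K (sp_obj E W) (sp_obj E (X - W)) (sp_obj E Y)
          (pure_tensor K (obj2 W (X - W)) (sp_obj E Y) (sp_comult E X x W) y))"
        by (rule tensor_assoc_natural[OF MW(1) FM MW(2) FM MY FM fock_class_linear[OF fin(1)[OF W]]
            fock_class_linear[OF fin(2)[OF W]] fock_class_linear[OF assms(2)] pure_tensor_closed[OF M2 MY d y]])
      also have "pure_tensor K (obj2 W (X - W)) (sp_obj E Y) (sp_comult E X x W) y =
          tensor_map K (obj2 W (X - W)) (sp_obj E Y) (\<lambda>x. sp_comult E X x W) id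
            (pure_tensor K (sp_obj E X) (sp_obj E Y) x y)"
        unfolding tensor_map_pure[OF MX MY M2 MY comult_linear[OF assms(1) W] linear_maps_id' x y] id_apply ..
      finally show "tensor_assoc K F F F (pure_tensor K FF F (class2 W (X - W) (sp_comult E X x W)) ?y) =
        class3 W (X - W) Y (tensor_assoc K (sp_obj E W) (sp_obj E (X - W)) (sp_obj E Y)
          (tensor_map K (obj2 W (X - W)) (sp_obj E Y) (\<lambda>x. sp_comult E X x W) id
            (pure_tensor K (sp_obj E X) (sp_obj E Y) x y)))" .
    qed
    finally show "tensor_assoc K F F F (tensor_map K FF F (fock_comult K E) id
        (class2 X Y (pure_tensor K (sp_obj E X) (sp_obj E Y) x y))) =
      (\<Oplus>\<^bsub>tensor K F FF\<^esub>W\<in>Pow X. class3 W (X - W) Y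
      (tensor_assoc K (sp_obj E W) (sp_obj E (X - W)) (sp_obj E Y)
        (tensor_map K (obj2 W (X - W)) (sp_obj E Y) (\<lambda>x. sp_comult E X x W) id
          (pure_tensor K (sp_obj E X) (sp_obj E Y) x y))))" .
  qed
qed

text \<open>The counterpart for the other side: here it is the second block that is split, into
  \<open>W\<close> and \<open>Y - W\<close>.\<close>

lemma comult_right_class2:
  assumes "finite X" "finite Y" "X \<inter> Y = {}" and t: "t \<in> carrier (obj2 X Y)"
  shows "tensor_map K F FF id (fock_comult K E) (class2 X Y t) =
    (\<Oplus>\<^bsub>tensor K F FF\<^esub>W\<in>Pow Y. class3 X W (Y - W)
      (tensor_map K (sp_obj E X) (obj2 W (Y - W)) id (\<lambda>y. sp_comult E Y y W) t))"
proof -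
  note FM = module_fock and FFM = module_FF
  note FFF = module_tensor[OF FM FFM]
  interpret FFF: module K "tensor K F FF" by (rule FFF)
  note MX = module_obj[OF assms(1)] and MY = module_obj[OF assms(2)]
  have fin: "finite W" "finite (Y - W)" if "W \<subseteq> Y" for W
    using that assms(2) finite_subset by auto
  note lin1 = tensor_map_linear[OF FM FM FM FFM linear_maps_id' fock_comult_linear]
  have lin3: "(\<lambda>t. class3 X W (Y - W) (tensor_map K (sp_obj E X) (obj2 W (Y - W)) id (\<lambda>y. sp_comult E Y y W) t))
      \<in> linear_maps K (obj2 X Y) (tensor K F FF)" if "W \<in> Pow Y" for W
  proof -
    have W: "W \<subseteq> Y" using that by simp
    show ?thesis
      by (rule linear_maps_comp[OF tensor_map_linear[OF MX MY MX module_obj2[OF fin[OF W]] linear_maps_id'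
            comult_linear[OF assms(2) W]] class3_linear[OF assms(1) fin[OF W]]])
  qed
  show ?thesis
  proof (rule tensor_eqI'[OF MX MY FFF linear_maps_comp[OF class2_linear[OF assms(1,2)] lin1]
        linear_maps_finsum_fun[OF FFF lin3] _ t])
    fix x y assume x: "x \<in> carrier (sp_obj E X)" and y: "y \<in> carrier (sp_obj E Y)"
    let ?x = "fock_class K E X x" and ?y = "fock_class K E Y y"
    have cl: "?x \<in> carrier F" "?y \<in> carrier F"
      using x y assms by (auto intro: fock_class_closed)
    note lin4 = bilinear_maps_right[OF pure_tensor_bilinear[OF FM FFM] cl(1)]
    have summand: "class2 W (Y - W) (sp_comult E Y y W) \<in> carrier FF" if "W \<subseteq> Y" for W
      by (rule linear_maps_closed[OF class_comult_summand_linear[OF assms(2) that] y])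
    have "tensor_map K F FF id (fock_comult K E) (class2 X Y (pure_tensor K (sp_obj E X) (sp_obj E Y) x y)) =
        pure_tensor K F FF ?x (class_comult Y y)"
      unfolding class2_pure[OF assms(1,2) x y] tensor_map_pure[OF FM FM FM FFM linear_maps_id' fock_comult_linear cl]
        fock_comult_class[OF assms(2) y] id_apply ..
    also have "\<dots> = (\<Oplus>\<^bsub>tensor K F FF\<^esub>W\<in>Pow Y. pure_tensor K F FF ?x (class2 W (Y - W) (sp_comult E Y y W)))"
      unfolding class_comult_def
      by (rule linear_maps_finsum[OF FFM FFF lin4]) (simp add: summand)
    also have "\<dots> = (\<Oplus>\<^bsub>tensor K F FF\<^esub>W\<in>Pow Y. class3 X W (Y - W)
      (tensor_map K (sp_obj E X) (obj2 W (Y - W)) id (\<lambda>y. sp_comult E Y y W)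
        (pure_tensor K (sp_obj E X) (sp_obj E Y) x y)))"
    proof (rule FFF.finsum_cong'[OF refl])
      show "(\<lambda>W. class3 X W (Y - W) (tensor_map K (sp_obj E X) (obj2 W (Y - W)) id (\<lambda>y. sp_comult E Y y W)
          (pure_tensor K (sp_obj E X) (sp_obj E Y) x y))) \<in> Pow Y \<rightarrow> carrier (tensor K F FF)"
        by (rule Pi_I) (rule linear_maps_closed[OF lin3 pure_tensor_closed[OF MX MY x y]])
      fix W assume "W \<in> Pow Y"
      then have W: "W \<subseteq> Y" by simp
      note M2 = module_obj2[OF fin[OF W]] and d = comult_closed[OF assms(2) W y]
      show "pure_tensor K F FF ?x (class2 W (Y - W) (sp_comult E Y y W)) = class3 X W (Y - W)
        (tensor_map K (sp_obj E X) (obj2 W (Y - W)) id (\<lambda>y. sp_comult E Y y W)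
          (pure_tensor K (sp_obj E X) (sp_obj E Y) x y))"
        unfolding tensor_map_pure[OF MX MY MX M2 linear_maps_id' comult_linear[OF assms(2) W] x y] id_apply
          tensor_map_pure[OF MX M2 FM FFM fock_class_linear[OF assms(1)] class2_linear[OF fin[OF W]] x d] ..
    qed
    finally show "tensor_map K F FF id (fock_comult K E) (class2 X Y (pure_tensor K (sp_obj E X) (sp_obj E Y) x y)) =
      (\<Oplus>\<^bsub>tensor K F FF\<^esub>W\<in>Pow Y. class3 X W (Y - W)
      (tensor_map K (sp_obj E X) (obj2 W (Y - W)) id (\<lambda>y. sp_comult E Y y W)
        (pure_tensor K (sp_obj E X) (sp_obj E Y) x y)))" .
  qed
qed

text \<open>Both sides are sums over ordered decompositions of the ground set into three blocks.
  From the left they are indexed by chains \<open>W \<subseteq> Z \<subseteq> X\<close> with blocks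
  \<open>W\<close>, \<open>Z - W\<close>, \<open>X - Z\<close>; from the right by \<open>Z\<close>
  and \<open>W \<subseteq> X - Z\<close> with blocks \<open>Z\<close>, \<open>W\<close>,
  \<open>X - Z - W\<close>.\<close>

lemma fock_comult_coassoc:
  assumes "f \<in> carrier F"
  shows "tensor_assoc K F F F (tensor_map K FF F (fock_comult K E) id (fock_comult K E f)) =
    tensor_map K F FF id (fock_comult K E) (fock_comult K E f)"
proof -
  note FM = module_fock and FFM = module_FF
  note FFF = module_tensor[OF FM FFM]
  interpret FFF: module K "tensor K F FF" by (rule FFF)
  note linL = linear_maps_comp[OF tensor_map_linear[OF FM FM FFM FM fock_comult_linear linear_maps_id'] tensor_assoc_linear[OF FM FM FM]]
  note linR = tensor_map_linear[OF FM FM FM FFM linear_maps_id' fock_comult_linear]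
  show ?thesis
  proof (rule fock_eqI[OF FFF linear_maps_comp[OF fock_comult_linear linL] linear_maps_comp[OF fock_comult_linear linR] _ assms])
    fix n x assume x: "x \<in> carrier (obj n)"
    define X where "X = {1..n}"
    have X: "finite X" and x: "x \<in> carrier (sp_obj E X)"
      using x by (auto simp: X_def)
    have fin: "finite Z" "finite (X - Z)" if "Z \<subseteq> X" for Z
      using that X finite_subset by auto
    have summand: "class2 Z (X - Z) (sp_comult E X x Z) \<in> carrier FF" if "Z \<in> Pow X" for Z
      using that by (intro linear_maps_closed[OF class_comult_summand_linear[OF X] x]) simp
    define left where "left Z W = class3 W (Z - W) (X - Z)
        (tensor_assoc K (sp_obj E W) (sp_obj E (Z - W)) (sp_obj E (X - Z))
          (tensor_map K (obj2 W (Z - W)) (sp_obj E (X - Z)) (\<lambda>x. sp_comult E Z x W) id (sp_comult E X x Z)))" for Z W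
    define right where "right Z W = class3 Z W (X - Z - W)
        (tensor_map K (sp_obj E Z) (obj2 W (X - Z - W)) id (\<lambda>y. sp_comult E (X - Z) y W) (sp_comult E X x Z))" for Z W
    have right_closed: "right Z W \<in> carrier (tensor K F FF)" if "Z \<subseteq> X" "W \<subseteq> X - Z" for Z W
    proof -
      have finW: "finite W" "finite (X - Z - W)"
        using that fin(2)[OF that(1)] finite_subset by auto
      note M = module_obj[OF fin(1)[OF that(1)]]
      show ?thesis
        unfolding right_def
        by (rule linear_maps_closed[OF class3_linear[OF fin(1)[OF that(1)] finW]
            linear_maps_closed[OF tensor_map_linear[OF M module_obj[OF fin(2)[OF that(1)]] M
              module_obj2[OF finW] linear_maps_id' comult_linear[OF fin(2)[OF that(1)] that(2)]]
            comult_closed[OF X that(1) x]]])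
    qed
    \<comment> \<open>Coassociativity of the species at the blocks \<open>W\<close>,
      \<open>Z - W\<close> and \<open>X - Z\<close>; the set equations reassemble the unions of
      blocks.\<close>
    have left_right: "left Z W = right W (Z - W)" if "Z \<subseteq> X" "W \<subseteq> Z" for Z W
    proof -
      have eqs: "W \<union> (Z - W) = Z" "Z \<union> (X - Z) = X" "(Z - W) \<union> (X - Z) = X - W" "X - W - (Z - W) = X - Z"
        using that by auto
      have "finite W" "finite (Z - W)" "finite (X - Z)"
        using that fin finite_subset by auto
      then show ?thesis
        using comult_assoc[of W "Z - W" "X - Z" x] x that
        unfolding left_def right_def eqs by (simp add: eqs) fastforce
    qed
    have "tensor_assoc K F F F (tensor_map K FF F (fock_comult K E) id (fock_comult K E (fock_class K E X x))) =
        (\<Oplus>\<^bsub>tensor K F FF\<^esub>Z\<in>Pow X. tensor_assoc K F F F (tensor_map K FF F (fock_comult K E) id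
          (class2 Z (X - Z) (sp_comult E X x Z))))"
      unfolding fock_comult_class[OF X x] class_comult_def
      by (rule linear_maps_finsum[OF FFM FFF linL summand])
    also have "\<dots> = (\<Oplus>\<^bsub>tensor K F FF\<^esub>Z\<in>Pow X. \<Oplus>\<^bsub>tensor K F FF\<^esub>W\<in>Pow Z. right W (Z - W))"
    proof (rule FFF.finsum_cong'[OF refl])
      have rc: "right W (Z - W) \<in> carrier (tensor K F FF)" if "Z \<subseteq> X" "W \<subseteq> Z" for Z W
        by (rule right_closed) (use that in auto)
      then show "(\<lambda>Z. \<Oplus>\<^bsub>tensor K F FF\<^esub>W\<in>Pow Z. right W (Z - W)) \<in> Pow X \<rightarrow> carrier (tensor K F FF)"
        by (intro Pi_I FFF.finsum_closed) auto
      fix Z assume "Z \<in> Pow X"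
      then have Z: "Z \<subseteq> X" by simp
      have "tensor_assoc K F F F (tensor_map K FF F (fock_comult K E) id
          (class2 Z (X - Z) (sp_comult E X x Z))) = (\<Oplus>\<^bsub>tensor K F FF\<^esub>W\<in>Pow Z. left Z W)"
        unfolding left_def
        by (rule comult_left_class2[OF fin[OF Z] _ comult_closed[OF X Z x]]) auto
      also have "\<dots> = (\<Oplus>\<^bsub>tensor K F FF\<^esub>W\<in>Pow Z. right W (Z - W))"
        using rc[OF Z] left_right[OF Z] by (intro FFF.finsum_cong') auto
      finally show "tensor_assoc K F F F (tensor_map K FF F (fock_comult K E) id
          (class2 Z (X - Z) (sp_comult E X x Z))) = (\<Oplus>\<^bsub>tensor K F FF\<^esub>W\<in>Pow Z. right W (Z - W))" .
    qed
    also have "\<dots> = (\<Oplus>\<^bsub>tensor K F FF\<^esub>p\<in>Sigma (Pow X) Pow. case p of (Z, W) \<Rightarrow> right W (Z - W))"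
    proof (rule finsum_Sigma[OF FFF.abelian_group_axioms])
      show "right W (Z - W) \<in> carrier (tensor K F FF)" if "Z \<in> Pow X" "W \<in> Pow Z" for Z W
        by (rule right_closed) (use that in auto)
    qed (use X fin in auto)
    \<comment> \<open>The first and second block \<open>Z\<close> and \<open>W\<close> determine the
      chain \<open>Z \<subseteq> Z \<union> W\<close>. Conversely a chain determines the second
      block as a difference.\<close>
    also have "\<dots> = (\<Oplus>\<^bsub>tensor K F FF\<^esub>p\<in>Sigma (Pow X) (\<lambda>Z. Pow (X - Z)).
        (\<lambda>(Z, W). right W (Z - W)) ((\<lambda>(Z, W). (Z \<union> W, Z)) p))"
    proof (rule finsum_reindex_bij_betw[OF FFF.abelian_group_axioms])
      show "bij_betw (\<lambda>(Z, W). (Z \<union> W, Z)) (Sigma (Pow X) (\<lambda>Z. Pow (X - Z))) (Sigma (Pow X) Pow)"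
        by (rule bij_betw_byWitness[where f' = "\<lambda>(Z, W). (W, Z - W)"]) auto
      show "(\<lambda>(Z, W). right W (Z - W)) p \<in> carrier (tensor K F FF)" if "p \<in> Sigma (Pow X) Pow" for p
        using that by (auto intro!: right_closed)
    qed
    also have "\<dots> = (\<Oplus>\<^bsub>tensor K F FF\<^esub>p\<in>Sigma (Pow X) (\<lambda>Z. Pow (X - Z)). case p of (Z, W) \<Rightarrow> right Z W)"
    proof (rule FFF.finsum_cong'[OF refl])
      show "(\<lambda>(Z, W). right Z W) \<in> Sigma (Pow X) (\<lambda>Z. Pow (X - Z)) \<rightarrow> carrier (tensor K F FF)"
        by (auto intro!: right_closed)
      fix p assume "p \<in> Sigma (Pow X) (\<lambda>Z. Pow (X - Z))"
      moreover have "Z \<union> W - Z = W" if "W \<subseteq> X - Z" for Z W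
        using that by auto
      ultimately show "(\<lambda>(Z, W). right W (Z - W)) ((\<lambda>(Z, W). (Z \<union> W, Z)) p) = (\<lambda>(Z, W). right Z W) p"
        by auto
    qed
    also have "\<dots> = (\<Oplus>\<^bsub>tensor K F FF\<^esub>Z\<in>Pow X. \<Oplus>\<^bsub>tensor K F FF\<^esub>W\<in>Pow (X - Z). right Z W)"
      by (rule finsum_Sigma[OF FFF.abelian_group_axioms, symmetric]) (use X in \<open>auto intro!: right_closed\<close>)
    also have "\<dots> = (\<Oplus>\<^bsub>tensor K F FF\<^esub>Z\<in>Pow X. tensor_map K F FF id (fock_comult K E)
          (class2 Z (X - Z) (sp_comult E X x Z)))"
    proof (rule FFF.finsum_cong'[OF refl])
      show "(\<lambda>Z. tensor_map K F FF id (fock_comult K E) (class2 Z (X - Z) (sp_comult E X x Z))) \<in>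
          Pow X \<rightarrow> carrier (tensor K F FF)"
        by (rule Pi_I) (rule linear_maps_closed[OF linR summand])
      fix Z assume "Z \<in> Pow X"
      then have Z: "Z \<subseteq> X" by simp
      show "(\<Oplus>\<^bsub>tensor K F FF\<^esub>W\<in>Pow (X - Z). right Z W) = tensor_map K F FF id (fock_comult K E)
          (class2 Z (X - Z) (sp_comult E X x Z))"
        unfolding right_def
        by (rule comult_right_class2[OF fin[OF Z] _ comult_closed[OF X Z x], symmetric]) auto
    qed
    also have "\<dots> = tensor_map K F FF id (fock_comult K E) (fock_comult K E (fock_class K E X x))"
      unfolding fock_comult_class[OF X x] class_comult_def
      by (rule linear_maps_finsum[OF FFM FFF linR summand, symmetric])
    finally show "tensor_assoc K F F F (tensor_map K FF F (fock_comult K E) id (fock_comult K E (fock_class K E {1..n} x))) =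
        tensor_map K F FF id (fock_comult K E) (fock_comult K E (fock_class K E {1..n} x))"
      unfolding X_def .
  qed
qed

end

section \<open>The bialgebra structure of the Fock space\<close>

locale fock_bimonoid = fock_species K E
  for K :: "('k, 'm) ring_scheme" and E :: "(nat, 'k, 'v, 'z) bimon_species_scheme" +
  assumes bimonoid: "bimonoid_no_counit K E"

sublocale fock_bimonoid \<subseteq> fock_monoid K E
  using bimonoid by unfold_locales (simp add: bimonoid_no_counit_def)

sublocale fock_bimonoid \<subseteq> fock_comonoid K E
  using bimonoid by unfold_locales (simp add: bimonoid_no_counit_def)

context fock_bimonoid
begin

lemma comult_mult:
  assumes "finite X" "finite Y" "X \<inter> Y = {}" "a \<in> carrier (sp_obj E X)" "b \<in> carrier (sp_obj E Y)"
    "Z \<subseteq> X \<union> Y"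
  shows "sp_comult E (X \<union> Y) (sp_mult E X Y a b) Z =
    tensor_mult K (sp_obj E Z) (sp_obj E (X \<union> Y - Z))
      (sp_mult E (Z \<inter> X) (Z \<inter> Y)) (sp_mult E (X - Z) (Y - Z))
      (sp_comult E X a (Z \<inter> X)) (sp_comult E Y b (Z \<inter> Y))"
  using bimonoid assms by (simp add: bimonoid_no_counit_def)

lemma comult_unit: "sp_comult E {} (sp_unit E) {} = pure_tensor K (sp_obj E {}) (sp_obj E {}) (sp_unit E) (sp_unit E)"
  using bimonoid by (simp add: bimonoid_no_counit_def)

abbreviation "FF_mult \<equiv> tensor_mult K F F (fock_mult K E) (fock_mult K E)"

lemma FF_mult_bilinear: "FF_mult \<in> bilinear_maps K FF FF FF"
  by (rule tensor_mult_bilinear(3)[OF module_fock module_fock module_fock module_fock module_fock module_fock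
      fock_mult_bilinear fock_mult_bilinear])

text \<open>Both sides are bilinear in \<open>s\<close> and \<open>t\<close>. On pure tensors the
  claim is \<open>fock_mult_class\<close> in each of the two tensor factors.\<close>

lemma class2_mult:
  assumes "finite X" "finite X'" "X \<inter> X' = {}" "finite Y" "finite Y'" "Y \<inter> Y' = {}"
    and s: "s \<in> carrier (obj2 X Y)" and t: "t \<in> carrier (obj2 X' Y')"
  shows "FF_mult (class2 X Y s) (class2 X' Y' t) = class2 (X \<union> X') (Y \<union> Y')
    (tensor_mult K (sp_obj E (X \<union> X')) (sp_obj E (Y \<union> Y')) (sp_mult E X X') (sp_mult E Y Y') s t)"
proof -
  have fin: "finite (X \<union> X')" "finite (Y \<union> Y')" using assms by auto
  note M = module_obj[OF fin(1)] module_obj[OF fin(2)] module_obj[OF assms(1)] module_obj[OF assms(4)]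
    module_obj[OF assms(2)] module_obj[OF assms(5)]
  note mX = mult_bilinear[OF assms(1-3)] and mY = mult_bilinear[OF assms(4-6)]
  note FM = module_fock
  show ?thesis
  proof (rule bilinear_maps_eqI[OF module_obj2[OF assms(1,4)] module_obj2[OF assms(2,5)] module_FF
      bilinear_maps_comp[OF class2_linear[OF assms(1,4)] class2_linear[OF assms(2,5)] FF_mult_bilinear linear_maps_id]
      bilinear_maps_comp[OF linear_maps_id linear_maps_id tensor_mult_bilinear(3)[OF M mX mY] class2_linear[OF fin]]
      spans_tensor[OF M(3,4) spans_carrier spans_carrier] spans_tensor[OF M(5,6) spans_carrier spans_carrier] _ s t])
    fix p q assume "p \<in> (\<lambda>(x, y). pure_tensor K (sp_obj E X) (sp_obj E Y) x y) `
        (carrier (sp_obj E X) \<times> carrier (sp_obj E Y))"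
      and "q \<in> (\<lambda>(x, y). pure_tensor K (sp_obj E X') (sp_obj E Y') x y) `
        (carrier (sp_obj E X') \<times> carrier (sp_obj E Y'))"
    then obtain x y x' y' where p: "p = pure_tensor K (sp_obj E X) (sp_obj E Y) x y"
      and q: "q = pure_tensor K (sp_obj E X') (sp_obj E Y') x' y'"
      and x: "x \<in> carrier (sp_obj E X)" and y: "y \<in> carrier (sp_obj E Y)"
      and x': "x' \<in> carrier (sp_obj E X')" and y': "y' \<in> carrier (sp_obj E Y')"
      by auto
    note c = fock_class_closed[OF assms(1) x] fock_class_closed[OF assms(4) y]
      fock_class_closed[OF assms(2) x'] fock_class_closed[OF assms(5) y']
    show "FF_mult (class2 X Y p) (class2 X' Y' q) = class2 (X \<union> X') (Y \<union> Y')
      (tensor_mult K (sp_obj E (X \<union> X')) (sp_obj E (Y \<union> Y')) (sp_mult E X X') (sp_mult E Y Y') p q)"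
      unfolding p q class2_pure[OF assms(1,4) x y] class2_pure[OF assms(2,5) x' y']
        tensor_mult_pure[OF FM FM FM FM FM FM fock_mult_bilinear fock_mult_bilinear c]
        tensor_mult_pure[OF M mX mY x y x' y']
        class2_pure[OF fin mult_closed[OF assms(1-3) x x'] mult_closed[OF assms(4-6) y y']]
        fock_mult_class[OF assms(1-3) x x'] fock_mult_class[OF assms(4-6) y y'] ..
  qed
qed

text \<open>A subset of the disjoint union \<open>X \<union> Y\<close> is the same as a pair of a
  subset of \<open>X\<close> and a subset of \<open>Y\<close>. Under this correspondence the
  compatibility in the species matches the summands with the terms of the expanded product.\<close>

lemma class_comult_mult:
  assumes "finite X" "finite Y" "X \<inter> Y = {}" and a: "a \<in> carrier (sp_obj E X)" and b: "b \<in> carrier (sp_obj E Y)"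
  shows "class_comult (X \<union> Y) (sp_mult E X Y a b) = FF_mult (class_comult X a) (class_comult Y b)"
proof -
  interpret FF: module K FF by (rule module_FF)
  have fin: "finite (X \<union> Y)" using assms by simp
  note ab = mult_closed[OF assms]
  define f where "f Z = class2 Z (X \<union> Y - Z) (sp_comult E (X \<union> Y) (sp_mult E X Y a b) Z)" for Z
  define g where "g Z W = FF_mult (class2 Z (X - Z) (sp_comult E X a Z)) (class2 W (Y - W) (sp_comult E Y b W))" for Z W
  have summand: "class2 Z (X - Z) (sp_comult E X a Z) \<in> carrier FF" "class2 W (Y - W) (sp_comult E Y b W) \<in> carrier FF"
    if "Z \<subseteq> X" "W \<subseteq> Y" for Z W
    using linear_maps_closed[OF class_comult_summand_linear[OF assms(1) that(1)] a]
      linear_maps_closed[OF class_comult_summand_linear[OF assms(2) that(2)] b] by auto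
  have f_closed: "f Z \<in> carrier FF" if "Z \<in> Pow (X \<union> Y)" for Z
    unfolding f_def by (rule linear_maps_closed[OF class_comult_summand_linear[OF fin] ab]) (use that in simp)
  have g_closed: "g Z W \<in> carrier FF" if "Z \<subseteq> X" "W \<subseteq> Y" for Z W
    unfolding g_def by (rule bilinear_maps_closed[OF FF_mult_bilinear summand[OF that]])
  have fg: "f (Z \<union> W) = g Z W" if Z: "Z \<subseteq> X" and W: "W \<subseteq> Y" for Z W
  proof -
    have sub: "Z \<union> W \<subseteq> X \<union> Y" and eqs: "(Z \<union> W) \<inter> X = Z" "(Z \<union> W) \<inter> Y = W" "X - (Z \<union> W) = X - Z" "Y - (Z \<union> W) = Y - W"
      "X \<union> Y - (Z \<union> W) = (X - Z) \<union> (Y - W)" "Z \<inter> W = {}" "(X - Z) \<inter> (Y - W) = {}"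
      using Z W assms(3) by auto
    have fins: "finite Z" "finite W" "finite (X - Z)" "finite (Y - W)"
      using Z W assms(1,2) finite_subset by auto
    show ?thesis
      unfolding f_def g_def comult_mult[OF assms sub] eqs(1-5)
      by (rule class2_mult[OF fins(1,2) eqs(6) fins(3,4) eqs(7) comult_closed[OF assms(1) Z a]
          comult_closed[OF assms(2) W b], symmetric])
  qed
  have "class_comult (X \<union> Y) (sp_mult E X Y a b) = (\<Oplus>\<^bsub>FF\<^esub>Z\<in>Pow (X \<union> Y). f Z)"
    by (simp add: class_comult_def f_def)
  also have "\<dots> = (\<Oplus>\<^bsub>FF\<^esub>p\<in>Pow X \<times> Pow Y. f (case p of (Z, W) \<Rightarrow> Z \<union> W))"
  proof (rule finsum_reindex_bij_betw[OF FF.abelian_group_axioms _ f_closed])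
    show "bij_betw (\<lambda>(Z, W). Z \<union> W) (Pow X \<times> Pow Y) (Pow (X \<union> Y))"
      by (rule bij_betw_byWitness[where f' = "\<lambda>Z. (Z \<inter> X, Z \<inter> Y)"]) (use assms(3) in auto)
  qed
  also have "\<dots> = (\<Oplus>\<^bsub>FF\<^esub>p\<in>Pow X \<times> Pow Y. case p of (Z, W) \<Rightarrow> g Z W)"
    by (rule FF.finsum_cong') (auto simp: fg g_closed)
  also have "\<dots> = (\<Oplus>\<^bsub>FF\<^esub>Z\<in>Pow X. \<Oplus>\<^bsub>FF\<^esub>W\<in>Pow Y. g Z W)"
    by (rule finsum_Sigma[OF FF.abelian_group_axioms, symmetric]) (use assms(1,2) in \<open>auto simp: g_closed\<close>)
  also have "\<dots> = FF_mult (class_comult X a) (class_comult Y b)"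
    unfolding class_comult_def g_def
    by (rule bilinear_maps_finsum[OF module_FF module_FF module_FF FF_mult_bilinear, symmetric]) (auto intro: summand)
  finally show ?thesis .
qed

lemma fock_comult_mult:
  assumes f: "f \<in> carrier F" and g: "g \<in> carrier F"
  shows "fock_comult K E (fock_mult K E f g) = FF_mult (fock_comult K E f) (fock_comult K E g)"
proof (rule bilinear_maps_eqI[OF module_fock module_fock module_FF
      bilinear_maps_comp[OF linear_maps_id linear_maps_id fock_mult_bilinear fock_comult_linear]
      bilinear_maps_comp[OF fock_comult_linear fock_comult_linear FF_mult_bilinear linear_maps_id]
      spans_fock spans_fock _ f g])
  fix s t assume "s \<in> (\<Union>n. fock_class K E {1..n} ` carrier (obj n))"
    and "t \<in> (\<Union>n. fock_class K E {1..n} ` carrier (obj n))"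
  then obtain k a l b where a: "a \<in> carrier (obj k)" and s: "s = fock_class K E {1..k} a"
    and b: "b \<in> carrier (obj l)" and t: "t = fock_class K E {1..l} b"
    by auto
  obtain b' where b': "b' \<in> carrier (sp_obj E {k + 1..k + l})"
    "fock_class K E {1..l} b = fock_class K E {k + 1..k + l} b'"
    by (rule fock_class_shift[OF b])
  have fin: "finite {1..k}" "finite {k + 1..k + l}" "{1..k} \<inter> {k + 1..k + l} = {}"
    by auto
  show "fock_comult K E (fock_mult K E s t) = FF_mult (fock_comult K E s) (fock_comult K E t)"
    unfolding s t b'(2) fock_mult_class[OF fin a b'(1)] fock_comult_class[OF fin(1) a]
      fock_comult_class[OF fin(2) b'(1)] fock_comult_class[OF finite_UnI[OF fin(1,2)] mult_closed[OF fin a b'(1)]]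
    by (rule class_comult_mult[OF fin a b'(1)])
qed

lemma fock_comult_one:
  "fock_comult K E (fock_class K E {} (sp_unit E)) =
    pure_tensor K F F (fock_class K E {} (sp_unit E)) (fock_class K E {} (sp_unit E))"
proof -
  interpret FF: module K FF by (rule module_FF)
  have "class2 {} ({} - {}) (sp_comult E {} (sp_unit E) {}) =
      pure_tensor K F F (fock_class K E {} (sp_unit E)) (fock_class K E {} (sp_unit E))"
    by (simp add: comult_unit class2_pure unit_closed)
  moreover have "pure_tensor K F F (fock_class K E {} (sp_unit E)) (fock_class K E {} (sp_unit E)) \<in> carrier FF"
    by (intro pure_tensor_closed module_fock one_closed)
  ultimately show ?thesis
    by (simp add: fock_comult_class unit_closed class_comult_def)
qed

lemma bialgebra_fock: "bialgebra_no_counit K A (fock_comult K E)"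
proof -
  have "fock_comult K E \<in> ring_hom A (tensor_algebra K A A)"
    using linear_maps_closed[OF fock_comult_linear]
    by (intro ring_hom_memI)
       (simp_all add: tensor_algebra_def fock_algebra_def fock_comult_mult fock_comult_one
         linear_maps_add[OF fock_comult_linear])
  then show ?thesis
    using module_fock_algebra ring_fock_algebra fock_mult_bilinear fock_comult_linear fock_comult_coassoc
    by (simp add: bialgebra_no_counit_def fock_algebra_def)
qed

end

section \<open>Gradings\<close>

lemma finsum_neutral_superset:
  assumes "abelian_group V" "finite A" "B \<subseteq> A" "\<And>i. i \<in> A - B \<Longrightarrow> h i = \<zero>\<^bsub>V\<^esub>" "\<And>i. i \<in> B \<Longrightarrow> h i \<in> carrier V"
  shows "(\<Oplus>\<^bsub>V\<^esub>i\<in>B. h i) = (\<Oplus>\<^bsub>V\<^esub>i\<in>A. h i)"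
proof -
  interpret V: abelian_group V by fact
  have "h i \<in> carrier V" if "i \<in> A" for i
    using that assms(4,5) by (cases "i \<in> B") auto
  then show ?thesis
    using assms by (intro V.add.finprod_mono_neutral_cong_left) auto
qed

text \<open>Spanning by homogeneous elements gives existence of decompositions, and the projections
  \<open>p n\<close> give uniqueness, since they read off the components of any
  decomposition.\<close>

lemma graded_moduleI:
  assumes V: "module K V" and G: "\<And>n. submodule (G n) K V"
    and p: "\<And>n. p n \<in> linear_maps K V V"
    and pG: "\<And>m n x. x \<in> G m \<Longrightarrow> p n x = (if n = m then x else \<zero>\<^bsub>V\<^esub>)"
    and spans: "spans K V (\<Union>n. G n)"
  shows "graded_module K V G"
proof -
  interpret V: module K V by fact
  note Gc = submodule_closed[OF V G]
  \<comment> \<open>The finite sums of homogeneous elements. The index set \<open>J\<close> need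
    only contain the support, so two such sums can be rewritten over a common one.\<close>
  define N where "N = {x. \<exists>h J. finite J \<and> (\<forall>n. h n \<in> G n) \<and> (\<forall>n. n \<notin> J \<longrightarrow> h n = \<zero>\<^bsub>V\<^esub>) \<and> x = (\<Oplus>\<^bsub>V\<^esub>n\<in>J. h n)}"
  have NI: "x \<in> N" if "finite J" "\<And>n. h n \<in> G n" "\<And>n. n \<notin> J \<Longrightarrow> h n = \<zero>\<^bsub>V\<^esub>" "x = (\<Oplus>\<^bsub>V\<^esub>n\<in>J. h n)" for x h J
    using that unfolding N_def by blast
  have smult: "c \<odot>\<^bsub>V\<^esub> x \<in> N" if c: "c \<in> carrier K" and "x \<in> N" for c x
  proof -
    obtain h J where h: "finite J" "\<And>n. h n \<in> G n" "\<And>n. n \<notin> J \<Longrightarrow> h n = \<zero>\<^bsub>V\<^esub>" "x = (\<Oplus>\<^bsub>V\<^esub>n\<in>J. h n)"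
      using \<open>x \<in> N\<close> unfolding N_def by blast
    show ?thesis
      using c h Gc by (intro NI[of J "\<lambda>n. c \<odot>\<^bsub>V\<^esub> h n"]) (auto intro!: V.finsum_smult_ldistr)
  qed
  have "submodule N K V"
  proof (rule V.submoduleI)
    show "N \<subseteq> carrier V"
      using Gc(1) by (auto simp: N_def intro!: V.finsum_closed)
    show "\<zero>\<^bsub>V\<^esub> \<in> N"
      by (rule NI[of "{}" "\<lambda>_. \<zero>\<^bsub>V\<^esub>"]) (simp_all add: Gc(2))
    then show "\<ominus>\<^bsub>V\<^esub> x \<in> N" if "x \<in> N" for x
      using smult[of "\<ominus>\<^bsub>K\<^esub> \<one>\<^bsub>K\<^esub>" x] that \<open>N \<subseteq> carrier V\<close> by (simp add: V.smult_l_minus subset_iff)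
    show "c \<odot>\<^bsub>V\<^esub> x \<in> N" if "c \<in> carrier K" "x \<in> N" for c x
      using that by (rule smult)
    fix x y assume "x \<in> N" "y \<in> N"
    obtain h J where h: "finite J" "\<And>n. h n \<in> G n" "\<And>n. n \<notin> J \<Longrightarrow> h n = \<zero>\<^bsub>V\<^esub>" "x = (\<Oplus>\<^bsub>V\<^esub>n\<in>J. h n)"
      using \<open>x \<in> N\<close> unfolding N_def by blast
    obtain g L where g: "finite L" "\<And>n. g n \<in> G n" "\<And>n. n \<notin> L \<Longrightarrow> g n = \<zero>\<^bsub>V\<^esub>" "y = (\<Oplus>\<^bsub>V\<^esub>n\<in>L. g n)"
      using \<open>y \<in> N\<close> unfolding N_def by blast
    have hc: "h n \<in> carrier V" and gc: "g n \<in> carrier V" for n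
      using Gc(1) h(2) g(2) by auto
    have "x = (\<Oplus>\<^bsub>V\<^esub>n\<in>J \<union> L. h n)" "y = (\<Oplus>\<^bsub>V\<^esub>n\<in>J \<union> L. g n)"
      unfolding h(4) g(4) using h(1,3) g(1,3) hc gc
      by (intro finsum_neutral_superset[OF V.abelian_group_axioms]; auto)+
    then have "x \<oplus>\<^bsub>V\<^esub> y = (\<Oplus>\<^bsub>V\<^esub>n\<in>J \<union> L. h n \<oplus>\<^bsub>V\<^esub> g n)"
      using hc gc by simp
    then show "x \<oplus>\<^bsub>V\<^esub> y \<in> N"
      using h g Gc(2,3) by (intro NI[of "J \<union> L" "\<lambda>n. h n \<oplus>\<^bsub>V\<^esub> g n"]) auto
  qed
  moreover have "(\<Union>n. G n) \<subseteq> N"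
  proof safe
    fix n x assume x: "x \<in> G n"
    then show "x \<in> N"
      using Gc by (intro NI[of "{n}" "\<lambda>m. if m = n then x else \<zero>\<^bsub>V\<^esub>"]) auto
  qed
  ultimately have "carrier V \<subseteq> N"
    using spans lin_span_least unfolding spans_def by (metis subset_trans)
  show ?thesis
    unfolding graded_module_def
  proof (intro conjI allI ballI G)
    fix x assume x: "x \<in> carrier V"
    define P where "P h \<longleftrightarrow> (\<forall>n. h n \<in> G n) \<and> finite {n. h n \<noteq> \<zero>\<^bsub>V\<^esub>} \<and> x = (\<Oplus>\<^bsub>V\<^esub>n\<in>{n. h n \<noteq> \<zero>\<^bsub>V\<^esub>}. h n)" for h
    obtain h J where h: "finite J" "\<And>n. h n \<in> G n" "\<And>n. n \<notin> J \<Longrightarrow> h n = \<zero>\<^bsub>V\<^esub>" "x = (\<Oplus>\<^bsub>V\<^esub>n\<in>J. h n)"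
      using x \<open>carrier V \<subseteq> N\<close> unfolding N_def by blast
    have sub: "{n. h n \<noteq> \<zero>\<^bsub>V\<^esub>} \<subseteq> J"
      using h(3) by auto
    have "(\<Oplus>\<^bsub>V\<^esub>n\<in>{n. h n \<noteq> \<zero>\<^bsub>V\<^esub>}. h n) = x"
      unfolding h(4) using h(1,2) Gc(1) sub
      by (intro finsum_neutral_superset[OF V.abelian_group_axioms]) auto
    then have "P h"
      unfolding P_def using h(2) finite_subset[OF sub h(1)] by simp
    \<comment> \<open>Applying \<open>p n\<close> to any decomposition of \<open>x\<close> leaves
      its component in degree \<open>n\<close>, so every decomposition is determined by
      \<open>x\<close>.\<close>
    moreover have "h' n = p n x" if "P h'" for h' n
    proof -
      let ?S = "{n. h' n \<noteq> \<zero>\<^bsub>V\<^esub>}"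
      have S: "finite ?S" "\<And>n. h' n \<in> G n" and x': "x = (\<Oplus>\<^bsub>V\<^esub>n\<in>?S. h' n)"
        using that unfolding P_def by blast+
      have "p n x = (\<Oplus>\<^bsub>V\<^esub>m\<in>?S. p n (h' m))"
        unfolding x' using S(2) Gc(1) by (intro linear_maps_finsum[OF V V p]) auto
      also have "\<dots> = (\<Oplus>\<^bsub>V\<^esub>m\<in>?S. if n = m then h' m else \<zero>\<^bsub>V\<^esub>)"
        using Gc(1)[OF S(2)] by (intro V.finsum_cong') (auto simp: pG[OF S(2)])
      also have "\<dots> = h' n"
      proof (cases "n \<in> ?S")
        case True
        then show ?thesis
          using S Gc(1) by (intro V.finsum_singleton) auto
      next
        case False
        then show ?thesis
          by (intro trans[OF V.add.finprod_one_eqI]) auto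
      qed
      finally show ?thesis ..
    qed
    ultimately have "\<exists>!h. P h"
      by (intro ex1I[of P h] ext) (metis, metis)
    then show "\<exists>!h. (\<forall>n. h n \<in> G n) \<and> finite {n. h n \<noteq> \<zero>\<^bsub>V\<^esub>} \<and> x = (\<Oplus>\<^bsub>V\<^esub>n\<in>{n. h n \<noteq> \<zero>\<^bsub>V\<^esub>}. h n)"
      unfolding P_def .
  qed
qed

text \<open>The way back from a grading to its projections. For \<open>x\<close> in the carrier,
  uniqueness of the decomposition makes the description by \<open>THE\<close> meaningful.\<close>

definition graded_part ::
    "('k, 'm) ring_scheme \<Rightarrow> ('k, 'v, 'p) module_scheme \<Rightarrow> (nat \<Rightarrow> 'v set) \<Rightarrow> nat \<Rightarrow> 'v \<Rightarrow> 'v"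
  where "graded_part K V G n x =
    (THE h. (\<forall>n. h n \<in> G n) \<and> finite {n. h n \<noteq> \<zero>\<^bsub>V\<^esub>} \<and> x = (\<Oplus>\<^bsub>V\<^esub>n\<in>{n. h n \<noteq> \<zero>\<^bsub>V\<^esub>}. h n)) n"

lemma graded_module_submodule: "graded_module K V G \<Longrightarrow> submodule (G n) K V"
  by (simp add: graded_module_def)

lemma graded_part_expand:
  assumes "graded_module K V G" "x \<in> carrier V"
  shows "graded_part K V G n x \<in> G n" "finite {n. graded_part K V G n x \<noteq> \<zero>\<^bsub>V\<^esub>}"
    "(\<Oplus>\<^bsub>V\<^esub>n\<in>{n. graded_part K V G n x \<noteq> \<zero>\<^bsub>V\<^esub>}. graded_part K V G n x) = x"
proof -
  have "\<exists>!h. (\<forall>n. h n \<in> G n) \<and> finite {n. h n \<noteq> \<zero>\<^bsub>V\<^esub>} \<and> x = (\<Oplus>\<^bsub>V\<^esub>n\<in>{n. h n \<noteq> \<zero>\<^bsub>V\<^esub>}. h n)"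
    using assms by (simp add: graded_module_def)
  from theI'[OF this]
  show "graded_part K V G n x \<in> G n" "finite {n. graded_part K V G n x \<noteq> \<zero>\<^bsub>V\<^esub>}"
    "(\<Oplus>\<^bsub>V\<^esub>n\<in>{n. graded_part K V G n x \<noteq> \<zero>\<^bsub>V\<^esub>}. graded_part K V G n x) = x"
    unfolding graded_part_def by auto
qed

lemma graded_part_unique:
  assumes "module K V" "graded_module K V G" "finite J" "\<And>n. h n \<in> G n" "\<And>n. n \<notin> J \<Longrightarrow> h n = \<zero>\<^bsub>V\<^esub>"
  shows "graded_part K V G n (\<Oplus>\<^bsub>V\<^esub>n\<in>J. h n) = h n"
proof -
  interpret V: module K V by fact
  let ?x = "\<Oplus>\<^bsub>V\<^esub>n\<in>J. h n"
  have hc: "h n \<in> carrier V" for n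
    by (rule submodule_closed(1)[OF assms(1) graded_module_submodule[OF assms(2)] assms(4)])
  then have "?x \<in> carrier V"
    by (intro V.finsum_closed) auto
  define P where "P g \<longleftrightarrow> (\<forall>n. g n \<in> G n) \<and> finite {n. g n \<noteq> \<zero>\<^bsub>V\<^esub>} \<and> ?x = (\<Oplus>\<^bsub>V\<^esub>n\<in>{n. g n \<noteq> \<zero>\<^bsub>V\<^esub>}. g n)" for g
  have ex: "\<exists>!g. P g"
    using assms(2) \<open>?x \<in> carrier V\<close> by (simp add: graded_module_def P_def)
  have sub: "{n. h n \<noteq> \<zero>\<^bsub>V\<^esub>} \<subseteq> J"
    using assms(5) by auto
  have "?x = (\<Oplus>\<^bsub>V\<^esub>n\<in>{n. h n \<noteq> \<zero>\<^bsub>V\<^esub>}. h n)"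
    using assms(3) sub hc
    by (intro finsum_neutral_superset[OF V.abelian_group_axioms, symmetric]) auto
  then have "P h"
    unfolding P_def using assms(4) finite_subset[OF sub assms(3)] by simp
  with ex have "(THE g. P g) = h"
    by (metis the1_equality)
  then show ?thesis
    unfolding graded_part_def P_def by simp
qed

lemma graded_part_homogeneous:
  assumes "module K V" "graded_module K V G" "x \<in> G m"
  shows "graded_part K V G n x = (if n = m then x else \<zero>\<^bsub>V\<^esub>)"
proof -
  interpret V: module K V by fact
  note Gc = submodule_closed[OF assms(1) graded_module_submodule[OF assms(2)]]
  show ?thesis
    using graded_part_unique[OF assms(1,2), of "{m}" "\<lambda>n. if n = m then x else \<zero>\<^bsub>V\<^esub>" n] Gc assms(3)
    by simp
qed

text \<open>The images of the homogeneous parts of \<open>x\<close> form a homogeneous decomposition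
  of \<open>f x\<close>, and there is only one. Applied to the action of a permutation it lets the
  projections descend to the coinvariants.\<close>

lemma graded_part_map:
  assumes "module K V" "graded_module K V G" "module K W" "graded_module K W H"
    "f \<in> linear_maps K V W" "\<And>n x. x \<in> G n \<Longrightarrow> f x \<in> H n" "x \<in> carrier V"
  shows "graded_part K W H n (f x) = f (graded_part K V G n x)"
proof -
  note e = graded_part_expand[OF assms(2,7)]
  let ?J = "{n. graded_part K V G n x \<noteq> \<zero>\<^bsub>V\<^esub>}"
  have "f x = f (\<Oplus>\<^bsub>V\<^esub>n\<in>?J. graded_part K V G n x)"
    by (simp only: e(3))
  also have "\<dots> = (\<Oplus>\<^bsub>W\<^esub>n\<in>?J. f (graded_part K V G n x))"
    by (rule linear_maps_finsum[OF assms(1,3,5) submodule_closed(1)[OF assms(1) graded_module_submodule[OF assms(2)] e(1)]])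
  also have "graded_part K W H n \<dots> = f (graded_part K V G n x)"
    by (rule graded_part_unique[OF assms(3,4) e(2) assms(6)[OF e(1)]])
       (simp add: linear_maps_zero[OF assms(1,3,5)])
  finally show ?thesis .
qed

lemma graded_part_linear:
  assumes "module K V" "graded_module K V G"
  shows "graded_part K V G n \<in> linear_maps K V V"
proof -
  interpret V: module K V by fact
  let ?p = "graded_part K V G"
  note Gs = graded_module_submodule[OF assms(2)]
  note Gc = submodule_closed[OF assms(1) Gs]
  note e = graded_part_expand[OF assms(2)]
  have pc: "?p n x \<in> carrier V" if "x \<in> carrier V" for n x
    by (rule Gc(1)[OF e(1)[OF that]])
  show ?thesis
  proof (rule linear_mapsI)
    show "?p n x \<in> carrier V" if "x \<in> carrier V" for x
      by (rule pc[OF that])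
    fix x y assume x: "x \<in> carrier V" and y: "y \<in> carrier V"
    let ?J = "{n. ?p n x \<noteq> \<zero>\<^bsub>V\<^esub>} \<union> {n. ?p n y \<noteq> \<zero>\<^bsub>V\<^esub>}"
    have J: "finite ?J"
      using e(2)[OF x] e(2)[OF y] by simp
    have "(\<Oplus>\<^bsub>V\<^esub>n\<in>{n. ?p n x \<noteq> \<zero>\<^bsub>V\<^esub>}. ?p n x) = (\<Oplus>\<^bsub>V\<^esub>n\<in>?J. ?p n x)"
      "(\<Oplus>\<^bsub>V\<^esub>n\<in>{n. ?p n y \<noteq> \<zero>\<^bsub>V\<^esub>}. ?p n y) = (\<Oplus>\<^bsub>V\<^esub>n\<in>?J. ?p n y)"
      using J pc[OF x] pc[OF y] by (intro finsum_neutral_superset[OF V.abelian_group_axioms]; auto)+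
    then have "x \<oplus>\<^bsub>V\<^esub> y = (\<Oplus>\<^bsub>V\<^esub>n\<in>?J. ?p n x) \<oplus>\<^bsub>V\<^esub> (\<Oplus>\<^bsub>V\<^esub>n\<in>?J. ?p n y)"
      unfolding e(3)[OF x] e(3)[OF y] by simp
    also have "\<dots> = (\<Oplus>\<^bsub>V\<^esub>n\<in>?J. ?p n x \<oplus>\<^bsub>V\<^esub> ?p n y)"
      using pc[OF x] pc[OF y] by (intro V.finsum_addf[symmetric]) auto
    finally have "?p n (x \<oplus>\<^bsub>V\<^esub> y) = ?p n (\<Oplus>\<^bsub>V\<^esub>n\<in>?J. ?p n x \<oplus>\<^bsub>V\<^esub> ?p n y)"
      by simp
    also have "\<dots> = ?p n x \<oplus>\<^bsub>V\<^esub> ?p n y"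
      by (rule graded_part_unique[OF assms J]) (use Gc(3) e(1)[OF x] e(1)[OF y] in auto)
    finally show "?p n (x \<oplus>\<^bsub>V\<^esub> y) = ?p n x \<oplus>\<^bsub>V\<^esub> ?p n y" .
  next
    fix c x assume c: "c \<in> carrier K" and x: "x \<in> carrier V"
    \<comment> \<open>Scaling is itself a linear map preserving every homogeneous part, so
      compatibility with scalars is a case of \<open>graded_part_map\<close>.\<close>
    have "(\<lambda>x. c \<odot>\<^bsub>V\<^esub> x) \<in> linear_maps K V V"
      by (rule linear_maps_smult_fun[OF assms(1) linear_maps_id c])
    from graded_part_map[OF assms assms this Gc(4)[OF c] x]
    show "?p n (c \<odot>\<^bsub>V\<^esub> x) = c \<odot>\<^bsub>V\<^esub> ?p n x" .
  qed
qed

lemma graded_module_update [simp]: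
  "graded_module K (V\<lparr>mult := m, one := u\<rparr>) G = graded_module K V G"
proof -
  have "submodule N K (V\<lparr>mult := m, one := u\<rparr>) = submodule N K V" for N
    by (simp add: submodule_def submodule_axioms_def)
  then show ?thesis
    by (simp add: graded_module_def finsum_def)
qed

section \<open>Total degree on tensor products\<close>

lemma tensor_grading_update [simp]:
  "tensor_grading K (V\<lparr>mult := m, one := u\<rparr>) W = tensor_grading K V W"
  "tensor_grading K V (W\<lparr>mult := m', one := u'\<rparr>) = tensor_grading K V W"
  by (simp_all add: tensor_grading_def fun_eq_iff)

lemma tensor_grading_closed:
  assumes "module K V" "module K W" "\<And>i. G i \<subseteq> carrier V" "\<And>j. H j \<subseteq> carrier W"
  shows "{pure_tensor K V W v w | v w i j. v \<in> G i \<and> w \<in> H j \<and> i + j = n} \<subseteq> carrier (tensor K V W)"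
  using assms(3,4) by (auto intro!: pure_tensor_closed[OF assms(1,2)])

lemma submodule_tensor_grading:
  assumes "module K V" "module K W" "\<And>i. G i \<subseteq> carrier V" "\<And>j. H j \<subseteq> carrier W"
  shows "submodule (tensor_grading K V W G H n) K (tensor K V W)"
  unfolding tensor_grading_def
  by (rule submodule_lin_span[OF module_tensor[OF assms(1,2)] tensor_grading_closed[OF assms]])

lemma tensor_map_grading:
  assumes M: "module K V" "module K W" "module K V'" "module K W'"
    and f: "f \<in> linear_maps K V V'" and g: "g \<in> linear_maps K W W'"
    and G: "\<And>i. G i \<subseteq> carrier V" "\<And>j. H j \<subseteq> carrier W" "\<And>i. G' i \<subseteq> carrier V'" "\<And>j. H' j \<subseteq> carrier W'"
    and fG: "\<And>i x. x \<in> G i \<Longrightarrow> f x \<in> G' i" and gH: "\<And>j x. x \<in> H j \<Longrightarrow> g x \<in> H' j"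
    and t: "t \<in> tensor_grading K V W G H n"
  shows "tensor_map K V' W' f g t \<in> tensor_grading K V' W' G' H' n"
proof (rule linear_maps_span[OF module_tensor[OF M(1,2)] module_tensor[OF M(3,4)] tensor_map_linear[OF M f g]
      submodule_tensor_grading[OF M(3,4) G(3,4)] tensor_grading_closed[OF M(1,2) G(1,2)] _ t[unfolded tensor_grading_def]])
  fix s assume "s \<in> {pure_tensor K V W v w | v w i j. v \<in> G i \<and> w \<in> H j \<and> i + j = n}"
  then obtain v w i j where s: "s = pure_tensor K V W v w" and v: "v \<in> G i" and w: "w \<in> H j" and n: "i + j = n"
    by auto
  have vw: "v \<in> carrier V" "w \<in> carrier W"
    using v w G(1,2) by auto
  show "tensor_map K V' W' f g s \<in> tensor_grading K V' W' G' H' n"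
    unfolding s tensor_map_pure[OF M f g vw] tensor_grading_def
    by (rule lin_span_base) (use fG[OF v] gH[OF w] n in blast)
qed

section \<open>The grading of the Fock space\<close>

locale fock_graded = fock_bimonoid K E
  for K :: "('k, 'm) ring_scheme" and E :: "(nat, 'k, 'v, 'z) bimon_species_scheme" +
  fixes G :: "nat set \<Rightarrow> nat \<Rightarrow> 'v set"
  assumes graded: "species_graded K E G"
begin

lemma graded_obj: "finite X \<Longrightarrow> graded_module K (sp_obj E X) (G X)"
  using graded by (simp add: species_graded_def)

lemma graded_obj_n: "graded_module K (obj n) (G {1..n})"
  by (rule graded_obj) simp

lemma map_graded: "finite X \<Longrightarrow> bij_betw \<sigma> X X' \<Longrightarrow> x \<in> G X' n \<Longrightarrow> sp_map E X X' \<sigma> x \<in> G X n"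
  using graded by (simp add: species_graded_def image_subset_iff)

lemma mult_graded:
  "finite X \<Longrightarrow> finite Y \<Longrightarrow> X \<inter> Y = {} \<Longrightarrow> a \<in> G X i \<Longrightarrow> b \<in> G Y j \<Longrightarrow> sp_mult E X Y a b \<in> G (X \<union> Y) (i + j)"
  using graded by (simp add: species_graded_def)

lemma unit_graded: "sp_unit E \<in> G {} 0"
  using graded by (simp add: species_graded_def)

lemma comult_graded:
  "finite X \<Longrightarrow> x \<in> G X n \<Longrightarrow> Z \<subseteq> X \<Longrightarrow>
    sp_comult E X x Z \<in> tensor_grading K (sp_obj E Z) (sp_obj E (X - Z)) (G Z) (G (X - Z)) n"
  using graded by (simp add: species_graded_def)

lemma graded_closed: "finite X \<Longrightarrow> x \<in> G X n \<Longrightarrow> x \<in> carrier (sp_obj E X)"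
  by (rule submodule_closed(1)[OF module_obj graded_module_submodule[OF graded_obj]])

abbreviation "part n j \<equiv> graded_part K (obj n) (G {1..n}) j"

lemma part_linear: "part n j \<in> linear_maps K (obj n) (obj n)"
  by (rule graded_part_linear[OF module_n graded_obj_n])

lemma part_closed: "x \<in> carrier (obj n) \<Longrightarrow> part n j x \<in> carrier (obj n)"
  by (rule linear_maps_closed[OF part_linear])

lemma part_graded: "x \<in> carrier (obj n) \<Longrightarrow> part n j x \<in> G {1..n} j"
  by (rule graded_part_expand(1)[OF graded_obj_n])

lemma part_part:
  assumes "x \<in> carrier (obj n)"
  shows "part n i (part n j x) = (if i = j then part n j x else \<zero>\<^bsub>obj n\<^esub>)"
  by (rule graded_part_homogeneous[OF module_n graded_obj_n part_graded[OF assms]])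

text \<open>The homogeneous projections commute with the action of the symmetric group, so they descend
  to the coinvariants.\<close>

definition "fock_part j = fock_lift K E F (\<lambda>n x. fock_class K E {1..n} (part n j x))"

lemma fock_cone_part: "fock_cone K E F (\<lambda>n x. fock_class K E {1..n} (part n j x))"
proof (rule fock_coneI)
  show "(\<lambda>x. fock_class K E {1..n} (part n j x)) \<in> linear_maps K (obj n) F" for n
    by (rule linear_maps_comp[OF part_linear fock_class_linear]) simp
  fix n \<sigma> v assume v: "v \<in> carrier (obj n)" and \<sigma>: "bij_betw \<sigma> {1..n} {1..n}"
  have "part n j (sp_map E {1..n} {1..n} \<sigma> v) = sp_map E {1..n} {1..n} \<sigma> (part n j v)"
    by (rule graded_part_map[OF module_n graded_obj_n module_n graded_obj_n map_linear[OF _ \<sigma>] map_graded[OF _ \<sigma>] v]) auto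
  then show "fock_class K E {1..n} (part n j (sp_map E {1..n} {1..n} \<sigma> v)) = fock_class K E {1..n} (part n j v)"
    by (simp add: fock_class_natural \<sigma> part_closed v)
qed

lemma fock_part_linear: "fock_part j \<in> linear_maps K F F"
  unfolding fock_part_def by (rule fock_lift_linear[OF module_fock fock_cone_part])

lemma fock_part_class:
  "x \<in> carrier (obj n) \<Longrightarrow> fock_part j (fock_class K E {1..n} x) = fock_class K E {1..n} (part n j x)"
  unfolding fock_part_def by (rule fock_lift_class[OF module_fock fock_cone_part])

lemma fock_component_linear: "(\<lambda>f. f n) \<in> linear_maps K F (coinvariants K E n)"
  unfolding fock_def by (rule direct_sum_component_linear) simp

lemma fock_class_component:
  "x \<in> carrier (obj m) \<Longrightarrow> fock_class K E {1..m} x n = (if n = m then coset m x else \<zero>\<^bsub>coinvariants K E n\<^esub>)"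
  by (simp add: fock_class_n ds_inj_component)

text \<open>Links the projection, known so far only on classes, with representatives of the
  components of an arbitrary element, in terms of which \<open>fock_grading\<close> is
  stated.\<close>

lemma fock_part_component:
  assumes f: "f \<in> carrier F" and x: "x \<in> carrier (obj n)" "f n = coset n x"
  shows "fock_part j f n = coset n (part n j x)"
proof -
  let ?C = "coinvariants K E n"
  let ?h = "\<lambda>x. coset n (part n j x)"
  have h: "?h \<in> linear_maps K (obj n) ?C"
    by (rule linear_maps_comp[OF part_linear coset_n_linear])
  have ker: "?h v = \<zero>\<^bsub>?C\<^esub>" if "v \<in> coinv_rel K E n" for v
  proof -
    have v: "v \<in> carrier (obj n)"
      by (rule submodule_closed(1)[OF module_n submodule_coinv_rel that])
    \<comment> \<open>That the projection maps relations to relations is obtained from the Fock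
      space: the class of \<open>part n j v\<close> vanishes there, and reading its component at
      \<open>n\<close> shows that \<open>part n j v\<close> lies in the trivial coset.\<close>
    have "fock_class K E {1..n} (part n j v) = \<zero>\<^bsub>F\<^esub>"
      by (rule fock_cone_ker[OF module_fock fock_cone_part that])
    then have "fock_class K E {1..n} (part n j v) n = \<zero>\<^bsub>F\<^esub> n"
      by simp
    then show ?thesis
      by (simp add: fock_class_component part_closed v fock_def direct_sum_simps)
  qed
  let ?q = "\<lambda>A. the_elem (?h ` A)"
  have q: "?q \<in> linear_maps K ?C ?C"
    unfolding coinvariants_def
    by (rule quotient_lift_linear[OF module_n _ submodule_coinv_rel h[unfolded coinvariants_def] ker[unfolded coinvariants_def]])
       (rule module_coinvariants[unfolded coinvariants_def])
  have q_coset: "?q (coset n y) = ?h y" if "y \<in> carrier (obj n)" for y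
    by (rule quotient_lift_eq[OF module_n module_coinvariants submodule_coinv_rel h ker that])
  \<comment> \<open>Both sides are linear in \<open>f\<close>. On a class of another degree both are
    zero; on a class of degree \<open>n\<close> they agree by construction.\<close>
  have "fock_part j f n = ?q (f n)"
  proof (rule fock_eqI[OF module_coinvariants linear_maps_comp[OF fock_part_linear fock_component_linear]
        linear_maps_comp[OF fock_component_linear q] _ f])
    fix m y assume y: "y \<in> carrier (obj m)"
    show "fock_part j (fock_class K E {1..m} y) n = ?q (fock_class K E {1..m} y n)"
    proof (cases "m = n")
      case True
      then show ?thesis
        using y by (simp add: fock_part_class fock_class_component part_closed q_coset)
    next
      case False
      then show ?thesis
        using y linear_maps_zero[OF module_coinvariants module_coinvariants q]
        by (simp add: fock_part_class fock_class_component part_closed)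
    qed
  qed
  with x q_coset show ?thesis by simp
qed

text \<open>A homogeneous representative is fixed by \<open>part\<close>, and conversely
  \<open>part\<close> makes any representative homogeneous. Thus homogeneity becomes a linear
  condition, from which the submodule laws are immediate.\<close>

lemma fock_grading_iff: "f \<in> fock_grading K E G j \<longleftrightarrow> f \<in> carrier F \<and> fock_part j f = f"
proof
  assume f: "f \<in> fock_grading K E G j"
  then have fF: "f \<in> carrier F" by (simp add: fock_grading_def)
  have "fock_part j f n = f n" for n
  proof -
    obtain x where x: "x \<in> G {1..n} j" "f n = coset n x"
      using f by (auto simp: fock_grading_def)
    have "part n j x = x"
      using graded_part_homogeneous[OF module_n graded_obj_n x(1)] by simp
    then show ?thesis
      using fock_part_component[OF fF graded_closed[OF _ x(1)] x(2)] x(2) by simp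
  qed
  with fF show "f \<in> carrier F \<and> fock_part j f = f" by (simp add: fun_eq_iff)
next
  assume f: "f \<in> carrier F \<and> fock_part j f = f"
  have "\<exists>x\<in>G {1..n} j. f n = coset n x" for n
  proof -
    obtain x where x: "x \<in> carrier (obj n)" "f n = coset n x"
      using fock_component f by blast
    have "f n = coset n (part n j x)"
      using fock_part_component[of f x n j] x f by simp
    with part_graded[OF x(1)] show ?thesis by blast
  qed
  with f show "f \<in> fock_grading K E G j" by (simp add: fock_grading_def)
qed

text \<open>The projections are orthogonal idempotents on the species, and by linearity this is
  inherited from the classes.\<close>

lemma fock_part_fock_part:
  assumes "f \<in> carrier F"
  shows "fock_part i (fock_part j f) = (if i = j then fock_part j f else \<zero>\<^bsub>F\<^esub>)"
proof -
  have "(\<lambda>f. if i = j then fock_part j f else \<zero>\<^bsub>F\<^esub>) \<in> linear_maps K F F"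
    using fock_part_linear linear_maps_const_zero[OF module_fock] by (cases "i = j") auto
  from fock_eqI[OF module_fock linear_maps_comp[OF fock_part_linear fock_part_linear] this _ assms]
  show ?thesis
    by (simp add: fock_part_class part_closed part_part linear_maps_zero[OF module_n module_fock fock_class_linear])
qed

lemma fock_class_graded:
  assumes "finite X" "x \<in> G X j"
  shows "fock_class K E X x \<in> fock_grading K E G j"
proof -
  let ?n = "card X"
  note xc = graded_closed[OF assms]
  obtain y where y: "y \<in> carrier (obj ?n)" "fock_class K E X x = fock_class K E {1..?n} y"
    "y = sp_map E {1..?n} X (\<lambda>i. sorted_list_of_set X ! (i - 1)) x"
    by (rule fock_class_to_n[OF assms(1) xc])
  have "y \<in> G {1..?n} j"
    unfolding y(3) by (rule map_graded[OF _ bij_betw_sorted_list_nth[OF assms(1)] assms(2)]) simp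
  then have "part ?n j y = y"
    using graded_part_homogeneous[OF module_n graded_obj_n] by simp
  then show ?thesis
    using y(1) by (simp add: fock_grading_iff y(2) fock_part_class fock_class_closed)
qed

lemma submodule_fock_grading: "submodule (fock_grading K E G j) K F"
proof -
  interpret F: module K F by (rule module_fock)
  note lin = fock_part_linear[of j]
  show ?thesis
    by (rule F.submoduleI)
       (auto simp: fock_grading_iff linear_maps_zero[OF module_fock module_fock lin]
         linear_maps_a_inv[OF module_fock module_fock lin] linear_maps_add[OF lin] linear_maps_smult[OF lin])
qed

lemma fock_grading_closed: "fock_grading K E G j \<subseteq> carrier F"
  by (auto simp: fock_grading_iff)

abbreviation "graded_classes j \<equiv> (\<Union>n. fock_class K E {1..n} ` G {1..n} j)"

lemma graded_classes_closed: "graded_classes j \<subseteq> carrier F"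
  by (auto intro!: fock_class_closed graded_closed)

text \<open>A homogeneous \<open>f\<close> equals its own projection. It is also a combination of
  classes, and the projection turns each of them into the class of a homogeneous element.\<close>

lemma fock_grading_span:
  assumes "f \<in> fock_grading K E G j"
  shows "f \<in> lin_span K F (graded_classes j)"
proof -
  have f: "f \<in> carrier F" "fock_part j f = f"
    using assms by (auto simp: fock_grading_iff)
  have "fock_part j f \<in> lin_span K F (graded_classes j)"
  proof (rule linear_maps_span[OF module_fock module_fock fock_part_linear
        submodule_lin_span[OF module_fock graded_classes_closed]])
    show "(\<Union>n. fock_class K E {1..n} ` carrier (obj n)) \<subseteq> carrier F"
      by (auto intro!: fock_class_closed)
    show "f \<in> lin_span K F (\<Union>n. fock_class K E {1..n} ` carrier (obj n))"
      using f(1) spans_fock by (auto simp: spans_def)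
    fix s assume "s \<in> (\<Union>n. fock_class K E {1..n} ` carrier (obj n))"
    then obtain n x where s: "s = fock_class K E {1..n} x" and x: "x \<in> carrier (obj n)"
      by auto
    show "fock_part j s \<in> lin_span K F (graded_classes j)"
      unfolding s fock_part_class[OF x]
      by (rule lin_span_base) (use part_graded[OF x] in auto)
  qed
  with f(2) show ?thesis by simp
qed

lemma graded_module_fock: "graded_module K F (fock_grading K E G)"
proof (rule graded_moduleI[OF module_fock submodule_fock_grading fock_part_linear])
  show "fock_part n f = (if n = m then f else \<zero>\<^bsub>F\<^esub>)" if "f \<in> fock_grading K E G m" for n m f
    using that fock_part_fock_part[of f n m] by (auto simp: fock_grading_iff)
  have sub: "(\<Union>n. fock_grading K E G n) \<subseteq> carrier F"
    using fock_grading_closed by auto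
  note N = submodule_lin_span[OF module_fock sub]
  have "fock_class K E {1..n} x \<in> lin_span K F (\<Union>n. fock_grading K E G n)" if x: "x \<in> carrier (obj n)" for n x
  proof -
    \<comment> \<open>The class of \<open>x\<close> is the sum of the classes of the finitely many
      nonzero homogeneous parts of \<open>x\<close>.\<close>
    let ?J = "{j. part n j x \<noteq> \<zero>\<^bsub>obj n\<^esub>}"
    have "fock_class K E {1..n} x = fock_class K E {1..n} (\<Oplus>\<^bsub>obj n\<^esub>j\<in>?J. part n j x)"
      by (simp only: graded_part_expand(3)[OF graded_obj_n x])
    also have "\<dots> = (\<Oplus>\<^bsub>F\<^esub>j\<in>?J. fock_class K E {1..n} (part n j x))"
      by (rule linear_maps_finsum[OF module_n module_fock fock_class_linear part_closed[OF x]]) simp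
    also have "\<dots> \<in> lin_span K F (\<Union>n. fock_grading K E G n)"
      using part_graded[OF x]
      by (intro submodule_finsum_closed[OF module_fock N] lin_span_base UN_I[OF UNIV_I] fock_class_graded) auto
    finally show ?thesis .
  qed
  then show "spans K F (\<Union>n. fock_grading K E G n)"
    by (intro spans_trans[OF module_fock spans_fock sub]) auto
qed

lemma fock_mult_graded:
  assumes f: "f \<in> fock_grading K E G i" and g: "g \<in> fock_grading K E G j"
  shows "fock_mult K E f g \<in> fock_grading K E G (i + j)"
proof -
  have base: "fock_mult K E (fock_class K E {1..k} a) (fock_class K E {1..l} b) \<in> fock_grading K E G (i + j)"
    if a: "a \<in> G {1..k} i" and b: "b \<in> G {1..l} j" for k a l b
  proof -
    let ?Y = "{k + 1..k + l}" and ?b = "sp_map E {k + 1..k + l} {1..l} (\<lambda>i. i - k) b"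
    have b': "?b \<in> G ?Y j"
      by (rule map_graded[OF _ bij_betw_shift b]) simp
    have "fock_class K E {1..l} b = fock_class K E ?Y ?b"
      using fock_class_natural[OF _ bij_betw_shift graded_closed[OF _ b]] by simp
    moreover have "fock_mult K E (fock_class K E {1..k} a) (fock_class K E ?Y ?b) =
        fock_class K E ({1..k} \<union> ?Y) (sp_mult E {1..k} ?Y a ?b)"
      by (rule fock_mult_class) (use graded_closed[OF _ a] graded_closed[OF _ b'] in auto)
    moreover have "fock_class K E ({1..k} \<union> ?Y) (sp_mult E {1..k} ?Y a ?b) \<in> fock_grading K E G (i + j)"
      by (rule fock_class_graded[OF _ mult_graded[OF _ _ _ a b']]) auto
    ultimately show ?thesis by simp
  qed
  note R = bilinear_maps_right[OF fock_mult_bilinear] and L = bilinear_maps_left[OF fock_mult_bilinear]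
  note span = linear_maps_span[OF module_fock module_fock _ submodule_fock_grading graded_classes_closed _ fock_grading_span]
  have gF: "g \<in> carrier F" using g fock_grading_closed by auto
  show ?thesis
  proof (rule span[OF L[OF gF] _ f])
    fix s assume "s \<in> graded_classes i"
    then obtain k a where s: "s = fock_class K E {1..k} a" and a: "a \<in> G {1..k} i"
      by auto
    have sF: "s \<in> carrier F"
      using s graded_closed[OF _ a] by (simp add: fock_class_closed)
    show "fock_mult K E s g \<in> fock_grading K E G (i + j)"
      by (rule span[OF R[OF sF] _ g]) (auto simp: s intro!: base a)
  qed
qed

lemma fock_comult_graded:
  assumes f: "f \<in> fock_grading K E G n"
  shows "fock_comult K E f \<in> tensor_grading K F F (fock_grading K E G) (fock_grading K E G) n"
proof -
  note N = submodule_tensor_grading[OF module_fock module_fock fock_grading_closed fock_grading_closed]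
  show ?thesis
  proof (rule linear_maps_span[OF module_fock module_FF fock_comult_linear N graded_classes_closed _ fock_grading_span[OF f]])
    fix s assume "s \<in> graded_classes n"
    then obtain m x where s: "s = fock_class K E {1..m} x" and x: "x \<in> G {1..m} n"
      by auto
    let ?X = "{1..m}"
    have X: "finite ?X" by simp
    have "class2 Z (?X - Z) (sp_comult E ?X x Z) \<in> tensor_grading K F F (fock_grading K E G) (fock_grading K E G) n"
      if "Z \<in> Pow ?X" for Z
    proof -
      have Z: "Z \<subseteq> ?X" using that by simp
      have fin: "finite Z" "finite (?X - Z)" using finite_subset[OF Z] by auto
      show ?thesis
        by (rule tensor_map_grading[OF module_obj[OF fin(1)] module_obj[OF fin(2)] module_fock module_fock
            fock_class_linear[OF fin(1)] fock_class_linear[OF fin(2)] _ _ fock_grading_closed fock_grading_closed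
            fock_class_graded[OF fin(1)] fock_class_graded[OF fin(2)] comult_graded[OF X x Z]])
           (use graded_closed fin in auto)
    qed
    then have "class_comult ?X x \<in> tensor_grading K F F (fock_grading K E G) (fock_grading K E G) n"
      unfolding class_comult_def by (rule submodule_finsum_closed[OF module_FF N])
    then show "fock_comult K E s \<in> tensor_grading K F F (fock_grading K E G) (fock_grading K E G) n"
      unfolding s fock_comult_class[OF X graded_closed[OF X x]] .
  qed
qed

lemma bialgebra_graded_fock: "bialgebra_graded K A (fock_comult K E) (fock_grading K E G)"
proof -
  have "fock_class K E {} (sp_unit E) \<in> fock_grading K E G 0"
    by (rule fock_class_graded[OF _ unit_graded]) simp
  then show ?thesis
    using graded_module_fock fock_mult_graded fock_comult_graded
    by (simp add: bialgebra_graded_def fock_algebra_def)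
qed

end

section \<open>Topologies with a marked open set\<close>

text \<open>Intersecting with a fixed set commutes with unions and with binary intersections, so the
  defining predicate satisfies the axioms of a topology and can be unfolded.\<close>

lemma openin_topology_disjoint_union:
  "openin (topology_disjoint_union T1 T2) S \<longleftrightarrow> S \<subseteq> topspace T1 \<union> topspace T2 \<and>
    openin T1 (S \<inter> topspace T1) \<and> openin T2 (S \<inter> topspace T2)"
proof -
  have "istopology (\<lambda>S. S \<subseteq> topspace T1 \<union> topspace T2 \<and>
      openin T1 (S \<inter> topspace T1) \<and> openin T2 (S \<inter> topspace T2))"
    unfolding istopology_def
  proof (intro conjI allI impI)
    fix S S' assume S: "S \<subseteq> topspace T1 \<union> topspace T2 \<and> openin T1 (S \<inter> topspace T1) \<and> openin T2 (S \<inter> topspace T2)"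
      and S': "S' \<subseteq> topspace T1 \<union> topspace T2 \<and> openin T1 (S' \<inter> topspace T1) \<and> openin T2 (S' \<inter> topspace T2)"
    have eq: "S \<inter> S' \<inter> A = (S \<inter> A) \<inter> (S' \<inter> A)" for A by auto
    show "S \<inter> S' \<subseteq> topspace T1 \<union> topspace T2" "openin T1 (S \<inter> S' \<inter> topspace T1)" "openin T2 (S \<inter> S' \<inter> topspace T2)"
      using S S' unfolding eq by auto
  next
    fix \<S> assume \<S>: "\<forall>S\<in>\<S>. S \<subseteq> topspace T1 \<union> topspace T2 \<and>
      openin T1 (S \<inter> topspace T1) \<and> openin T2 (S \<inter> topspace T2)"
    have eq: "\<Union>\<S> \<inter> A = (\<Union>S\<in>\<S>. S \<inter> A)" for A by auto
    show "\<Union>\<S> \<subseteq> topspace T1 \<union> topspace T2"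
      using \<S> by blast
    show "openin T1 (\<Union>\<S> \<inter> topspace T1)" "openin T2 (\<Union>\<S> \<inter> topspace T2)"
      unfolding eq using \<S> by (intro openin_Union; blast)+
  qed
  then show ?thesis
    unfolding topology_disjoint_union_def by simp
qed

lemma topspace_topology_disjoint_union [simp]:
  "topspace (topology_disjoint_union T1 T2) = topspace T1 \<union> topspace T2"
proof
  show "topspace (topology_disjoint_union T1 T2) \<subseteq> topspace T1 \<union> topspace T2"
    using openin_topspace[of "topology_disjoint_union T1 T2"]
    unfolding openin_topology_disjoint_union by blast
  have "openin (topology_disjoint_union T1 T2) (topspace T1 \<union> topspace T2)"
    using openin_topspace[of T1] openin_topspace[of T2]
    by (simp add: openin_topology_disjoint_union Int_absorb1)
  then show "topspace T1 \<union> topspace T2 \<subseteq> topspace (topology_disjoint_union T1 T2)"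
    by (rule openin_subset)
qed

lemma topology_disjoint_union_commute: "topology_disjoint_union T1 T2 = topology_disjoint_union T2 T1"
  by (auto simp: topology_eq openin_topology_disjoint_union)

lemma topology_disjoint_union_assoc:
  "topology_disjoint_union (topology_disjoint_union T1 T2) T3 =
    topology_disjoint_union T1 (topology_disjoint_union T2 T3)"
proof -
  have eq: "S \<inter> (A \<union> B) \<inter> A = S \<inter> A" "S \<inter> (A \<union> B) \<inter> B = S \<inter> B" for S A B :: "'a set"
    by auto
  show ?thesis
    by (auto simp: topology_eq openin_topology_disjoint_union eq)
qed

lemma topology_disjoint_union_empty: "topology_disjoint_union (discrete_topology {}) T = T"
proof -
  have "openin T (S \<inter> topspace T) \<longleftrightarrow> openin T S" if "S \<subseteq> topspace T" for S
    using that by (simp add: Int_absorb2)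
  then show ?thesis
    using openin_subset by (auto simp: topology_eq openin_topology_disjoint_union)
qed

text \<open>The set \<open>A\<close> is cut down to each ground set on the right because the
  compatibility of product and coproduct restricts the factors to the traces
  \<open>Z \<inter> X\<close> and \<open>Z \<inter> Y\<close>.\<close>

lemma subtopology_disjoint_union:
  assumes "topspace T1 \<inter> topspace T2 = {}"
  shows "subtopology (topology_disjoint_union T1 T2) A =
    topology_disjoint_union (subtopology T1 (A \<inter> topspace T1)) (subtopology T2 (A \<inter> topspace T2))"
  unfolding topology_eq
proof
  fix S
  show "openin (subtopology (topology_disjoint_union T1 T2) A) S \<longleftrightarrow>
    openin (topology_disjoint_union (subtopology T1 (A \<inter> topspace T1)) (subtopology T2 (A \<inter> topspace T2))) S"
    (is "?l = ?r")
  proof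
    assume ?l
    then obtain U where U: "U \<subseteq> topspace T1 \<union> topspace T2" "openin T1 (U \<inter> topspace T1)" "openin T2 (U \<inter> topspace T2)"
      and S: "S = U \<inter> A"
      by (auto simp: openin_subtopology openin_topology_disjoint_union)
    have "S \<inter> (topspace T1 \<inter> (A \<inter> topspace T1)) = (U \<inter> topspace T1) \<inter> (A \<inter> topspace T1)"
      "S \<inter> (topspace T2 \<inter> (A \<inter> topspace T2)) = (U \<inter> topspace T2) \<inter> (A \<inter> topspace T2)"
      using S by auto
    then show ?r
      using U S unfolding openin_topology_disjoint_union topspace_subtopology openin_subtopology
      by auto
  next
    assume r: ?r
    then obtain U1 U2 where U: "openin T1 U1" "openin T2 U2"
      and S1: "S \<inter> (topspace T1 \<inter> (A \<inter> topspace T1)) = U1 \<inter> (A \<inter> topspace T1)"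
      and S2: "S \<inter> (topspace T2 \<inter> (A \<inter> topspace T2)) = U2 \<inter> (A \<inter> topspace T2)"
      and S: "S \<subseteq> topspace T1 \<inter> (A \<inter> topspace T1) \<union> topspace T2 \<inter> (A \<inter> topspace T2)"
      unfolding openin_topology_disjoint_union topspace_subtopology openin_subtopology by auto
    note sub = openin_subset[OF U(1)] openin_subset[OF U(2)]
    \<comment> \<open>The witness for openness is the union of the two given open sets. By
      disjointness of the ground sets each of them is the trace of that union.\<close>
    have "(U1 \<union> U2) \<inter> topspace T1 = U1" "(U1 \<union> U2) \<inter> topspace T2 = U2"
      using sub assms by auto
    then have "openin (topology_disjoint_union T1 T2) (U1 \<union> U2)"
      using U sub by (auto simp: openin_topology_disjoint_union)
    moreover have "S = (U1 \<union> U2) \<inter> A"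
      using S S1 S2 sub by blast
    ultimately show ?l
      by (auto simp: openin_subtopology)
  qed
qed

text \<open>Open sets of a pullback are given as preimages; a bijection allows the original open set
  to be recovered as an image. In terms of images, composites of relabellings and disjoint unions
  can be compared directly.\<close>

lemma openin_pullback_bij:
  assumes "bij_betw \<sigma> X (topspace T)"
  shows "openin (pullback_topology X \<sigma> T) S \<longleftrightarrow> S \<subseteq> X \<and> openin T (\<sigma> ` S)"
proof
  assume "openin (pullback_topology X \<sigma> T) S"
  then obtain U where U: "openin T U" "S = \<sigma> -` U \<inter> X"
    by (auto simp: openin_pullback_topology)
  have "\<sigma> ` (\<sigma> -` U \<inter> X) = U \<inter> \<sigma> ` X"
    by auto
  then have "\<sigma> ` S = U"
    using U openin_subset[OF U(1)] bij_betw_imp_surj_on[OF assms] by auto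
  with U show "S \<subseteq> X \<and> openin T (\<sigma> ` S)" by auto
next
  assume S: "S \<subseteq> X \<and> openin T (\<sigma> ` S)"
  then have "S = \<sigma> -` (\<sigma> ` S) \<inter> X"
    using bij_betw_imp_inj_on[OF assms] by (auto simp: inj_on_def)
  with S show "openin (pullback_topology X \<sigma> T) S"
    by (auto simp: openin_pullback_topology)
qed

lemma topspace_pullback_bij: "bij_betw \<sigma> X (topspace T) \<Longrightarrow> topspace (pullback_topology X \<sigma> T) = X"
  by (auto simp: topspace_pullback_topology bij_betw_apply)

lemma pullback_topology_cong:
  "(\<And>i. i \<in> X \<Longrightarrow> \<sigma> i = \<tau> i) \<Longrightarrow> pullback_topology X \<sigma> T = pullback_topology X \<tau> T"
proof -
  assume "\<And>i. i \<in> X \<Longrightarrow> \<sigma> i = \<tau> i"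
  then have "\<sigma> -` U \<inter> X = \<tau> -` U \<inter> X" for U by auto
  then show ?thesis by (simp add: topology_eq openin_pullback_topology)
qed

lemma pullback_topology_id: "topspace T = X \<Longrightarrow> pullback_topology X id T = T"
  using openin_pullback_bij[of id X T] openin_subset[of T] by (auto simp: topology_eq)

lemma pullback_topology_comp:
  assumes "bij_betw \<sigma> X X'" "bij_betw \<tau> X' (topspace T)"
  shows "pullback_topology X \<sigma> (pullback_topology X' \<tau> T) = pullback_topology X (\<tau> \<circ> \<sigma>) T"
proof -
  have "openin (pullback_topology X \<sigma> (pullback_topology X' \<tau> T)) S \<longleftrightarrow>
      openin (pullback_topology X (\<tau> \<circ> \<sigma>) T) S" for S
  proof -
    have "\<sigma> ` S \<subseteq> X'" if "S \<subseteq> X"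
      using that bij_betw_imp_surj_on[OF assms(1)] by auto
    then show ?thesis
      using assms
      by (auto simp: openin_pullback_bij topspace_pullback_bij openin_pullback_bij[OF bij_betw_trans[OF assms]] image_comp)
  qed
  then show ?thesis by (simp add: topology_eq)
qed

lemma pullback_topology_disjoint_union:
  assumes \<sigma>: "bij_betw \<sigma> X (topspace T1)" "bij_betw \<sigma> Y (topspace T2)" and "X \<inter> Y = {}" "topspace T1 \<inter> topspace T2 = {}"
  shows "pullback_topology (X \<union> Y) \<sigma> (topology_disjoint_union T1 T2) =
    topology_disjoint_union (pullback_topology X \<sigma> T1) (pullback_topology Y \<sigma> T2)"
proof -
  have XY: "bij_betw \<sigma> (X \<union> Y) (topspace (topology_disjoint_union T1 T2))"
    using bij_betw_combine[OF \<sigma> assms(4)] by simp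
  have eq: "\<sigma> ` S \<inter> topspace T1 = \<sigma> ` (S \<inter> X)" "\<sigma> ` S \<inter> topspace T2 = \<sigma> ` (S \<inter> Y)" "\<sigma> ` S \<subseteq> topspace T1 \<union> topspace T2"
    if "S \<subseteq> X \<union> Y" for S
    using that assms(4) bij_betw_apply[OF \<sigma>(1)] bij_betw_apply[OF \<sigma>(2)] by blast+
  show ?thesis
    unfolding topology_eq openin_pullback_bij[OF XY] openin_topology_disjoint_union topspace_pullback_bij[OF \<sigma>(1)]
      topspace_pullback_bij[OF \<sigma>(2)] openin_pullback_bij[OF \<sigma>(1)] openin_pullback_bij[OF \<sigma>(2)]
  proof
    fix S
    show "(S \<subseteq> X \<union> Y \<and> \<sigma> ` S \<subseteq> topspace T1 \<union> topspace T2 \<and>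
        openin T1 (\<sigma> ` S \<inter> topspace T1) \<and> openin T2 (\<sigma> ` S \<inter> topspace T2)) =
      (S \<subseteq> X \<union> Y \<and> (S \<inter> X \<subseteq> X \<and> openin T1 (\<sigma> ` (S \<inter> X))) \<and> S \<inter> Y \<subseteq> Y \<and> openin T2 (\<sigma> ` (S \<inter> Y)))"
      using eq[of S] by (cases "S \<subseteq> X \<union> Y") simp_all
  qed
qed

lemma subtopology_pullback:
  assumes "bij_betw \<sigma> X (topspace T)" "A \<subseteq> X"
  shows "subtopology (pullback_topology X \<sigma> T) A = pullback_topology A \<sigma> (subtopology T (\<sigma> ` A))"
  unfolding topology_eq
proof
  fix S
  have inj: "inj_on \<sigma> X"
    by (rule bij_betw_imp_inj_on[OF assms(1)])
  have sub: "\<sigma> ` A \<subseteq> topspace T"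
    using assms(2) bij_betw_imp_surj_on[OF assms(1)] by auto
  have \<sigma>: "bij_betw \<sigma> A (topspace (subtopology T (\<sigma> ` A)))"
    using bij_betw_subset[OF assms(1,2) refl] sub by (simp add: Int_absorb1)
  show "openin (subtopology (pullback_topology X \<sigma> T) A) S \<longleftrightarrow> openin (pullback_topology A \<sigma> (subtopology T (\<sigma> ` A))) S"
    unfolding openin_pullback_bij[OF \<sigma>]
  proof
    assume "openin (subtopology (pullback_topology X \<sigma> T) A) S"
    then obtain U where U: "U \<subseteq> X" "openin T (\<sigma> ` U)" "S = U \<inter> A"
      by (auto simp: openin_subtopology openin_pullback_bij[OF assms(1)])
    moreover have "\<sigma> ` (U \<inter> A) = \<sigma> ` U \<inter> \<sigma> ` A"
      by (rule inj_on_image_Int[OF inj U(1) assms(2)])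
    ultimately show "S \<subseteq> A \<and> openin (subtopology T (\<sigma> ` A)) (\<sigma> ` S)"
      by (auto simp: openin_subtopology)
  next
    assume "S \<subseteq> A \<and> openin (subtopology T (\<sigma> ` A)) (\<sigma> ` S)"
    then obtain U where S: "S \<subseteq> A" and U: "openin T U" "\<sigma> ` S = U \<inter> \<sigma> ` A"
      by (auto simp: openin_subtopology)
    have "openin (pullback_topology X \<sigma> T) (\<sigma> -` U \<inter> X)"
      using U(1) by (auto simp: openin_pullback_topology)
    moreover have "S = (\<sigma> -` U \<inter> X) \<inter> A"
    proof
      show "S \<subseteq> (\<sigma> -` U \<inter> X) \<inter> A"
        using S U(2) assms(2) by auto
      show "(\<sigma> -` U \<inter> X) \<inter> A \<subseteq> S"
      proof
        fix i assume i: "i \<in> (\<sigma> -` U \<inter> X) \<inter> A"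
        then have "\<sigma> i \<in> \<sigma> ` S" using U(2) by auto
        with i S assms(2) inj show "i \<in> S" by (auto simp: inj_on_def)
      qed
    qed
    ultimately show "openin (subtopology (pullback_topology X \<sigma> T) A) S"
      by (auto simp: openin_subtopology)
  qed
qed

section \<open>Marked topologies as a basis\<close>

lemma mem_marked_topologies [simp]: "(T, Y) \<in> marked_topologies X \<longleftrightarrow> topspace T = X \<and> openin T Y"
  by (simp add: marked_topologies_def)

lemma marked_topologiesE:
  assumes "s \<in> basis_vec K ` marked_topologies X"
  obtains T Y where "s = basis_vec K (T, Y)" "topspace T = X" "openin T Y"
  using assms by (auto simp: marked_topologies_def)

text \<open>Linearity in the second variable is not visible, as \<open>b\<close> occurs inside the
  function being extended. It is tested on basis vectors of the first module, where the outer
  extension reduces to evaluation.\<close>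

lemma lin_ext_bilinear:
  assumes "module K V" "\<And>x y. x \<in> B \<Longrightarrow> y \<in> C \<Longrightarrow> \<phi> x y \<in> carrier V"
  shows "(\<lambda>a b. lin_ext K V (\<lambda>x. lin_ext K V (\<phi> x) b) a)
    \<in> bilinear_maps K (free_module K B) (free_module K C) V"
proof (rule bilinear_mapsI_linear)
  note K = module_cring[OF assms(1)]
  have inner: "lin_ext K V (\<phi> x) \<in> linear_maps K (free_module K C) V" if "x \<in> B" for x
    using that by (intro lin_ext_linear[OF assms(1)] Pi_I assms(2))
  have outer: "lin_ext K V (\<lambda>x. lin_ext K V (\<phi> x) b) \<in> linear_maps K (free_module K B) V"
    if "b \<in> carrier (free_module K C)" for b
    by (rule lin_ext_linear[OF assms(1)]) (use linear_maps_closed[OF inner that] in auto)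
  then show "(\<lambda>a. lin_ext K V (\<lambda>x. lin_ext K V (\<phi> x) b) a) \<in> linear_maps K (free_module K B) V"
    if "b \<in> carrier (free_module K C)" for b
    using that .
  fix a assume a: "a \<in> carrier (free_module K B)"
  show "(\<lambda>b. lin_ext K V (\<lambda>x. lin_ext K V (\<phi> x) b) a) \<in> linear_maps K (free_module K C) V"
  proof (rule linear_maps_param[OF module_free_module[OF K] module_free_module[OF K] assms(1)
        spans_free_module[OF K] outer _ a])
    fix s assume "s \<in> basis_vec K ` B"
    then obtain x where s: "s = basis_vec K x" and x: "x \<in> B" by auto
    show "(\<lambda>b. lin_ext K V (\<lambda>x. lin_ext K V (\<phi> x) b) s) \<in> linear_maps K (free_module K C) V"
      by (rule linear_maps_cong[OF module_free_module[OF K] inner[OF x]])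
         (simp add: s lin_ext_basis_vec[OF assms(1)] linear_maps_closed[OF inner[OF x]])
  qed
qed

text \<open>Only \<open>K\<close> is fixed, so the ground type stays polymorphic. One interpretation
  then serves the species over an arbitrary type and also the one over the naturals to which the
  Fock functor is applied.\<close>

locale DD_species =
  fixes K :: "('k, 'm) ring_scheme"
  assumes cring_K: "cring K"
begin

abbreviation "M X \<equiv> free_module K (marked_topologies X)"
abbreviation "e T Y \<equiv> basis_vec K (T, Y)"
abbreviation "relabel X X' \<sigma> \<equiv> sp_map (DD K) X X' \<sigma>"

lemma module_M: "module K (M X)"
  by (rule module_free_module[OF cring_K])

lemma spans_M: "spans K (M X) (basis_vec K ` marked_topologies X)"
  by (rule spans_free_module[OF cring_K])

lemma e_closed: "topspace T = X \<Longrightarrow> openin T Y \<Longrightarrow> e T Y \<in> carrier (M X)"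
  by (rule basis_vec_closed[OF cring_K]) simp

lemma M_eqI:
  assumes "module K W" "f \<in> linear_maps K (M X) W" "g \<in> linear_maps K (M X) W"
    "\<And>T Y. topspace T = X \<Longrightarrow> openin T Y \<Longrightarrow> f (e T Y) = g (e T Y)" "x \<in> carrier (M X)"
  shows "f x = g x"
  by (rule linear_maps_eqI[OF module_M assms(1-3) spans_M _ assms(5)])
     (use assms(4) in \<open>auto elim: marked_topologiesE\<close>)

lemma sp_obj_DD [simp]: "sp_obj (DD K) X = M X"
  by (simp add: DD_def DD_base_def)

lemma map_eq: "relabel X X' \<sigma> = lin_ext K (M X) (\<lambda>p. e (pullback_topology X \<sigma> (fst p)) (\<sigma> -` snd p \<inter> X))"
  by (simp add: DD_def DD_base_def case_prod_beta')

lemma pullback_marked: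
  assumes "bij_betw \<sigma> X (topspace T)" "openin T Y"
  shows "openin (pullback_topology X \<sigma> T) (\<sigma> -` Y \<inter> X)"
  using assms by (auto simp: openin_pullback_topology)

lemma map_linear:
  assumes "bij_betw \<sigma> X X'"
  shows "relabel X X' \<sigma> \<in> linear_maps K (M X') (M X)"
  unfolding map_eq
proof (rule lin_ext_linear[OF module_M], rule Pi_I)
  fix p assume "p \<in> marked_topologies X'"
  then have p: "topspace (fst p) = X'" "openin (fst p) (snd p)"
    by (cases p; simp)+
  then show "e (pullback_topology X \<sigma> (fst p)) (\<sigma> -` snd p \<inter> X) \<in> carrier (M X)"
    using assms by (intro e_closed pullback_marked topspace_pullback_bij) simp_all
qed

lemma map_e:
  assumes "bij_betw \<sigma> X (topspace T)" "openin T Y"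
  shows "relabel X (topspace T) \<sigma> (e T Y) = e (pullback_topology X \<sigma> T) (\<sigma> -` Y \<inter> X)"
  unfolding map_eq
  using e_closed[OF topspace_pullback_bij[OF assms(1)] pullback_marked[OF assms]]
  by (simp add: lin_ext_basis_vec[OF module_M])

lemma linear_species_DD: "linear_species K (DD K)"
proof -
  have cong: "relabel X X' \<sigma> v = relabel X X' \<tau> v"
    if "bij_betw \<sigma> X X'" "\<forall>i\<in>X. \<sigma> i = \<tau> i" "v \<in> carrier (M X')" for X X' :: "'b set" and \<sigma> \<tau> v
  proof -
    have \<tau>: "bij_betw \<tau> X X'"
      using that(1) by (rule bij_betw_cong[THEN iffD1, rotated]) (simp add: that(2))
    have "\<sigma> -` U \<inter> X = \<tau> -` U \<inter> X" for U
      using that(2) by auto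
    then show ?thesis
      using that(1) \<tau> pullback_topology_cong[of X \<sigma> \<tau>] that(2)
      by (intro M_eqI[OF module_M map_linear[OF that(1)] map_linear[OF \<tau>] _ that(3)]) (auto simp: map_e)
  qed
  have id: "relabel X X id v = v" if "v \<in> carrier (M X)" for X :: "'b set" and v
  proof (rule M_eqI[OF module_M map_linear[OF bij_betw_id] linear_maps_id _ that])
    fix T Y assume T: "topspace T = X" and Y: "openin T Y"
    have "Y \<inter> X = Y"
      using openin_subset[OF Y] T by auto
    then show "relabel X X id (e T Y) = e T Y"
      using map_e[of id X T Y] T Y by (simp add: pullback_topology_id)
  qed
  have comp: "relabel X X'' (\<tau> \<circ> \<sigma>) v = relabel X X' \<sigma> (relabel X' X'' \<tau> v)"
    if \<sigma>: "bij_betw \<sigma> X X'" and \<tau>: "bij_betw \<tau> X' X''" and v: "v \<in> carrier (M X'')" for X X' X'' :: "'b set" and \<sigma> \<tau> v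
  proof (rule M_eqI[OF module_M map_linear[OF bij_betw_trans[OF \<sigma> \<tau>]]
        linear_maps_comp[OF map_linear[OF \<tau>] map_linear[OF \<sigma>]] _ v])
    fix T Y assume T: "topspace T = X''" and Y: "openin T Y"
    have b: "bij_betw \<tau> X' (topspace T)" using \<tau> T by simp
    have b': "bij_betw (\<tau> \<circ> \<sigma>) X (topspace T)" using bij_betw_trans[OF \<sigma> \<tau>] T by simp
    have "\<sigma> -` (\<tau> -` Y \<inter> X') \<inter> X = (\<tau> \<circ> \<sigma>) -` Y \<inter> X"
      using bij_betw_apply[OF \<sigma>] by auto
    then show "relabel X X'' (\<tau> \<circ> \<sigma>) (e T Y) = relabel X X' \<sigma> (relabel X' X'' \<tau> (e T Y))"
      using map_e[OF b' Y] map_e[OF b Y] map_e[of \<sigma> X "pullback_topology X' \<tau> T" "\<tau> -` Y \<inter> X'"]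
        pullback_marked[OF b Y] pullback_topology_comp[OF \<sigma> b] topspace_pullback_bij[OF b] \<sigma> T
      by simp
  qed
  show ?thesis
    unfolding linear_species_def sp_obj_DD
    by (intro conjI allI impI ballI module_M map_linear cong id comp) auto
qed

section \<open>The product of marked topologies\<close>

lemma mult_eq: "sp_mult (DD K) X Y = (\<lambda>a b. lin_ext K (M (X \<union> Y)) (\<lambda>p. lin_ext K (M (X \<union> Y)) (\<lambda>q.
    e (topology_disjoint_union (fst p) (fst q)) (snd p \<union> snd q)) b) a)"
  by (simp add: DD_def DD_mult_def DD_base_def case_prod_beta' fun_eq_iff Let_def)

lemma disjoint_union_marked:
  assumes "topspace T1 \<inter> topspace T2 = {}" "openin T1 Y1" "openin T2 Y2"
  shows "openin (topology_disjoint_union T1 T2) (Y1 \<union> Y2)"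
proof -
  have "(Y1 \<union> Y2) \<inter> topspace T1 = Y1" "(Y1 \<union> Y2) \<inter> topspace T2 = Y2"
    using assms openin_subset[OF assms(2)] openin_subset[OF assms(3)] by auto
  then show ?thesis
    using assms openin_subset[OF assms(2)] openin_subset[OF assms(3)]
    by (auto simp: openin_topology_disjoint_union)
qed

lemma mult_bilinear:
  assumes "X \<inter> Y = {}"
  shows "sp_mult (DD K) X Y \<in> bilinear_maps K (M X) (M Y) (M (X \<union> Y))"
  unfolding mult_eq
proof (rule lin_ext_bilinear[OF module_M])
  fix p q assume "p \<in> marked_topologies X" "q \<in> marked_topologies Y"
  then show "e (topology_disjoint_union (fst p) (fst q)) (snd p \<union> snd q) \<in> carrier (M (X \<union> Y))"
    using assms by (cases p; cases q) (auto intro!: e_closed disjoint_union_marked)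
qed

lemma mult_e:
  assumes "topspace T1 = X" "topspace T2 = Y" "X \<inter> Y = {}" "openin T1 Y1" "openin T2 Y2"
  shows "sp_mult (DD K) X Y (e T1 Y1) (e T2 Y2) = e (topology_disjoint_union T1 T2) (Y1 \<union> Y2)"
proof -
  have "e (topology_disjoint_union T1 T2) (Y1 \<union> Y2) \<in> carrier (M (X \<union> Y))"
    using assms by (intro e_closed disjoint_union_marked) auto
  then show ?thesis
    by (simp add: mult_eq lin_ext_basis_vec[OF module_M])
qed

lemma M_bilinear_eqI:
  assumes "module K W" "\<beta> \<in> bilinear_maps K (M X) (M Y) W" "\<gamma> \<in> bilinear_maps K (M X) (M Y) W"
    "\<And>T U S V. topspace T = X \<Longrightarrow> openin T U \<Longrightarrow> topspace S = Y \<Longrightarrow> openin S V \<Longrightarrow> \<beta> (e T U) (e S V) = \<gamma> (e T U) (e S V)"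
    "a \<in> carrier (M X)" "b \<in> carrier (M Y)"
  shows "\<beta> a b = \<gamma> a b"
  by (rule bilinear_maps_eqI[OF module_M module_M assms(1-3) spans_M spans_M _ assms(5,6)])
     (use assms(4) in \<open>auto elim!: marked_topologiesE\<close>)

abbreviation "unit \<equiv> e (discrete_topology {}) {}"

lemma sp_unit_DD [simp]: "sp_unit (DD K) = unit"
  by (simp add: DD_def)

lemma unit_closed: "unit \<in> carrier (M {})"
  by (rule e_closed) auto

lemma mult_commute:
  assumes "X \<inter> Y = {}" "a \<in> carrier (M X)" "b \<in> carrier (M Y)"
  shows "sp_mult (DD K) X Y a b = sp_mult (DD K) Y X b a"
proof -
  have YX: "Y \<inter> X = {}" using assms(1) by auto
  have "(\<lambda>a b. sp_mult (DD K) Y X b a) \<in> bilinear_maps K (M X) (M Y) (M (X \<union> Y))"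
    using bilinear_maps_swap[OF mult_bilinear[OF YX]] by (simp add: Un_commute)
  from M_bilinear_eqI[OF module_M mult_bilinear[OF assms(1)] this _ assms(2,3)]
  show ?thesis
    by (simp add: mult_e assms(1) YX Un_commute topology_disjoint_union_commute)
qed

lemma unit_mult:
  assumes "a \<in> carrier (M X)"
  shows "sp_mult (DD K) {} X unit a = a" "sp_mult (DD K) X {} a unit = a"
proof -
  have "sp_mult (DD K) {} X unit \<in> linear_maps K (M X) (M X)"
    using bilinear_maps_right[OF mult_bilinear unit_closed, of X] by simp
  from M_eqI[OF module_M this linear_maps_id _ assms]
  show "sp_mult (DD K) {} X unit a = a"
    by (simp add: mult_e topology_disjoint_union_empty)
  then show "sp_mult (DD K) X {} a unit = a"
    using mult_commute[OF _ assms unit_closed] by simp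
qed

lemma mult_natural:
  assumes "X \<inter> Y = {}" "X' \<inter> Y' = {}" "bij_betw \<sigma> X X'" "bij_betw \<sigma> Y Y'"
    "a \<in> carrier (M X')" "b \<in> carrier (M Y')"
  shows "relabel (X \<union> Y) (X' \<union> Y') \<sigma> (sp_mult (DD K) X' Y' a b) =
    sp_mult (DD K) X Y (relabel X X' \<sigma> a) (relabel Y Y' \<sigma> b)"
proof (rule M_bilinear_eqI[OF module_M
      bilinear_maps_comp[OF linear_maps_id linear_maps_id mult_bilinear[OF assms(2)]
        map_linear[OF bij_betw_combine[OF assms(3,4,2)]]]
      bilinear_maps_comp[OF map_linear[OF assms(3)] map_linear[OF assms(4)] mult_bilinear[OF assms(1)] linear_maps_id]
      _ assms(5,6)])
  fix T U S V assume T: "topspace T = X'" "openin T U" and S: "topspace S = Y'" "openin S V"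
  have \<sigma>: "bij_betw \<sigma> X (topspace T)" "bij_betw \<sigma> Y (topspace S)"
    "bij_betw \<sigma> (X \<union> Y) (topspace (topology_disjoint_union T S))"
    using assms(3,4) bij_betw_combine[OF assms(3,4,2)] T S by auto
  have disj: "topspace T \<inter> topspace S = {}"
    using assms(2) T S by simp
  \<comment> \<open>\<open>U\<close> lies in \<open>X'\<close> and \<open>V\<close> in
    \<open>Y'\<close>. As \<open>\<sigma>\<close> carries \<open>X\<close> to \<open>X'\<close> and
    \<open>Y\<close> to \<open>Y'\<close>, no point of \<open>X\<close> is sent into
    \<open>V\<close> and no point of \<open>Y\<close> into \<open>U\<close>.\<close>
  have "\<sigma> -` (U \<union> V) \<inter> (X \<union> Y) = (\<sigma> -` U \<inter> X) \<union> (\<sigma> -` V \<inter> Y)"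
    using openin_subset[OF T(2)] openin_subset[OF S(2)] disj bij_betw_apply[OF \<sigma>(1)] bij_betw_apply[OF \<sigma>(2)]
    by blast
  then show "relabel (X \<union> Y) (X' \<union> Y') \<sigma> (sp_mult (DD K) X' Y' (e T U) (e S V)) =
      sp_mult (DD K) X Y (relabel X X' \<sigma> (e T U)) (relabel Y Y' \<sigma> (e S V))"
    using map_e[OF \<sigma>(1) T(2)] map_e[OF \<sigma>(2) S(2)] map_e[OF \<sigma>(3) disjoint_union_marked[OF disj T(2) S(2)]]
      mult_e[OF T(1) S(1) assms(2) T(2) S(2)]
      mult_e[OF topspace_pullback_bij[OF \<sigma>(1)] topspace_pullback_bij[OF \<sigma>(2)] assms(1) pullback_marked[OF \<sigma>(1) T(2)]
        pullback_marked[OF \<sigma>(2) S(2)]]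
      pullback_topology_disjoint_union[OF \<sigma>(1,2) assms(1) disj] T(1) S(1)
    by simp
qed

lemma mult_closed:
  "X \<inter> Y = {} \<Longrightarrow> a \<in> carrier (M X) \<Longrightarrow> b \<in> carrier (M Y) \<Longrightarrow> sp_mult (DD K) X Y a b \<in> carrier (M (X \<union> Y))"
  by (rule bilinear_maps_closed[OF mult_bilinear])

lemma mult_assoc:
  assumes XY: "X \<inter> Y = {}" and XZ: "X \<inter> Z = {}" and YZ: "Y \<inter> Z = {}"
    and a: "a \<in> carrier (M X)" and b: "b \<in> carrier (M Y)" and c: "c \<in> carrier (M Z)"
  shows "sp_mult (DD K) (X \<union> Y) Z (sp_mult (DD K) X Y a b) c = sp_mult (DD K) X (Y \<union> Z) a (sp_mult (DD K) Y Z b c)"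
proof -
  have d: "(X \<union> Y) \<inter> Z = {}" "X \<inter> (Y \<union> Z) = {}" using assms by auto
  \<comment> \<open>Folding associativity of the union gives both bracketings literally the same
    target module, as the comparison of bilinear maps requires.\<close>
  note bl = mult_bilinear[OF d(1)] and br = mult_bilinear[OF d(2), folded Un_assoc]
  show ?thesis
  proof (rule M_bilinear_eqI[OF module_M
        bilinear_maps_comp[OF linear_maps_id linear_maps_id mult_bilinear[OF XY] bilinear_maps_left[OF bl c]]
        bilinear_maps_comp[OF linear_maps_id bilinear_maps_left[OF mult_bilinear[OF YZ] c] br linear_maps_id] _ a b])
    fix T U S V assume T: "topspace T = X" "openin T U" and S: "topspace S = Y" "openin S V"
    note l = bilinear_maps_right[OF bl mult_closed[OF XY e_closed[OF T] e_closed[OF S]]]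
    note r = linear_maps_comp[OF bilinear_maps_right[OF mult_bilinear[OF YZ] e_closed[OF S]]
        bilinear_maps_right[OF br e_closed[OF T]]]
    show "sp_mult (DD K) (X \<union> Y) Z (sp_mult (DD K) X Y (e T U) (e S V)) c =
        sp_mult (DD K) X (Y \<union> Z) (e T U) (sp_mult (DD K) Y Z (e S V) c)"
    proof (rule M_eqI[OF module_M l r _ c])
      fix R W assume R: "topspace R = Z" "openin R W"
      have "openin (topology_disjoint_union T S) (U \<union> V)" "openin (topology_disjoint_union S R) (V \<union> W)"
        using T S R XY YZ by (auto intro!: disjoint_union_marked)
      then show "sp_mult (DD K) (X \<union> Y) Z (sp_mult (DD K) X Y (e T U) (e S V)) (e R W) =
        sp_mult (DD K) X (Y \<union> Z) (e T U) (sp_mult (DD K) Y Z (e S V) (e R W))"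
        using T S R XY YZ d by (simp add: mult_e topology_disjoint_union_assoc Un_assoc)
    qed
  qed
qed

lemma species_monoid_DD: "species_monoid K (DD K)"
  unfolding species_monoid_def sp_obj_DD sp_unit_DD
  by (intro conjI allI impI ballI linear_species_DD mult_bilinear mult_natural mult_assoc unit_closed unit_mult) auto

lemma species_commutative_DD: "species_commutative (DD K)"
  unfolding species_commutative_def sp_obj_DD using mult_commute by blast

end

section \<open>The coproduct of marked topologies\<close>

context DD_species
begin

abbreviation "M2 X Y \<equiv> tensor K (M X) (M Y)"
abbreviation "MM X \<equiv> direct_sum (Pow X) (\<lambda>Z. M2 Z (X - Z))"
abbreviation "comult \<equiv> sp_comult (DD K)"
abbreviation "split_at T Y Z \<equiv> pure_tensor K (M Z) (M (topspace T - Z)) (e (subtopology T Z) Z)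
  (e (subtopology T (topspace T - Z)) (Y - Z))"

lemma module_M2: "module K (M2 X Y)"
  by (rule module_tensor[OF module_M module_M])

lemma module_MM: "module K (MM X)"
  by (rule module_direct_sum[OF cring_K module_M2])

lemma sp_obj_tensor_DD: "sp_obj (species_tensor K (DD K) (DD K)) X = MM X"
  by (simp add: species_tensor_def)

lemma subtopology_closed:
  assumes "A \<subseteq> topspace T" "openin T Y" "B = Y \<inter> A"
  shows "e (subtopology T A) B \<in> carrier (M A)"
  using assms by (intro e_closed) (auto simp: openin_subtopology)

lemma split_parts_closed:
  assumes "openin T Y" "Z \<subseteq> Y"
  shows "e (subtopology T Z) Z \<in> carrier (M Z)"
    "e (subtopology T (topspace T - Z)) (Y - Z) \<in> carrier (M (topspace T - Z))"
  using assms openin_subset[OF assms(1)]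
  by (auto intro!: subtopology_closed[of _ _ Y])

lemma split_at_closed:
  assumes "openin T Y" "Z \<subseteq> Y"
  shows "split_at T Y Z \<in> carrier (M2 Z (topspace T - Z))"
  by (rule pure_tensor_closed[OF module_M module_M split_parts_closed[OF assms]])

lemma comult_eq:
  "comult X = lin_ext K (MM X) (\<lambda>p. \<Oplus>\<^bsub>MM X\<^esub>Z\<in>{Z. openin (subtopology (fst p) (snd p)) Z}.
    ds_inj (Pow X) (\<lambda>Z. M2 Z (X - Z)) Z
      (pure_tensor K (M Z) (M (X - Z)) (e (subtopology (fst p) Z) Z) (e (subtopology (fst p) (X - Z)) (snd p - Z))))"
  by (simp add: DD_def DD_comult_def DD_base_def species_tensor_def case_prod_beta' Let_def)

lemma comult_summand_closed:
  assumes "openin T Y" "Z \<subseteq> Y" "topspace T = X"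
  shows "ds_inj (Pow X) (\<lambda>Z. M2 Z (X - Z)) Z (split_at T Y Z) \<in> carrier (MM X)"
  using split_at_closed[OF assms(1,2)] assms openin_subset[OF assms(1)]
  by (intro linear_maps_closed[OF ds_inj_linear[where V="\<lambda>Z. M2 Z (X - Z)", OF module_M2]]) auto

lemma comult_linear: "comult X \<in> linear_maps K (M X) (MM X)"
  unfolding comult_eq
proof (rule lin_ext_linear[OF module_MM], rule Pi_I)
  interpret MM: module K "MM X" by (rule module_MM)
  fix p assume "p \<in> marked_topologies X"
  then have p: "topspace (fst p) = X" "openin (fst p) (snd p)"
    by (cases p; simp)+
  show "(\<Oplus>\<^bsub>MM X\<^esub>Z\<in>{Z. openin (subtopology (fst p) (snd p)) Z}. ds_inj (Pow X) (\<lambda>Z. M2 Z (X - Z)) Z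
      (pure_tensor K (M Z) (M (X - Z)) (e (subtopology (fst p) Z) Z) (e (subtopology (fst p) (X - Z)) (snd p - Z))))
      \<in> carrier (MM X)"
    using comult_summand_closed[OF p(2) _ p(1)] p
    by (intro MM.finsum_closed Pi_I) (auto simp: openin_open_subtopology)
qed

lemma comult_component_linear:
  assumes "Z \<subseteq> X"
  shows "(\<lambda>x. comult X x Z) \<in> linear_maps K (M X) (M2 Z (X - Z))"
  by (rule linear_maps_comp[OF comult_linear direct_sum_component_linear]) (use assms in simp)

text \<open>Distinct open sets contribute to distinct summands of the direct sum, so a component of
  the coproduct of a basis element never collects more than one term.\<close>

lemma comult_e:
  assumes "finite X" "topspace T = X" "openin T Y" "Z \<subseteq> X"
  shows "comult X (e T Y) Z = (if openin T Z \<and> Z \<subseteq> Y then split_at T Y Z else \<zero>\<^bsub>M2 Z (X - Z)\<^esub>)"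
proof -
  interpret MM: module K "MM X" by (rule module_MM)
  interpret M2: module K "M2 Z (X - Z)" by (rule module_M2)
  let ?I = "{W. openin (subtopology T Y) W}"
  let ?inj = "ds_inj (Pow X) (\<lambda>Z. M2 Z (X - Z))"
  \<comment> \<open>Since \<open>Y\<close> is open, the open sets of the restriction to
    \<open>Y\<close> are the open sets of \<open>T\<close> contained in \<open>Y\<close>.\<close>
  have I: "?I = {W. openin T W \<and> W \<subseteq> Y}"
    using assms(3) by (simp add: openin_open_subtopology)
  have "?I \<subseteq> Pow X"
    unfolding I using openin_subset[of T] assms(2) by auto
  then have fin: "finite ?I"
    by (rule finite_subset) (use assms(1) in simp)
  have summand: "?inj W (split_at T Y W) \<in> carrier (MM X)" if "W \<in> ?I" for W
    using that comult_summand_closed[OF assms(3) _ assms(2)] unfolding I by auto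
  have "comult X (e T Y) = (\<Oplus>\<^bsub>MM X\<^esub>W\<in>?I. ?inj W (split_at T Y W))"
    using MM.finsum_closed[of "\<lambda>W. ?inj W (split_at T Y W)" ?I] summand assms(2)
    by (simp add: comult_eq lin_ext_basis_vec[OF module_MM])
  then have "comult X (e T Y) Z = (\<Oplus>\<^bsub>M2 Z (X - Z)\<^esub>W\<in>?I. ?inj W (split_at T Y W) Z)"
    using linear_maps_finsum[where I="?I" and g="\<lambda>W. ?inj W (split_at T Y W)",
        OF module_MM module_M2 direct_sum_component_linear[OF PowI[OF assms(4)]] summand]
    by simp
  also have "\<dots> = (\<Oplus>\<^bsub>M2 Z (X - Z)\<^esub>W\<in>?I. if Z = W then split_at T Y W else \<zero>\<^bsub>M2 Z (X - Z)\<^esub>)"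
  proof (rule M2.finsum_cong'[OF refl])
    show "(\<lambda>W. if Z = W then split_at T Y W else \<zero>\<^bsub>M2 Z (X - Z)\<^esub>) \<in> ?I \<rightarrow> carrier (M2 Z (X - Z))"
      using split_at_closed[OF assms(3)] assms(2) unfolding I by auto
    show "?inj W (split_at T Y W) Z = (if Z = W then split_at T Y W else \<zero>\<^bsub>M2 Z (X - Z)\<^esub>)" for W
      using assms(4) by (simp add: ds_inj_component)
  qed
  also have "\<dots> = (if openin T Z \<and> Z \<subseteq> Y then split_at T Y Z else \<zero>\<^bsub>M2 Z (X - Z)\<^esub>)"
  proof (cases "Z \<in> ?I")
    case True
    then have cl: "split_at T Y Z \<in> carrier (M2 Z (X - Z))"
      using split_at_closed[OF assms(3)] assms(2) unfolding I by auto
    \<comment> \<open>For \<open>W\<close> different from \<open>Z\<close> the tensor lives in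
      another space. It is replaced under the condition by the one at \<open>Z\<close>, so that the
      rule for a single nonzero term becomes applicable.\<close>
    have "(\<Oplus>\<^bsub>M2 Z (X - Z)\<^esub>W\<in>?I. if Z = W then split_at T Y W else \<zero>\<^bsub>M2 Z (X - Z)\<^esub>) =
        (\<Oplus>\<^bsub>M2 Z (X - Z)\<^esub>W\<in>?I. if Z = W then split_at T Y Z else \<zero>\<^bsub>M2 Z (X - Z)\<^esub>)"
      using cl by (intro M2.finsum_cong') auto
    also have "\<dots> = split_at T Y Z"
      using True fin cl by (intro M2.finsum_singleton) auto
    finally show ?thesis
      using True unfolding I by simp
  next
    case False
    then have "(\<Oplus>\<^bsub>M2 Z (X - Z)\<^esub>W\<in>?I. if Z = W then split_at T Y W else \<zero>\<^bsub>M2 Z (X - Z)\<^esub>) = \<zero>\<^bsub>M2 Z (X - Z)\<^esub>"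
      by (intro M2.add.finprod_one_eqI) auto
    moreover have "\<not> (openin T Z \<and> Z \<subseteq> Y)"
      using False unfolding I by simp
    ultimately show ?thesis
      by (simp only: if_False)
  qed
  finally show ?thesis .
qed

text \<open>In an iterated coproduct the second splitting may be impossible; the resulting zero
  factor then makes the threefold tensor vanish.\<close>

lemma pure_zero:
  "u \<in> carrier (M X) \<Longrightarrow> pure_tensor K (M X) (M2 Y Z) u \<zero>\<^bsub>M2 Y Z\<^esub> = \<zero>\<^bsub>tensor K (M X) (M2 Y Z)\<^esub>"
  "u \<in> carrier (M X) \<Longrightarrow> pure_tensor K (M2 Y Z) (M X) \<zero>\<^bsub>M2 Y Z\<^esub> u = \<zero>\<^bsub>tensor K (M2 Y Z) (M X)\<^esub>"
  by (rule linear_maps_zero[OF module_M2 module_tensor[OF module_M module_M2]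
        bilinear_maps_right[OF pure_tensor_bilinear[OF module_M module_M2]]], assumption)
     (rule linear_maps_zero[OF module_M2 module_tensor[OF module_M2 module_M]
        bilinear_maps_left[OF pure_tensor_bilinear[OF module_M2 module_M]]])

lemma subtopology_pullback_split:
  assumes \<sigma>: "bij_betw \<sigma> X (topspace T)" and Z: "Z \<subseteq> X"
  shows "subtopology (pullback_topology X \<sigma> T) Z = pullback_topology Z \<sigma> (subtopology T (\<sigma> ` Z))"
    "subtopology (pullback_topology X \<sigma> T) (X - Z) = pullback_topology (X - Z) \<sigma> (subtopology T (topspace T - \<sigma> ` Z))"
proof -
  have "\<sigma> ` (X - Z) = topspace T - \<sigma> ` Z"
    using bij_betw_imp_inj_on[OF \<sigma>] bij_betw_imp_surj_on[OF \<sigma>] Z by (simp add: inj_on_image_set_diff)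
  then show "subtopology (pullback_topology X \<sigma> T) Z = pullback_topology Z \<sigma> (subtopology T (\<sigma> ` Z))"
    "subtopology (pullback_topology X \<sigma> T) (X - Z) = pullback_topology (X - Z) \<sigma> (subtopology T (topspace T - \<sigma> ` Z))"
    using subtopology_pullback[OF \<sigma> Z] subtopology_pullback[OF \<sigma>, of "X - Z"] by auto
qed

text \<open>A relabelling preserves openness and inclusion in the mark, so the two components vanish
  together. When they do not vanish, restriction commutes with relabelling in both tensor
  factors.\<close>

lemma comult_natural_component:
  assumes "finite X" and \<sigma>: "bij_betw \<sigma> X X'" and x: "x \<in> carrier (M X')" and Z: "Z \<subseteq> X"
  shows "comult X (relabel X X' \<sigma> x) Z =
    tensor_map K (M Z) (M (X - Z)) (relabel Z (\<sigma> ` Z) \<sigma>) (relabel (X - Z) (X' - \<sigma> ` Z) \<sigma>) (comult X' x (\<sigma> ` Z))"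
proof -
  have fin: "finite X'" using assms(1) \<sigma> bij_betw_finite by blast
  have Z': "\<sigma> ` Z \<subseteq> X'" using Z bij_betw_imp_surj_on[OF \<sigma>] by auto
  have \<sigma>Z: "bij_betw \<sigma> Z (\<sigma> ` Z)"
    by (rule bij_betw_subset[OF \<sigma> Z refl])
  have img: "\<sigma> ` (X - Z) = X' - \<sigma> ` Z"
    using bij_betw_imp_inj_on[OF \<sigma>] bij_betw_imp_surj_on[OF \<sigma>] Z by (simp add: inj_on_image_set_diff)
  have \<sigma>XZ: "bij_betw \<sigma> (X - Z) (X' - \<sigma> ` Z)"
    by (rule bij_betw_subset[OF \<sigma> Diff_subset img])
  note tm = tensor_map_linear[OF module_M module_M module_M module_M map_linear[OF \<sigma>Z] map_linear[OF \<sigma>XZ]]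
  show ?thesis
  proof (rule M_eqI[OF module_M2 linear_maps_comp[OF map_linear[OF \<sigma>] comult_component_linear[OF Z]]
        linear_maps_comp[OF comult_component_linear[OF Z'] tm] _ x])
    fix T Y assume T: "topspace T = X'" and Y: "openin T Y"
    have \<sigma>T: "bij_betw \<sigma> X (topspace T)" using \<sigma> T by simp
    note pb = topspace_pullback_bij[OF \<sigma>T] pullback_marked[OF \<sigma>T Y]
    have e: "relabel X X' \<sigma> (e T Y) = e (pullback_topology X \<sigma> T) (\<sigma> -` Y \<inter> X)"
      using map_e[OF \<sigma>T Y] T by simp
    have cond: "openin (pullback_topology X \<sigma> T) Z \<and> Z \<subseteq> \<sigma> -` Y \<inter> X \<longleftrightarrow> openin T (\<sigma> ` Z) \<and> \<sigma> ` Z \<subseteq> Y"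
      using Z by (auto simp: openin_pullback_bij[OF \<sigma>T])
    show "comult X (relabel X X' \<sigma> (e T Y)) Z =
      tensor_map K (M Z) (M (X - Z)) (relabel Z (\<sigma> ` Z) \<sigma>) (relabel (X - Z) (X' - \<sigma> ` Z) \<sigma>) (comult X' (e T Y) (\<sigma> ` Z))"
    proof (cases "openin T (\<sigma> ` Z) \<and> \<sigma> ` Z \<subseteq> Y")
      case False
      then show ?thesis
        unfolding e comult_e[OF assms(1) pb Z] comult_e[OF fin T Y Z'] cond if_not_P[OF False]
        by (simp add: linear_maps_zero[OF module_M2 module_M2 tm])
    next
      case True
      then have sub: "\<sigma> ` Z \<subseteq> Y" by simp
      let ?S = "subtopology T (\<sigma> ` Z)" and ?R = "subtopology T (X' - \<sigma> ` Z)"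
      have S1: "topspace ?S = \<sigma> ` Z" and R: "topspace ?R = X' - \<sigma> ` Z" "openin ?R (Y - \<sigma> ` Z)"
        using Z' T Y openin_subset[OF Y] by (auto simp: openin_subtopology intro!: exI[of _ Y])
      have S: "topspace ?S = \<sigma> ` Z" "openin ?S (\<sigma> ` Z)"
        using openin_topspace[of ?S] unfolding S1 by simp_all
      have bS: "bij_betw \<sigma> Z (topspace ?S)" and bR: "bij_betw \<sigma> (X - Z) (topspace ?R)"
        using \<sigma>Z \<sigma>XZ S(1) R(1) by simp_all
      have sets: "\<sigma> -` (\<sigma> ` Z) \<inter> Z = Z" "\<sigma> -` (Y - \<sigma> ` Z) \<inter> (X - Z) = \<sigma> -` Y \<inter> X - Z"
        using bij_betw_imp_inj_on[OF \<sigma>] Z by (auto simp: inj_on_def)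
      have "relabel Z (\<sigma> ` Z) \<sigma> (e ?S (\<sigma> ` Z)) = e (subtopology (pullback_topology X \<sigma> T) Z) Z"
        using map_e[OF bS S(2)] unfolding S(1) sets subtopology_pullback_split(1)[OF \<sigma>T Z] .
      moreover have "relabel (X - Z) (X' - \<sigma> ` Z) \<sigma> (e ?R (Y - \<sigma> ` Z)) =
          e (subtopology (pullback_topology X \<sigma> T) (X - Z)) (\<sigma> -` Y \<inter> X - Z)"
        using map_e[OF bR R(2)] unfolding R(1) sets subtopology_pullback_split(2)[OF \<sigma>T Z] T .
      moreover have "tensor_map K (M Z) (M (X - Z)) (relabel Z (\<sigma> ` Z) \<sigma>) (relabel (X - Z) (X' - \<sigma> ` Z) \<sigma>)
          (pure_tensor K (M (\<sigma> ` Z)) (M (X' - \<sigma> ` Z)) (e ?S (\<sigma> ` Z)) (e ?R (Y - \<sigma> ` Z))) =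
          pure_tensor K (M Z) (M (X - Z)) (relabel Z (\<sigma> ` Z) \<sigma> (e ?S (\<sigma> ` Z))) (relabel (X - Z) (X' - \<sigma> ` Z) \<sigma> (e ?R (Y - \<sigma> ` Z)))"
        by (rule tensor_map_pure[OF module_M module_M module_M module_M map_linear[OF \<sigma>Z] map_linear[OF \<sigma>XZ]
            e_closed[OF S] e_closed[OF R]])
      ultimately show ?thesis
        unfolding e comult_e[OF assms(1) pb Z] comult_e[OF fin T Y Z'] cond pb(1)
        using True T by simp
    qed
  qed
qed

lemma comult_natural:
  assumes "finite X" and \<sigma>: "bij_betw \<sigma> X X'" and x: "x \<in> carrier (M X')"
  shows "comult X (relabel X X' \<sigma> x) = sp_map (species_tensor K (DD K) (DD K)) X X' \<sigma> (comult X' x)"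
proof
  fix Z
  show "comult X (relabel X X' \<sigma> x) Z = sp_map (species_tensor K (DD K) (DD K)) X X' \<sigma> (comult X' x) Z"
  proof (cases "Z \<subseteq> X")
    case True
    then show ?thesis
      using comult_natural_component[OF assms True] by (simp add: species_tensor_def)
  next
    \<comment> \<open>Off the subsets of \<open>X\<close> both sides take the value
      \<open>undefined\<close>: the left as an element of a direct sum, the right by the restriction
      in \<open>species_tensor\<close>.\<close>
    case False
    have "comult X (relabel X X' \<sigma> x) \<in> carrier (MM X)"
      by (rule linear_maps_closed[OF comult_linear linear_maps_closed[OF map_linear[OF \<sigma>] x]])
    then have "comult X (relabel X X' \<sigma> x) \<in> extensional (Pow X)"
      unfolding mem_direct_sum PiE_def by blast
    then have "comult X (relabel X X' \<sigma> x) Z = undefined"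
      by (rule extensional_arb) (use False in simp)
    with False show ?thesis
      by (simp add: species_tensor_def)
  qed
qed

lemma comult_coassoc:
  assumes "finite X" "finite Y" "finite Z" "X \<inter> Y = {}" "X \<inter> Z = {}" "Y \<inter> Z = {}"
    and x: "x \<in> carrier (M (X \<union> Y \<union> Z))"
  shows "tensor_assoc K (M X) (M Y) (M Z)
      (tensor_map K (M2 X Y) (M Z) (\<lambda>y. comult (X \<union> Y) y X) id (comult (X \<union> Y \<union> Z) x (X \<union> Y))) =
    tensor_map K (M X) (M2 Y Z) id (\<lambda>y. comult (Y \<union> Z) y Y) (comult (X \<union> Y \<union> Z) x X)"
proof -
  let ?A = "X \<union> Y \<union> Z"
  have diff: "?A - (X \<union> Y) = Z" "?A - X = Y \<union> Z" "X \<union> Y - X = Y" "Y \<union> Z - Y = Z"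
    using assms(4-6) by auto
  have sub: "X \<union> Y \<subseteq> ?A" "X \<subseteq> ?A" "X \<subseteq> X \<union> Y" "Y \<subseteq> Y \<union> Z" by auto
  have fin: "finite ?A" "finite (X \<union> Y)" "finite (Y \<union> Z)" using assms by auto
  note cXY = comult_component_linear[OF sub(1), unfolded diff] and cX = comult_component_linear[OF sub(2), unfolded diff]
    and cX' = comult_component_linear[OF sub(3), unfolded diff] and cY = comult_component_linear[OF sub(4), unfolded diff]
  note tL = tensor_map_linear[OF module_M module_M module_M2 module_M cX' linear_maps_id']
    and tR = tensor_map_linear[OF module_M module_M module_M module_M2 linear_maps_id' cY]
    and as = tensor_assoc_linear[OF module_M module_M module_M]
  note W = module_tensor[OF module_M module_M2]
  note mXY_Z = module_tensor[OF module_M2 module_M]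
  show ?thesis
  proof (rule M_eqI[OF W linear_maps_comp[OF cXY linear_maps_comp[OF tL as]] linear_maps_comp[OF cX tR] _ x])
    fix T U assume T: "topspace T = ?A" and U: "openin T U"
    have topXY: "topspace (subtopology T (X \<union> Y)) = X \<union> Y" and topYZ: "topspace (subtopology T (Y \<union> Z)) = Y \<union> Z"
      using T by auto
    have opXY: "openin (subtopology T (X \<union> Y)) (X \<union> Y)"
      using openin_topspace[of "subtopology T (X \<union> Y)"] by (simp only: topXY)
    \<comment> \<open>The common value of both sides when they do not vanish: \<open>X\<close> and
      \<open>Y\<close> are entirely marked, and \<open>Z\<close> keeps what is left of
      \<open>U\<close>.\<close>
    define P where "P = pure_tensor K (M X) (M2 Y Z) (e (subtopology T X) X)
      (pure_tensor K (M Y) (M Z) (e (subtopology T Y) Y) (e (subtopology T Z) (U - (X \<union> Y))))"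
    \<comment> \<open>After the first splitting on the left the part to be split again is marked
      entirely, so only openness of \<open>X\<close> is asked. On the right that part carries the
      mark \<open>U - X\<close>, so \<open>Y\<close> must also be contained in it.\<close>
    let ?l = "openin T (X \<union> Y) \<and> X \<union> Y \<subseteq> U" and ?l' = "openin (subtopology T (X \<union> Y)) X"
    let ?r = "openin T X \<and> X \<subseteq> U" and ?r' = "openin (subtopology T (Y \<union> Z)) Y \<and> Y \<subseteq> U - X"
    have sT: "subtopology (subtopology T A) B = subtopology T B" if "B \<subseteq> A" for A B
      using that by (simp add: subtopology_subtopology Int_absorb1)
    have eq: "?l \<and> ?l' \<longleftrightarrow> ?r \<and> ?r'"
    proof
      assume l: "?l \<and> ?l'"
      then have "openin T X"
        using openin_trans_full by blast
      moreover have "openin (subtopology T (Y \<union> Z)) Y"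
        \<comment> \<open>By disjointness of the blocks the open set \<open>X \<union> Y\<close>
          meets \<open>Y \<union> Z\<close> exactly in \<open>Y\<close>.\<close>
        unfolding openin_subtopology using l assms(4-6) by (intro exI[of _ "X \<union> Y"]) auto
      ultimately show "?r \<and> ?r'" using l assms(4) by auto
    next
      assume r: "?r \<and> ?r'"
      then obtain V where V: "openin T V" "Y = V \<inter> (Y \<union> Z)"
        by (auto simp: openin_subtopology)
      \<comment> \<open>\<open>V\<close> may reach into \<open>X\<close>, but outside
        \<open>X\<close> it consists exactly of the points of \<open>Y\<close>. Adding the open set
        \<open>X\<close> therefore yields \<open>X \<union> Y\<close>.\<close>
      have "X \<union> V = X \<union> Y"
        using V(2) openin_subset[OF V(1)] T by auto
      then have XY: "openin T (X \<union> Y)"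
        using r V(1) by (metis openin_Un)
      moreover have "openin (subtopology T (X \<union> Y)) X"
        unfolding openin_subtopology using r by (intro exI[of _ X]) auto
      ultimately show "?l \<and> ?l'" using r by auto
    qed
    have left: "tensor_assoc K (M X) (M Y) (M Z) (tensor_map K (M2 X Y) (M Z) (\<lambda>y. comult (X \<union> Y) y X) id
        (comult ?A (e T U) (X \<union> Y))) = (if ?l \<and> ?l' then P else \<zero>\<^bsub>tensor K (M X) (M2 Y Z)\<^esub>)"
    proof (cases ?l)
      case False
      then show ?thesis
        unfolding comult_e[OF fin(1) T U sub(1)] diff if_not_P[OF False]
        by (auto simp: linear_maps_zero[OF module_M2 W linear_maps_comp[OF tL as]])
    next
      case True
      then have op: "X \<union> Y \<subseteq> U" by simp
      note cl = split_parts_closed[OF U op, unfolded T diff]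
      have "comult (X \<union> Y) (e (subtopology T (X \<union> Y)) (X \<union> Y)) X = (if ?l'
          then pure_tensor K (M X) (M Y) (e (subtopology T X) X) (e (subtopology T Y) Y)
          else \<zero>\<^bsub>M2 X Y\<^esub>)"
        using comult_e[OF fin(2) topXY opXY sub(3), unfolded topXY diff sT[OF sub(3)] sT[OF Un_upper2]] by simp
      moreover have "e (subtopology T X) X \<in> carrier (M X)" "e (subtopology T Y) Y \<in> carrier (M Y)"
        using openin_topspace T by (auto intro!: subtopology_closed[of _ _ "topspace T"])
      ultimately show ?thesis
        using True cl
        unfolding comult_e[OF fin(1) T U sub(1)] diff T
        by (simp add: tensor_map_pure[OF module_M module_M module_M2 module_M cX' linear_maps_id'] P_def
            tensor_assoc_pure[OF module_M module_M module_M] pure_zero linear_maps_zero[OF mXY_Z W as])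
    qed
    have right: "tensor_map K (M X) (M2 Y Z) id (\<lambda>y. comult (Y \<union> Z) y Y) (comult ?A (e T U) X) =
        (if ?r \<and> ?r' then P else \<zero>\<^bsub>tensor K (M X) (M2 Y Z)\<^esub>)"
    proof (cases ?r)
      case False
      then show ?thesis
        unfolding comult_e[OF fin(1) T U sub(2)] diff if_not_P[OF False]
        by (auto simp: linear_maps_zero[OF module_M2 W tR])
    next
      case True
      then have op: "X \<subseteq> U" by simp
      note cl = split_parts_closed[OF U op, unfolded T diff]
      have UXY: "U - X - Y = U - (X \<union> Y)" by auto
      have opYZ: "openin (subtopology T (Y \<union> Z)) (U - X)"
        unfolding openin_subtopology using U openin_subset[OF U] T assms(4,5) by (intro exI[of _ U]) auto
      have "comult (Y \<union> Z) (e (subtopology T (Y \<union> Z)) (U - X)) Y = (if ?r'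
          then pure_tensor K (M Y) (M Z) (e (subtopology T Y) Y) (e (subtopology T Z) (U - (X \<union> Y)))
          else \<zero>\<^bsub>M2 Y Z\<^esub>)"
        using comult_e[OF fin(3) topYZ opYZ sub(4), unfolded topYZ diff sT[OF sub(4)] sT[OF Un_upper2] UXY] .
      then show ?thesis
        using True cl
        unfolding comult_e[OF fin(1) T U sub(2)] diff T
        by (simp add: tensor_map_pure[OF module_M module_M module_M module_M2 linear_maps_id' cY] P_def pure_zero)
    qed
    show "tensor_assoc K (M X) (M Y) (M Z) (tensor_map K (M2 X Y) (M Z) (\<lambda>y. comult (X \<union> Y) y X) id
        (comult ?A (e T U) (X \<union> Y))) = tensor_map K (M X) (M2 Y Z) id (\<lambda>y. comult (Y \<union> Z) y Y) (comult ?A (e T U) X)"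
      unfolding left right eq ..
  qed
qed

lemma species_comonoid_DD: "species_comonoid_no_counit K (DD K)"
  unfolding species_comonoid_no_counit_def sp_obj_tensor_DD sp_obj_DD
  by (intro conjI allI impI ballI linear_species_DD comult_linear comult_natural comult_coassoc) auto

text \<open>A set is open in a disjoint union, and inside the union of the marks, exactly if both of
  its traces are so in the factors. Hence the two sides vanish together, and otherwise restriction
  distributes over the disjoint union.\<close>

lemma comult_mult:
  assumes "finite X" "finite Y" and XY: "X \<inter> Y = {}" and a: "a \<in> carrier (M X)" and b: "b \<in> carrier (M Y)"
    and Z: "Z \<subseteq> X \<union> Y"
  shows "comult (X \<union> Y) (sp_mult (DD K) X Y a b) Z = tensor_mult K (M Z) (M (X \<union> Y - Z))
    (sp_mult (DD K) (Z \<inter> X) (Z \<inter> Y)) (sp_mult (DD K) (X - Z) (Y - Z)) (comult X a (Z \<inter> X)) (comult Y b (Z \<inter> Y))"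
proof -
  have fin: "finite (X \<union> Y)" using assms by simp
  have sets: "(Z \<inter> X) \<union> (Z \<inter> Y) = Z" "(X - Z) \<union> (Y - Z) = X \<union> Y - Z" "X - Z \<inter> X = X - Z" "Y - Z \<inter> Y = Y - Z"
    and disj: "(Z \<inter> X) \<inter> (Z \<inter> Y) = {}" "(X - Z) \<inter> (Y - Z) = {}"
    using Z XY by auto
  note m1 = mult_bilinear[OF disj(1), unfolded sets] and m2 = mult_bilinear[OF disj(2), unfolded sets]
  note tm = tensor_mult_bilinear(3)[OF module_M module_M module_M module_M module_M module_M m1 m2]
  note cX = comult_component_linear[of "Z \<inter> X" X, OF Int_lower2, unfolded sets]
    and cY = comult_component_linear[of "Z \<inter> Y" Y, OF Int_lower2, unfolded sets]
  show ?thesis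
  proof (rule M_bilinear_eqI[OF module_M2
        bilinear_maps_comp[OF linear_maps_id linear_maps_id mult_bilinear[OF XY] comult_component_linear[OF Z]]
        bilinear_maps_comp[OF cX cY tm linear_maps_id] _ a b])
    fix T U S V assume T: "topspace T = X" "openin T U" and S: "topspace S = Y" "openin S V"
    have TS: "topspace T \<inter> topspace S = {}" using XY T S by simp
    let ?D = "topology_disjoint_union T S"
    have D: "topspace ?D = X \<union> Y" "openin ?D (U \<union> V)"
      using T S disjoint_union_marked[OF TS T(2) S(2)] by auto
    have UV: "U \<subseteq> X" "V \<subseteq> Y" using openin_subset[OF T(2)] openin_subset[OF S(2)] T S by auto
    have cond: "openin ?D Z \<and> Z \<subseteq> U \<union> V \<longleftrightarrow> (openin T (Z \<inter> X) \<and> Z \<inter> X \<subseteq> U) \<and> (openin S (Z \<inter> Y) \<and> Z \<inter> Y \<subseteq> V)"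
      unfolding openin_topology_disjoint_union T(1) S(1) using Z UV XY by blast
    note cT = comult_e[OF assms(1) T Int_lower2, of Z, unfolded T(1) sets]
      and cS = comult_e[OF assms(2) S Int_lower2, of Z, unfolded S(1) sets]
      and cD = comult_e[OF fin D Z, unfolded D(1)]
    show "comult (X \<union> Y) (sp_mult (DD K) X Y (e T U) (e S V)) Z = tensor_mult K (M Z) (M (X \<union> Y - Z))
      (sp_mult (DD K) (Z \<inter> X) (Z \<inter> Y)) (sp_mult (DD K) (X - Z) (Y - Z)) (comult X (e T U) (Z \<inter> X)) (comult Y (e S V) (Z \<inter> Y))"
    proof (cases "(openin T (Z \<inter> X) \<and> Z \<inter> X \<subseteq> U) \<and> (openin S (Z \<inter> Y) \<and> Z \<inter> Y \<subseteq> V)")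
      \<comment> \<open>At least one of the two coproducts has component zero, and the product of
        tensors is linear in each argument.\<close>
      case False
      have "comult X (e T U) (Z \<inter> X) \<in> carrier (M2 (Z \<inter> X) (X - Z))" "comult Y (e S V) (Z \<inter> Y) \<in> carrier (M2 (Z \<inter> Y) (Y - Z))"
        by (rule linear_maps_closed[OF cX e_closed[OF T]], rule linear_maps_closed[OF cY e_closed[OF S]])
      then have "tensor_mult K (M Z) (M (X \<union> Y - Z)) (sp_mult (DD K) (Z \<inter> X) (Z \<inter> Y)) (sp_mult (DD K) (X - Z) (Y - Z))
          (comult X (e T U) (Z \<inter> X)) (comult Y (e S V) (Z \<inter> Y)) = \<zero>\<^bsub>M2 Z (X \<union> Y - Z)\<^esub>"
        using False cT cS linear_maps_zero[OF module_M2 module_M2 bilinear_maps_left[OF tm]]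
          linear_maps_zero[OF module_M2 module_M2 bilinear_maps_right[OF tm]]
        by (auto split: if_splits)
      then show ?thesis
        unfolding mult_e[OF T(1) S(1) XY T(2) S(2)] cD cond if_not_P[OF False] by simp
    next
      case True
      then have subs: "Z \<inter> X \<subseteq> U" "Z \<inter> Y \<subseteq> V" by auto
      note pT = split_parts_closed[OF T(2) subs(1), unfolded T(1) sets] and pS = split_parts_closed[OF S(2) subs(2), unfolded S(1) sets]
      have opens: "openin (subtopology T (Z \<inter> X)) (Z \<inter> X)" "openin (subtopology S (Z \<inter> Y)) (Z \<inter> Y)"
        "openin (subtopology T (X - Z)) (U - Z)" "openin (subtopology S (Y - Z)) (V - Z)"
        using True T S UV by (auto simp: openin_subtopology)
      have tops: "topspace (subtopology T (Z \<inter> X)) = Z \<inter> X" "topspace (subtopology S (Z \<inter> Y)) = Z \<inter> Y"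
        "topspace (subtopology T (X - Z)) = X - Z" "topspace (subtopology S (Y - Z)) = Y - Z"
        using T S by auto
      \<comment> \<open>Restricting the disjoint union to \<open>Z\<close>, or to its complement, is
        the same as restricting each factor to its trace.\<close>
      have subD: "topology_disjoint_union (subtopology T (Z \<inter> X)) (subtopology S (Z \<inter> Y)) = subtopology ?D Z"
        "topology_disjoint_union (subtopology T (X - Z)) (subtopology S (Y - Z)) = subtopology ?D (X \<union> Y - Z)"
      proof -
        have "(X \<union> Y - Z) \<inter> X = X - Z" "(X \<union> Y - Z) \<inter> Y = Y - Z" by auto
        then show "topology_disjoint_union (subtopology T (Z \<inter> X)) (subtopology S (Z \<inter> Y)) = subtopology ?D Z"
          "topology_disjoint_union (subtopology T (X - Z)) (subtopology S (Y - Z)) = subtopology ?D (X \<union> Y - Z)"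
          using subtopology_disjoint_union[OF TS] T(1) S(1) by auto
      qed
      have diffs: "U - Z \<inter> X = U - Z" "V - Z \<inter> Y = V - Z" "(U - Z) \<union> (V - Z) = U \<union> V - Z"
        using UV by auto
      have mults: "sp_mult (DD K) (Z \<inter> X) (Z \<inter> Y) (e (subtopology T (Z \<inter> X)) (Z \<inter> X)) (e (subtopology S (Z \<inter> Y)) (Z \<inter> Y)) =
          e (subtopology ?D Z) Z"
        "sp_mult (DD K) (X - Z) (Y - Z) (e (subtopology T (X - Z)) (U - Z)) (e (subtopology S (Y - Z)) (V - Z)) =
          e (subtopology ?D (X \<union> Y - Z)) (U \<union> V - Z)"
        unfolding mult_e[OF tops(1,2) disj(1) opens(1,2)] mult_e[OF tops(3,4) disj(2) opens(3,4)] subD sets diffs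
        by (rule refl)+
      show ?thesis
        unfolding mult_e[OF T(1) S(1) XY T(2) S(2)] cD cond cT cS
        using True tensor_mult_pure[OF module_M module_M module_M module_M module_M module_M m1 m2 pT pS]
        by (simp add: diffs mults)
    qed
  qed
qed

lemma comult_unit: "comult {} unit {} = pure_tensor K (M {}) (M {}) unit unit"
  using comult_e[of "{}" "discrete_topology {}" "{}" "{}"] by simp

lemma bimonoid_DD: "bimonoid_no_counit K (DD K)"
  unfolding bimonoid_no_counit_def sp_obj_DD sp_unit_DD
  by (intro conjI allI impI ballI species_monoid_DD species_comonoid_DD comult_mult comult_unit) auto

section \<open>The grading by the size of the mark\<close>

abbreviation "homog X n \<equiv> {(T, Y) \<in> marked_topologies X. card Y = n}"

lemma grading_eq: "DD_grading K X n = carrier (free_module K (homog X n))"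
  by (simp add: DD_grading_def)

text \<open>A homogeneous part is the carrier of a free module on fewer generators. Its inclusion is
  linear, so the spanning property of that smaller basis is transported along it.\<close>

lemma grading_span: "x \<in> DD_grading K X n \<Longrightarrow> x \<in> lin_span K (M X) (basis_vec K ` homog X n)"
proof -
  assume x: "x \<in> DD_grading K X n"
  have F: "module K (free_module K (homog X n))"
    by (rule module_free_module[OF cring_K])
  have sub: "basis_vec K ` homog X n \<subseteq> carrier (M X)" "basis_vec K ` homog X n \<subseteq> carrier (free_module K (homog X n))"
    by (auto intro!: basis_vec_closed[OF cring_K])
  have "carrier (free_module K (homog X n)) \<subseteq> carrier (M X)"
    by (rule free_module_mono) auto
  then have "(\<lambda>x. x) \<in> linear_maps K (free_module K (homog X n)) (M X)"
    by (intro linear_mapsI) (simp_all add: free_module_simps subset_iff)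
  from linear_maps_span[OF F module_M this submodule_lin_span[OF module_M sub(1)] sub(2) lin_span_base]
  show ?thesis
    using x spans_free_module[OF cring_K, of "homog X n"] by (auto simp: grading_eq spans_def)
qed

lemma e_grading: "topspace T = X \<Longrightarrow> openin T Y \<Longrightarrow> card Y = n \<Longrightarrow> e T Y \<in> DD_grading K X n"
  unfolding grading_eq by (rule basis_vec_closed[OF cring_K]) simp

lemma grading_closed: "DD_grading K X n \<subseteq> carrier (M X)"
  unfolding grading_eq by (rule free_module_mono) auto

lemma submodule_grading: "submodule (DD_grading K X n) K (M X)"
proof -
  interpret K: cring K by (rule cring_K)
  interpret M: module K "M X" by (rule module_M)
  interpret H: module K "free_module K (homog X n)" by (rule module_free_module[OF cring_K])
  \<comment> \<open>The two free modules share their operations, which are pointwise and refer to no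
    basis; closure can thus be borrowed from the smaller module.\<close>
  have add: "x \<oplus>\<^bsub>M X\<^esub> y = x \<oplus>\<^bsub>free_module K (homog X n)\<^esub> y" and smult: "c \<odot>\<^bsub>M X\<^esub> x = c \<odot>\<^bsub>free_module K (homog X n)\<^esub> x"
    and zero: "\<zero>\<^bsub>M X\<^esub> = \<zero>\<^bsub>free_module K (homog X n)\<^esub>" for x y c
    by (simp_all add: free_module_simps)
  have smult_closed: "c \<odot>\<^bsub>M X\<^esub> x \<in> DD_grading K X n" if "c \<in> carrier K" "x \<in> DD_grading K X n" for c x
    using that unfolding grading_eq smult by (rule H.smult_closed)
  show ?thesis
  proof (rule M.submoduleI[OF grading_closed])
    show "\<ominus>\<^bsub>M X\<^esub> x \<in> DD_grading K X n" if "x \<in> DD_grading K X n" for x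
      using smult_closed[of "\<ominus>\<^bsub>K\<^esub> \<one>\<^bsub>K\<^esub>" x] that grading_closed[of X n] by (auto simp: M.smult_l_minus)
    show "\<zero>\<^bsub>M X\<^esub> \<in> DD_grading K X n"
      unfolding grading_eq zero by (rule H.zero_closed)
    show "x \<oplus>\<^bsub>M X\<^esub> y \<in> DD_grading K X n" if "x \<in> DD_grading K X n" "y \<in> DD_grading K X n" for x y
      using that unfolding grading_eq add by (rule H.a_closed)
  qed (rule smult_closed)
qed

text \<open>Reduces each claim that an operation preserves degrees to basis elements whose mark has
  the prescribed size.\<close>

lemma grading_linear_maps:
  assumes "module K W" "f \<in> linear_maps K (M X) W" "submodule N K W"
    "\<And>T Y. topspace T = X \<Longrightarrow> openin T Y \<Longrightarrow> card Y = n \<Longrightarrow> f (e T Y) \<in> N" "x \<in> DD_grading K X n"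
  shows "f x \<in> N"
proof (rule linear_maps_span[OF module_M assms(1-3) _ _ grading_span[OF assms(5)]])
  show "basis_vec K ` homog X n \<subseteq> carrier (M X)"
    by (auto intro!: basis_vec_closed[OF cring_K])
qed (use assms(4) in auto)

lemma graded_module_DD:
  fixes X :: "'b set"
  shows "graded_module K (M X) (DD_grading K X)"
proof (rule graded_moduleI[OF module_M submodule_grading])
  interpret K: cring K by (rule cring_K)
  \<comment> \<open>The projection keeps the coefficients of those pairs whose mark has size
    \<open>n\<close>.\<close>
  define p where "p n f = (\<lambda>b. if card (snd b) = n then f b else \<zero>\<^bsub>K\<^esub>)" for n and f :: "'b topology \<times> 'b set \<Rightarrow> 'k"
  show "p n \<in> linear_maps K (M X) (M X)" for n
  proof (rule linear_mapsI)
    fix f assume f: "f \<in> carrier (M X)"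
    have "finite {b. p n f b \<noteq> \<zero>\<^bsub>K\<^esub>}"
      by (rule finite_subset[of _ "{b. f b \<noteq> \<zero>\<^bsub>K\<^esub>}"]) (use f in \<open>auto simp: p_def mem_free_module\<close>)
    then show "p n f \<in> carrier (M X)"
      using f by (auto simp: p_def mem_free_module)
  qed (auto simp: p_def free_module_simps fun_eq_iff)
  show "p n f = (if n = m then f else \<zero>\<^bsub>M X\<^esub>)" if "f \<in> DD_grading K X m" for m n f
  proof -
    have supp: "f b = \<zero>\<^bsub>K\<^esub>" if "card (snd b) \<noteq> m" for b
      using \<open>f \<in> DD_grading K X m\<close> that by (cases b) (auto simp: grading_eq mem_free_module)
    show ?thesis
      by (auto simp: p_def free_module_simps fun_eq_iff supp)
  qed
  have sub: "(\<Union>n. DD_grading K X n) \<subseteq> carrier (M X)"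
    using grading_closed by auto
  show "spans K (M X) (\<Union>n. DD_grading K X n)"
    by (rule spans_trans[OF module_M spans_M sub])
       (auto elim!: marked_topologiesE intro!: lin_span_base e_grading)
qed

lemma map_grading:
  assumes "bij_betw \<sigma> X X'" "x \<in> DD_grading K X' n"
  shows "relabel X X' \<sigma> x \<in> DD_grading K X n"
proof (rule grading_linear_maps[OF module_M map_linear[OF assms(1)] submodule_grading _ assms(2)])
  fix T Y assume T: "topspace T = X'" "openin T Y" "card Y = n"
  have \<sigma>: "bij_betw \<sigma> X (topspace T)" using assms(1) T by simp
  \<comment> \<open>An open set lies in the image of \<open>\<sigma>\<close>, so
    \<open>\<sigma>\<close> maps its preimage onto it, and the size of the mark is
    preserved.\<close>
  have "bij_betw \<sigma> (\<sigma> -` Y \<inter> X) Y"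
  proof (rule bij_betw_subset[OF \<sigma>])
    have "\<sigma> ` (\<sigma> -` Y \<inter> X) = Y \<inter> \<sigma> ` X" by auto
    then show "\<sigma> ` (\<sigma> -` Y \<inter> X) = Y"
      using openin_subset[OF T(2)] bij_betw_imp_surj_on[OF \<sigma>] by auto
  qed auto
  then have "card (\<sigma> -` Y \<inter> X) = n"
    using T(3) bij_betw_same_card by auto
  then show "relabel X X' \<sigma> (e T Y) \<in> DD_grading K X n"
    using map_e[OF \<sigma> T(2)] e_grading[OF topspace_pullback_bij[OF \<sigma>] pullback_marked[OF \<sigma> T(2)]] T(1) by simp
qed

lemma mult_grading:
  assumes "finite X" "finite Y" "X \<inter> Y = {}" and a: "a \<in> DD_grading K X i" and b: "b \<in> DD_grading K Y j"
  shows "sp_mult (DD K) X Y a b \<in> DD_grading K (X \<union> Y) (i + j)"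
proof -
  note bil = mult_bilinear[OF assms(3)]
  have bc: "b \<in> carrier (M Y)" using b grading_closed by auto
  show ?thesis
  proof (rule grading_linear_maps[OF module_M bilinear_maps_left[OF bil bc] submodule_grading _ a])
    fix T U assume T: "topspace T = X" "openin T U" "card U = i"
    show "sp_mult (DD K) X Y (e T U) b \<in> DD_grading K (X \<union> Y) (i + j)"
    proof (rule grading_linear_maps[OF module_M bilinear_maps_right[OF bil e_closed[OF T(1,2)]] submodule_grading _ b])
      fix S V assume S: "topspace S = Y" "openin S V" "card V = j"
      have UV: "U \<subseteq> X" "V \<subseteq> Y" using openin_subset[OF T(2)] openin_subset[OF S(2)] T S by auto
      \<comment> \<open>Finite ground sets make the marks finite and disjoint ground sets make them
        disjoint, so that their sizes add up.\<close>
      then have "card (U \<union> V) = i + j"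
        using assms(1-3) T(3) S(3) finite_subset by (subst card_Un_disjoint) auto
      then show "sp_mult (DD K) X Y (e T U) (e S V) \<in> DD_grading K (X \<union> Y) (i + j)"
        unfolding mult_e[OF T(1) S(1) assms(3) T(2) S(2)]
        by (intro e_grading disjoint_union_marked) (use T S assms(3) in auto)
    qed
  qed
qed

lemma comult_grading:
  assumes "finite X" "x \<in> DD_grading K X n" "Z \<subseteq> X"
  shows "comult X x Z \<in> tensor_grading K (M Z) (M (X - Z)) (DD_grading K Z) (DD_grading K (X - Z)) n"
proof -
  note N = submodule_tensor_grading[OF module_M module_M grading_closed grading_closed]
  show ?thesis
  proof (rule grading_linear_maps[OF module_M2 comult_component_linear[OF assms(3)] N _ assms(2)])
    fix T Y assume T: "topspace T = X" "openin T Y" "card Y = n"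
    show "comult X (e T Y) Z \<in> tensor_grading K (M Z) (M (X - Z)) (DD_grading K Z) (DD_grading K (X - Z)) n"
    proof (cases "openin T Z \<and> Z \<subseteq> Y")
      case False
      then show ?thesis
        unfolding comult_e[OF assms(1) T(1,2) assms(3)] if_not_P[OF False]
        by (simp add: submodule_closed(2)[OF module_M2 N])
    next
      case True
      have Y: "Y \<subseteq> X" "finite Y" using openin_subset[OF T(2)] T(1) assms(1) finite_subset by auto
      have tops: "topspace (subtopology T Z) = Z" "topspace (subtopology T (X - Z)) = X - Z"
        using T(1) assms(3) by auto
      have opens: "openin (subtopology T Z) Z" "openin (subtopology T (X - Z)) (Y - Z)"
        unfolding openin_subtopology using True T(2) Y(1) by (auto intro: exI[of _ Z] exI[of _ Y])
      have "e (subtopology T Z) Z \<in> DD_grading K Z (card Z)"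
        "e (subtopology T (X - Z)) (Y - Z) \<in> DD_grading K (X - Z) (card (Y - Z))"
        by (rule e_grading[OF tops(1) opens(1) refl], rule e_grading[OF tops(2) opens(2) refl])
      \<comment> \<open>The degrees of the two tensor factors are \<open>card Z\<close> and
        \<open>card (Y - Z)\<close>; they sum to \<open>n\<close> because \<open>Z\<close> is
        contained in the mark.\<close>
      moreover have "card Z + card (Y - Z) = n"
        using True Y T(3) by (metis card_Diff_subset card_mono finite_subset le_add_diff_inverse)
      ultimately have "split_at T Y Z \<in> tensor_grading K (M Z) (M (X - Z)) (DD_grading K Z) (DD_grading K (X - Z)) n"
        unfolding tensor_grading_def T(1) by (intro lin_span_base) blast
      with True show ?thesis
        unfolding comult_e[OF assms(1) T(1,2) assms(3)] T(1) by simp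
    qed
  qed
qed

lemma species_graded_DD: "species_graded K (DD K) (DD_grading K)"
proof -
  have unit: "unit \<in> DD_grading K {} 0"
    by (rule e_grading) auto
  show ?thesis
    unfolding species_graded_def sp_obj_DD sp_unit_DD
    by (intro conjI allI impI ballI graded_module_DD image_subsetI map_grading mult_grading unit comult_grading) auto
qed

section \<open>Connectedness\<close>

lemma marked_topologies_empty: "marked_topologies {} = {(discrete_topology {}, {})}"
  by (auto simp: marked_topologies_def)

lemma species_connected_DD:
  assumes "\<one>\<^bsub>K\<^esub> \<noteq> \<zero>\<^bsub>K\<^esub>"
  shows "species_connected K (DD K :: ('b, 'k, 'b topology \<times> 'b set \<Rightarrow> 'k) bimon_species)"
proof -
  interpret K: cring K by (rule cring_K)
  \<comment> \<open>The unit is a basis vector; its coefficient one differs from zero in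
    \<open>K\<close>.\<close>
  have "unit \<noteq> \<zero>\<^bsub>M {}\<^esub>"
    using assms by (auto simp: free_module_simps basis_vec_def fun_eq_iff)
  moreover have "carrier (M ({} :: 'b set)) = {c \<odot>\<^bsub>M {}\<^esub> unit | c. c \<in> carrier K}" (is "?l = ?r")
  proof
    interpret M: module K "M {}" by (rule module_M)
    show "?r \<subseteq> ?l"
      using unit_closed by auto
    show "?l \<subseteq> ?r"
    proof
      fix f assume f: "f \<in> ?l"
      let ?d = "(discrete_topology {}, {})"
      have "f b = \<zero>\<^bsub>K\<^esub>" if "b \<noteq> ?d" for b
        using f that unfolding mem_free_module marked_topologies_empty by blast
      \<comment> \<open>All coefficients of \<open>f\<close> except the one at the single marked
        topology of the empty set vanish, so that coefficient is the required scalar.\<close>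
      then have "f = f ?d \<odot>\<^bsub>M {}\<^esub> unit"
        using free_module_coeff[OF f] by (auto simp: free_module_simps basis_vec_def fun_eq_iff)
      then show "f \<in> ?r"
        using free_module_coeff[OF f] by blast
    qed
  qed
  ultimately show ?thesis
    by (simp add: species_connected_def)
qed

end

theorem theorem2p1:
  fixes K :: "('k, 'm) ring_scheme"
    and D :: "('a, 'k, 'a topology \<times> 'a set \<Rightarrow> 'k) bimon_species"
    and DN :: "(nat, 'k, nat topology \<times> nat set \<Rightarrow> 'k) bimon_species"
  assumes "field K"
    and "D = DD K" and "DN = DD K"
  shows "bimonoid_no_counit K D \<and>
         species_commutative D \<and>
         species_graded K D (DD_grading K) \<and>
         species_connected K D \<and>
         bialgebra_no_counit K (fock_algebra K DN) (fock_comult K DN) \<and>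
         cring (fock_algebra K DN) \<and>
         bialgebra_graded K (fock_algebra K DN) (fock_comult K DN)
           (fock_grading K DN (DD_grading K))"
proof -
  interpret K: field K by fact
  interpret D: DD_species K
    by unfold_locales
  interpret DN: fock_graded K "DD K" "DD_grading K"
    by unfold_locales (rule D.linear_species_DD D.bimonoid_DD D.species_graded_DD)+
  show ?thesis
    unfolding assms(2,3)
    by (intro conjI D.bimonoid_DD D.species_commutative_DD D.species_graded_DD D.species_connected_DD
        K.one_not_zero DN.bialgebra_fock DN.cring_fock_algebra DN.bialgebra_graded_fock)
qed

end
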